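(* Let $n\ge2$, designate each of $1,\ldots,n-1$ as a left point or a right point, and let $\Theta$ be the associated Cambrian congruence on the weak order on $B_n$. Then $\Theta$ is the meet, in the lattice of congruences of $B_n$, of the meet-irreducible congruences $\Theta_o$, $\Theta_r$ and $\Theta_l$, where $\Theta_r$ is omitted if there are no right points and $\Theta_l$ is omitted if there are no left points.
   Context: $B_n$: signed permutations of $\{\pm1,\ldots,\pm n\}$ ($\pi(-i)=-\pi(i)$), one-line notation $\pi_1\cdots\pi_n$, long one-line notation $\pi_{-n}\cdots\pi_{-1}\pi_1\cdots\pi_n$. Weak order: $\sigma$ covers $\pi$ iff either $\pi_{-1}<\pi_1$ and $\sigma$ swaps $\pi_{-1},\pi_1$, or $\pi_i<\pi_{i+1}$ ($1\le i\le n-1$) and $\sigma$ swaps $\pi_i,\pi_{i+1}$ and $\pi_{-i-1},\pi_{-i}$; a finite lattice. Join-irreducible: covers exactly one element $j_*$. Lattice congruences (equivalence relations compatible with $\wedge,\vee$) form a lattice under refinement; $\Theta$ contracts $j$ if $j\equiv j_*$. The associated Cambrian congruence $\Theta$ is generated by contracting $s_0s_1=2(-1)3\cdots n$ and $s_0s_1s_0=(-2)(-1)3\cdots n$ if $1$ is a right point, or $s_1s_0=(-2)13\cdots n$ and $s_1s_0s_1=1(-2)3\cdots n$ if $1$ is a left point, and for $2\le i\le n-1$, $s_{i-1}s_i=1\cdots(i-2)\,i\,(i+1)(i-1)(i+2)\cdots n$ if $i$ is right, or $s_is_{i-1}=1\cdots(i-2)(i+1)(i-1)\,i\,(i+2)\cdots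 n$ if $i$ is left. Orbifold model: numbered points $1,\ldots,n$ above an orbifold point $\times$ (the origin) in the orbifold plane $\mathbb R^2/(x\sim -x)$. Type-B arcs, up to combinatorial equivalence: an orbifold arc with upper endpoint $p$ goes monotone downward from $p$ to $\times$ and is determined by $p$ and the sets $L(\alpha),R(\alpha)$ partitioning $\{1,\ldots,p-1\}$ into points left/right of it; a long arc with left endpoint $p$ and right endpoint $q\ne p$ consists of disjoint left and right pieces descending from $p$ and $q$ and joined by going around $\times$ below it, and is determined by $(p,q)$, $L(\alpha)$ (points in $(0,p)$ left of the left piece) and $R(\alpha)$ (points in $(0,q)$ right of the right piece), disjoint sets; the other points of $(0,\min(p,q))$ lie between the pieces; ordinary arcs join two numbered points. The join-irreducible elements $j$ of $B_n$ are in bijection with type-B arcs via $\delta^\circ(j)=\{\text{arc}\}$, where $\delta^\circ(\pi)$ is obtained from the centrally symmetric arc diagram $\delta(\pi)$ (on points $-n,\ldots,-1,1,\ldots,n$: for each pair of consecutive positions $a,b$ in the order $-n<\cdots<-1<1<\cdots<n$ with $\pi_a>\pi_b$, an arc from $\pi_a$ down to $\pi_b$ passing right of each $\pi_c$ with $\pi_b<\pi_c<\pi_a$, $c$ before $a$, and left of such $\pi_c$ with $c$ after $b$) by identifying $x$ with $-x$. Define $\beta_o$ as the orbifold arc with upper endpoint $n$ with $L(\beta_o)$ = the set of left points and $R(\beta_o)$ = the set of right points (it passes left of every right point and right of every left point). If there is a right point, let $r$ be the highest right point and $\beta_r$ the long arc with left endpoint $n$, right endpoint $r$, no numbered points between its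 pieces, $L(\beta_r)$ = left points in $(0,n)$, $R(\beta_r)$ = right points in $(0,r)$. If there is a left point, let $l$ be the highest left point and $\beta_l$ the long arc with right endpoint $n$, left endpoint $l$, no points between its pieces, $L(\beta_l)$ = left points in $(0,l)$, $R(\beta_l)$ = right points in $(0,n)$. For a type-B arc $\beta$, $\Theta_\beta$ denotes the coarsest congruence not contracting the join-irreducible element corresponding to $\beta$; set $\Theta_o=\Theta_{\beta_o}$, $\Theta_r=\Theta_{\beta_r}$, $\Theta_l=\Theta_{\beta_l}$. *)

theory Defs
  imports "HOL-Algebra.Lattice" "HOL-Combinatorics.Permutations" "HOL.Hull"
begin

section \<open>Signed permutations and the weak order\<close>

definition signed_points :: "nat \<Rightarrow> int set" where
  "signed_points n = {- int n .. int n} - {0}"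

definition signed_perms :: "nat \<Rightarrow> (int \<Rightarrow> int) set" where
  "signed_perms n = {\<pi>. \<pi> permutes signed_points n \<and> (\<forall>i. \<pi> (- i) = - \<pi> i)}"

definition simple_refl :: "int \<Rightarrow> int \<Rightarrow> int" where
  "simple_refl i =
     (if i = 0 then transpose (- 1) 1
      else transpose i (i + 1) \<circ> transpose (- i - 1) (- i))"

text \<open>
  Precomposing with \<^term>\<open>simple_refl i\<close> permutes positions: it swaps the entries in positions
  \<open>-1, 1\<close> if \<open>i = 0\<close>, and otherwise those in positions \<open>i, i+1\<close> and those in \<open>-i-1, -i\<close>.
\<close>

definition weak_covers :: "nat \<Rightarrow> (int \<Rightarrow> int) \<Rightarrow> (int \<Rightarrow> int) \<Rightarrow> bool" where
  "weak_covers n \<sigma> \<pi> \<longleftrightarrow>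
     \<sigma> \<in> signed_perms n \<and> \<pi> \<in> signed_perms n \<and>
     (\<pi> (- 1) < \<pi> 1 \<and> \<sigma> = \<pi> \<circ> simple_refl 0 \<or>
      (\<exists>i\<in>{1 .. int n - 1}. \<pi> i < \<pi> (i + 1) \<and> \<sigma> = \<pi> \<circ> simple_refl i))"

definition weak_order :: "nat \<Rightarrow> (int \<Rightarrow> int) gorder" where
  "weak_order n =
     \<lparr>carrier = signed_perms n, eq = (=), le = (\<lambda>\<pi> \<sigma>. weak_covers n \<sigma> \<pi>)\<^sup>*\<^sup>*\<rparr>"

definition join_irreducible :: "nat \<Rightarrow> (int \<Rightarrow> int) \<Rightarrow> bool" where
  "join_irreducible n j \<longleftrightarrow> j \<in> signed_perms n \<and> (\<exists>!\<pi>. weak_covers n j \<pi>)"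

definition lower_cover :: "nat \<Rightarrow> (int \<Rightarrow> int) \<Rightarrow> int \<Rightarrow> int" where
  "lower_cover n j = (THE \<pi>. weak_covers n j \<pi>)"


section \<open>Lattice congruences\<close>

definition lattice_congruence :: "('a, 'b) gorder_scheme \<Rightarrow> 'a rel \<Rightarrow> bool" where
  "lattice_congruence P \<theta> \<longleftrightarrow>
     equiv (carrier P) \<theta> \<and>
     (\<forall>x x' y y'. (x, x') \<in> \<theta> \<longrightarrow> (y, y') \<in> \<theta> \<longrightarrow>
        (x \<squnion>\<^bsub>P\<^esub> y, x' \<squnion>\<^bsub>P\<^esub> y') \<in> \<theta> \<and> (x \<sqinter>\<^bsub>P\<^esub> y, x' \<sqinter>\<^bsub>P\<^esub> y') \<in> \<theta>)"

text \<open>Refinement order: finer congruences are smaller, so the coarsest one is the greatest.\<close>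

definition congruences :: "('a, 'b) gorder_scheme \<Rightarrow> 'a rel gorder" where
  "congruences P = \<lparr>carrier = Collect (lattice_congruence P), eq = (=), le = (\<subseteq>)\<rparr>"

definition covers :: "('a, 'b) gorder_scheme \<Rightarrow> 'a \<Rightarrow> 'a \<Rightarrow> bool" where
  "covers P y x \<longleftrightarrow>
     x \<in> carrier P \<and> y \<in> carrier P \<and> x \<sqsubset>\<^bsub>P\<^esub> y \<and>
     (\<forall>z\<in>carrier P. \<not> (x \<sqsubset>\<^bsub>P\<^esub> z \<and> z \<sqsubset>\<^bsub>P\<^esub> y))"

definition meet_irreducible :: "('a, 'b) gorder_scheme \<Rightarrow> 'a \<Rightarrow> bool" where
  "meet_irreducible P x \<longleftrightarrow> x \<in> carrier P \<and> (\<exists>!y. covers P y x)"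

definition contracts :: "nat \<Rightarrow> (int \<Rightarrow> int) rel \<Rightarrow> (int \<Rightarrow> int) \<Rightarrow> bool" where
  "contracts n \<theta> j \<longleftrightarrow> (j, lower_cover n j) \<in> \<theta>"


section \<open>Cambrian congruences\<close>

text \<open>
  \<open>L\<close> and \<open>R\<close> are the sets of left and right points. In one-line notation the elements below are
  \<open>s0 s1 = 2 (-1) 3 \<dots> n\<close>, \<open>s0 s1 s0 = (-2) (-1) 3 \<dots> n\<close>,
  \<open>s1 s0 = (-2) 1 3 \<dots> n\<close>, \<open>s1 s0 s1 = 1 (-2) 3 \<dots> n\<close>, and for \<open>i \<ge> 2\<close>
  the words \<open>i (i+1) (i-1)\<close> (right) and \<open>(i+1) (i-1) i\<close> (left) in positions \<open>i-1, i, i+1\<close>.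
\<close>

definition cambrian_generators :: "nat \<Rightarrow> int set \<Rightarrow> int set \<Rightarrow> (int \<Rightarrow> int) set" where
  "cambrian_generators n L R =
     (if 1 \<in> R then {simple_refl 0 \<circ> simple_refl 1,
                     simple_refl 0 \<circ> simple_refl 1 \<circ> simple_refl 0} else {}) \<union>
     (if 1 \<in> L then {simple_refl 1 \<circ> simple_refl 0,
                     simple_refl 1 \<circ> simple_refl 0 \<circ> simple_refl 1} else {}) \<union>
     {simple_refl (i - 1) \<circ> simple_refl i | i. i \<in> {2 .. int n - 1} \<inter> R} \<union>
     {simple_refl i \<circ> simple_refl (i - 1) | i. i \<in> {2 .. int n - 1} \<inter> L}"

definition cambrian_congruence :: "nat \<Rightarrow> int set \<Rightarrow> int set \<Rightarrow> (int \<Rightarrow> int) rel" where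
  "cambrian_congruence n L R =
     lattice_congruence (weak_order n) hull
       {(j, lower_cover n j) | j. j \<in> cambrian_generators n L R}"


section \<open>Arcs\<close>

text \<open>
  An arc on the points \<open>-n, \<dots>, -1, 1, \<dots>, n\<close>, up to combinatorial equivalence, is given by its upper
  and lower endpoints and the sets of points at intermediate heights lying to the left and to
  the right of it.
\<close>

datatype arc = Arc (upper: int) (lower: int) (left_of: "int set") (right_of: "int set")

text \<open>
  The arcs of \<open>\<delta>(\<pi>)\<close> come from the descents at consecutive positions \<open>a < b\<close>. Entries before
  position \<open>a\<close> lie to the left of the arc, entries after position \<open>b\<close> to its right.
\<close>

definition arc_diagram :: "nat \<Rightarrow> (int \<Rightarrow> int) \<Rightarrow> arc set" where
  "arc_diagram n \<pi> =
     {Arc (\<pi> a) (\<pi> b)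
        {\<pi> c | c. c \<in> signed_points n \<and> c < a \<and> \<pi> b < \<pi> c \<and> \<pi> c < \<pi> a}
        {\<pi> c | c. c \<in> signed_points n \<and> b < c \<and> \<pi> b < \<pi> c \<and> \<pi> c < \<pi> a} | a b.
      a \<in> signed_points n \<and> b \<in> signed_points n \<and> a < b \<and>
      (\<forall>c\<in>signed_points n. \<not> (a < c \<and> c < b)) \<and> \<pi> a > \<pi> b}"

text \<open>
  The half-turn \<open>x \<mapsto> -x\<close> exchanges up with down and left with right. An arc in the orbifold
  is represented by the set of its lifts to the plane, an orbit under the half-turn.
\<close>

definition half_turn :: "arc \<Rightarrow> arc" where
  "half_turn \<alpha> = Arc (- lower \<alpha>) (- upper \<alpha>) (uminus ` right_of \<alpha>) (uminus ` left_of \<alpha>)"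

definition orbifold_image :: "arc \<Rightarrow> arc set" where
  "orbifold_image \<alpha> = {\<alpha>, half_turn \<alpha>}"

definition orbifold_diagram :: "nat \<Rightarrow> (int \<Rightarrow> int) \<Rightarrow> arc set set" where
  "orbifold_diagram n \<pi> = orbifold_image ` arc_diagram n \<pi>"

text \<open>
  The orbifold arc with upper endpoint \<open>p\<close> and data \<open>L\<close>, \<open>R\<close> (a partition of \<open>{1, \<dots>, p-1}\<close>) lifts to
  the centrally symmetric arc from \<open>p\<close> through the origin to \<open>-p\<close>.
\<close>

definition orbifold_arc :: "int \<Rightarrow> int set \<Rightarrow> int set \<Rightarrow> arc set" where
  "orbifold_arc p L R = orbifold_image (Arc p (- p) (L \<union> uminus ` R) (R \<union> uminus ` L))"

text \<open>
  The long arc with left endpoint \<open>p\<close> and right endpoint \<open>q\<close>, where \<open>L\<close> and \<open>R\<close> are the points left of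
  the left piece and right of the right piece. The lift starting at \<open>p\<close> follows the left piece
  and passes to the left of the origin; it then continues below the horizontal axis along the
  half-turn of the right piece, ending at \<open>-q\<close>.
\<close>

definition long_arc :: "int \<Rightarrow> int \<Rightarrow> int set \<Rightarrow> int set \<Rightarrow> arc set" where
  "long_arc p q L R =
     orbifold_image (Arc p (- q) (L \<union> uminus ` R)
                             (({0<..<p} - L) \<union> uminus ` ({0<..<q} - R)))"

definition join_irreducible_of_arc :: "nat \<Rightarrow> arc set \<Rightarrow> int \<Rightarrow> int" where
  "join_irreducible_of_arc n \<beta> = (THE j. join_irreducible n j \<and> orbifold_diagram n j = {\<beta>})"

definition arc_congruence :: "nat \<Rightarrow> arc set \<Rightarrow> (int \<Rightarrow> int) rel" where
  "arc_congruence n \<beta> =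
     (GREATEST \<theta>. lattice_congruence (weak_order n) \<theta> \<and>
        \<not> contracts n \<theta> (join_irreducible_of_arc n \<beta>))"

definition beta_o :: "nat \<Rightarrow> int set \<Rightarrow> int set \<Rightarrow> arc set" where
  "beta_o n L R = orbifold_arc (int n) L R"

definition beta_r :: "nat \<Rightarrow> int set \<Rightarrow> int set \<Rightarrow> arc set" where
  "beta_r n L R = long_arc (int n) (Max R) L (R \<inter> {0<..<Max R})"

definition beta_l :: "nat \<Rightarrow> int set \<Rightarrow> int set \<Rightarrow> arc set" where
  "beta_l n L R = long_arc (Max L) (int n) (L \<inter> {0<..<Max L}) R"

end

(*
  A permutation is encoded by its inversion set, which turns the weak order into the inclusion
  order on biclosed sets. Let M be the set of left points together with the negatives of the right
  points. Two permutations are called equivalent if their inversion sets contain the same shards,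
  where the shard of b > a consists of the pairs (c, d) with b >= c > d >= a, c in M or c = b,
  and d not in M or d = a. Meets clearly respect this relation; joins do, because it can also be
  described by the pairs whose dual shard is disjoint from the inversion set. So it is a congruence,
  and it separates a cover exactly when the arc of the cover passes left of the points outside M
  and right of the points of M.

  Edges with the same arc are contracted together by every congruence, and the hexagons and
  octagons of the weak order show that contracting an arc contracts every arc that it can be cut
  out of. Cutting an arc with a misplaced point down to a generator shows that the
  Cambrian congruence contains the shard congruence; lengthening an arc without misplaced points
  ends at one of the three arcs beta, so the meet of the three congruences is
  contained in the shard congruence.
*)

theory Submission
  imports Defs
begin

section \<open>Congruences of a lattice\<close>

text \<open>The central symmetry shapes the argument. Moving an entry c also moves - c, so three
  entries can be brought into consecutive positions, with all other points on prescribed sides, only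
  if the configuration does not collide with its own negative. Hence \<open>hexagon\<close> carries
  a sign s for the half of the positions that hosts it, together with a separation hypothesis; arcs
  that admit no such cut are cut at the centre by \<open>octagon\<close>. The same constraint
  explains the three maximal arcs. The half-turn allows b >= - a, and then the upper end can always
  be raised to n. A positive lower end leads to the central arc by an octagon. A negative lower end
  - q is moved by a hexagon to - m with m on the same side as q, so the process stops at the highest
  right or left point. Configurations are not written as permutations. A key, that is, an odd
  injective function on the points, assigns virtual positions with arbitrary gaps, and only the
  order of its values matters.\<close>

context lattice
begin

lemma join_absorb: "x \<in> carrier L \<Longrightarrow> y \<in> carrier L \<Longrightarrow> x \<sqsubseteq> y \<Longrightarrow> x \<squnion> y = y"
  by (rule le_antisym) (auto intro: join_le join_right)

lemma meet_absorb: "x \<in> carrier L \<Longrightarrow> y \<in> carrier L \<Longrightarrow> x \<sqsubseteq> y \<Longrightarrow> x \<sqinter> y = x"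
  by (rule le_antisym) (auto intro: meet_le meet_left)

lemma join_commute: "x \<squnion> y = y \<squnion> x"
  by (simp add: join_def insert_commute)

lemma congruence_carrier:
  assumes "lattice_congruence L \<theta>" "(x, y) \<in> \<theta>"
  shows "x \<in> carrier L" "y \<in> carrier L"
  using assms unfolding lattice_congruence_def equiv_def by auto

lemma congruence_refl: "lattice_congruence L \<theta> \<Longrightarrow> x \<in> carrier L \<Longrightarrow> (x, x) \<in> \<theta>"
  unfolding lattice_congruence_def equiv_def refl_on_def by auto

lemma congruence_sym: "lattice_congruence L \<theta> \<Longrightarrow> (x, y) \<in> \<theta> \<Longrightarrow> (y, x) \<in> \<theta>"
  unfolding lattice_congruence_def equiv_def sym_def by auto

lemma congruence_trans:
  "lattice_congruence L \<theta> \<Longrightarrow> (x, y) \<in> \<theta> \<Longrightarrow> (y, z) \<in> \<theta> \<Longrightarrow> (x, z) \<in> \<theta>"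
  unfolding lattice_congruence_def equiv_def trans_def by blast

lemma congruence_join:
  assumes "lattice_congruence L \<theta>" "(x, y) \<in> \<theta>" "z \<in> carrier L"
  shows "(x \<squnion> z, y \<squnion> z) \<in> \<theta>" "(z \<squnion> x, z \<squnion> y) \<in> \<theta>"
  using assms congruence_refl[OF assms(1,3)] unfolding lattice_congruence_def by blast+

lemma congruence_meet:
  assumes "lattice_congruence L \<theta>" "(x, y) \<in> \<theta>" "z \<in> carrier L"
  shows "(x \<sqinter> z, y \<sqinter> z) \<in> \<theta>" "(z \<sqinter> x, z \<sqinter> y) \<in> \<theta>"
  using assms congruence_refl[OF assms(1,3)] unfolding lattice_congruence_def by blast+

text \<open>Joining both members of (x, y) with z, and then with w, shows that z and w are each
  congruent to y.\<close>

lemma congruence_interval: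
  assumes C: "lattice_congruence L \<theta>" and xy: "(x, y) \<in> \<theta>"
    and le: "x \<sqsubseteq> z" "z \<sqsubseteq> w" "w \<sqsubseteq> y" and car: "z \<in> carrier L" "w \<in> carrier L"
  shows "(z, w) \<in> \<theta>"
proof -
  have c: "x \<in> carrier L" "y \<in> carrier L" using congruence_carrier[OF C xy] .
  have zy: "z \<sqsubseteq> y" using le car c le_trans by blast
  have xw: "x \<sqsubseteq> w" using le car c le_trans by blast
  have 1: "(z, y) \<in> \<theta>" using congruence_join(1)[OF C xy car(1)]
    join_absorb[OF c(1) car(1) le(1)] join_absorb[OF car(1) c(2) zy] by (simp add: join_commute)
  have 2: "(w, y) \<in> \<theta>" using congruence_join(1)[OF C xy car(2)]
    join_absorb[OF c(1) car(2) xw] join_absorb[OF car(2) c(2) le(3)] by (simp add: join_commute)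
  show ?thesis using congruence_trans[OF C 1 congruence_sym[OF C 2]] .
qed

lemma congruence_inf_sup:
  assumes C: "lattice_congruence L \<theta>" and xy: "(x, y) \<in> \<theta>"
  shows "(x \<sqinter> y, x \<squnion> y) \<in> \<theta>"
proof -
  have c: "x \<in> carrier L" "y \<in> carrier L" using congruence_carrier[OF C xy] .
  have "(x \<sqinter> y, y) \<in> \<theta>"
    using congruence_meet(1)[OF C xy c(2)] meet_absorb[of y y] c by simp
  moreover have "(y, x \<squnion> y) \<in> \<theta>"
    using congruence_join(1)[OF C congruence_sym[OF C xy] c(2)] join_absorb[of y y] c by simp
  ultimately show ?thesis using congruence_trans[OF C] by blast
qed

text \<open>Here u is the bottom of a polygon, p' and q' are its atoms, and p and q are the last
  elements of the two sides below the top, the join of the atoms. Joining (u, p') with q' contracts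
  everything from q' to the top; meeting the result with p carries the contraction back to the first
  side. Only inequalities are required, so the sides may have any length and hexagons and octagons
  are treated alike.\<close>

lemma congruence_polygon:
  assumes C: "lattice_congruence L \<theta>"
    and car: "u \<in> carrier L" "p' \<in> carrier L" "p \<in> carrier L" "q' \<in> carrier L" "q \<in> carrier L"
    and le: "u \<sqsubseteq> p'" "p' \<sqsubseteq> p" "u \<sqsubseteq> q'" "q' \<sqsubseteq> q"
    and meet: "p \<sqinter> q' \<sqsubseteq> u" "q \<sqinter> p' \<sqsubseteq> u"
    and join: "p \<sqsubseteq> p' \<squnion> q'" "q \<sqsubseteq> p' \<squnion> q'"
    and contr: "(u, p') \<in> \<theta>"
  shows "(p', p) \<in> \<theta>" "(q', q) \<in> \<theta>"
proof -
  have t: "(q', p' \<squnion> q') \<in> \<theta>"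
    using congruence_join(1)[OF C contr car(4)] join_absorb[OF car(1,4) le(3)] by simp
  have tc: "p' \<squnion> q' \<in> carrier L" using car by simp
  show "(q', q) \<in> \<theta>"
    using congruence_interval[OF C t _ le(4) join(2)] car by simp
  have "(p \<sqinter> q', p) \<in> \<theta>"
    using congruence_meet(2)[OF C t car(3)] meet_absorb[OF car(3) tc join(1)] by simp
  moreover have "p \<sqinter> q' \<sqsubseteq> p'" using le_trans[OF meet(1) le(1)] car by simp
  ultimately show "(p', p) \<in> \<theta>"
    using congruence_interval[OF C _ _ le(2)] car by simp
qed

section \<open>Intersections, generated congruences and joins of congruences\<close>

lemma total_congruence: "lattice_congruence L (carrier L \<times> carrier L)"
  unfolding lattice_congruence_def equiv_def refl_on_def sym_def trans_def by auto

lemma congruence_Inter: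
  assumes T: "\<And>\<theta>. \<theta> \<in> T \<Longrightarrow> lattice_congruence L \<theta>" and ne: "T \<noteq> {}"
  shows "lattice_congruence L (\<Inter>T)"
  unfolding lattice_congruence_def
proof (intro conjI allI impI equivI)
  obtain \<theta>0 where "\<theta>0 \<in> T" using ne by blast
  then show "\<Inter>T \<subseteq> carrier L \<times> carrier L" using congruence_carrier[OF T] by auto
  show "refl_on (carrier L) (\<Inter>T)" by (rule refl_onI) (use congruence_refl[OF T] in auto)
  show "sym (\<Inter>T)" by (rule symI) (use congruence_sym[OF T] in auto)
  show "trans (\<Inter>T)" by (rule transI) (use congruence_trans[OF T] in blast)
next
  fix x x' y y' assume "(x, x') \<in> \<Inter>T" "(y, y') \<in> \<Inter>T"
  then show "(x \<squnion> y, x' \<squnion> y') \<in> \<Inter>T" "(x \<sqinter> y, x' \<sqinter> y') \<in> \<Inter>T"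
    using T unfolding lattice_congruence_def by auto
qed

lemma congruence_hull:
  assumes "S \<subseteq> carrier L \<times> carrier L"
  shows "lattice_congruence L (lattice_congruence L hull S)"
proof -
  have "carrier L \<times> carrier L \<in> {t. lattice_congruence L t \<and> S \<subseteq> t}"
    using assms total_congruence by simp
  then show ?thesis unfolding hull_def by (intro congruence_Inter) blast+
qed

text \<open>This is the join in the lattice of congruences. Compatibility is checked one argument at
  a time, because a unary operation maps a chain to a chain link by link.\<close>

lemma congruence_trancl_Union:
  assumes T: "\<And>\<theta>. \<theta> \<in> T \<Longrightarrow> lattice_congruence L \<theta>" and ne: "T \<noteq> {}"
  shows "lattice_congruence L ((\<Union>T)\<^sup>+)"
proof -
  have step: "(f x, f y) \<in> (\<Union>T)\<^sup>+"
    if xy: "(x, y) \<in> (\<Union>T)\<^sup>+"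
      and f: "\<And>x y \<theta>. \<theta> \<in> T \<Longrightarrow> (x, y) \<in> \<theta> \<Longrightarrow> (f x, f y) \<in> \<theta>" for f x y
    using xy
  proof (induction rule: trancl_induct)
    case (base y)
    then obtain \<theta> where "\<theta> \<in> T" "(x, y) \<in> \<theta>" by auto
    then have "(f x, f y) \<in> \<Union>T" using f by auto
    then show ?case by auto
  next
    case (step y z)
    then obtain \<theta> where "\<theta> \<in> T" "(y, z) \<in> \<theta>" by auto
    then have "(f y, f z) \<in> \<Union>T" using f by auto
    with step.IH show ?case by (rule trancl_into_trancl)
  qed
  have sub: "(\<Union>T)\<^sup>+ \<subseteq> carrier L \<times> carrier L"
  proof (rule trancl_subset_Sigma, rule subrelI)
    fix x y assume "(x, y) \<in> \<Union>T"
    then obtain \<theta> where "\<theta> \<in> T" "(x, y) \<in> \<theta>" by auto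
    then show "(x, y) \<in> carrier L \<times> carrier L" using congruence_carrier[OF T] by auto
  qed
  have sm: "sym ((\<Union>T)\<^sup>+)"
  proof (rule sym_trancl, rule symI)
    fix x y assume "(x, y) \<in> \<Union>T"
    then obtain \<theta> where "\<theta> \<in> T" "(x, y) \<in> \<theta>" by auto
    then show "(y, x) \<in> \<Union>T" using congruence_sym[OF T] by auto
  qed
  obtain \<theta>0 where \<theta>0: "\<theta>0 \<in> T" using ne by auto
  show ?thesis
    unfolding lattice_congruence_def
  proof (intro conjI allI impI equivI)
    show "refl_on (carrier L) ((\<Union>T)\<^sup>+)"
    proof (rule refl_onI)
      fix x assume "x \<in> carrier L"
      then have "(x, x) \<in> \<Union>T" using congruence_refl[OF T[OF \<theta>0]] \<theta>0 by auto
      then show "(x, x) \<in> (\<Union>T)\<^sup>+" by auto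
    qed
  next
    fix x x' y y' assume xy: "(x, x') \<in> (\<Union>T)\<^sup>+" "(y, y') \<in> (\<Union>T)\<^sup>+"
    have c: "y \<in> carrier L" "x' \<in> carrier L" using sub xy by auto
    have "(x \<squnion> y, x' \<squnion> y) \<in> (\<Union>T)\<^sup>+"
      by (rule step[OF xy(1)]) (rule congruence_join(1)[OF T _ c(1)])
    moreover have "(x' \<squnion> y, x' \<squnion> y') \<in> (\<Union>T)\<^sup>+"
      by (rule step[OF xy(2)]) (rule congruence_join(2)[OF T _ c(2)])
    ultimately show "(x \<squnion> y, x' \<squnion> y') \<in> (\<Union>T)\<^sup>+" by (rule trancl_trans)
    have "(x \<sqinter> y, x' \<sqinter> y) \<in> (\<Union>T)\<^sup>+"
      by (rule step[OF xy(1)]) (rule congruence_meet(1)[OF T _ c(1)])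
    moreover have "(x' \<sqinter> y, x' \<sqinter> y') \<in> (\<Union>T)\<^sup>+"
      by (rule step[OF xy(2)]) (rule congruence_meet(2)[OF T _ c(2)])
    ultimately show "(x \<sqinter> y, x' \<sqinter> y') \<in> (\<Union>T)\<^sup>+" by (rule trancl_trans)
  qed (use sub sm trans_trancl in simp_all)
qed

text \<open>Projecting a chain into the two-element interval shows that a join of congruences can
  contract a covering pair only if one of its members does.\<close>

lemma Greatest_congruence_separating:
  assumes car: "j \<in> carrier L" "i \<in> carrier L" and le: "i \<sqsubseteq> j" and ne: "i \<noteq> j"
    and cov: "\<And>z. z \<in> carrier L \<Longrightarrow> i \<sqsubseteq> z \<Longrightarrow> z \<sqsubseteq> j \<Longrightarrow> z = i \<or> z = j"
  defines "P \<equiv> \<lambda>\<theta>. lattice_congruence L \<theta> \<and> (j, i) \<notin> \<theta>"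
  shows "P (Greatest P)" "\<And>\<theta>. P \<theta> \<Longrightarrow> \<theta> \<subseteq> Greatest P"
proof -
  define U where "U = (\<Union>(Collect P))\<^sup>+"
  define g where "g z = (z \<squnion> i) \<sqinter> j" for z
  have "lattice_congruence L (Id_on (carrier L))"
    unfolding lattice_congruence_def equiv_def refl_on_def sym_def trans_def by auto
  then have P0: "Id_on (carrier L) \<in> Collect P" using ne by (simp add: P_def Id_on_iff)
  have CU: "lattice_congruence L U"
    unfolding U_def
  proof (rule congruence_trancl_Union)
    show "Collect P \<noteq> {}" using P0 by auto
  qed (simp add: P_def)
  have gij: "g z = i \<or> g z = j" if "z \<in> carrier L" for z
  proof (rule cov)
    show "g z \<in> carrier L" "g z \<sqsubseteq> j" using that car meet_right unfolding g_def by auto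
    have "i \<sqsubseteq> z \<squnion> i" using join_right that car by simp
    then show "i \<sqsubseteq> g z" unfolding g_def using meet_le[of i "z \<squnion> i" j] le that car by simp
  qed
  have geq: "g x = g y" if "P \<theta>" "(x, y) \<in> \<theta>" for \<theta> x y
  proof -
    have C: "lattice_congruence L \<theta>" and n: "(j, i) \<notin> \<theta>" using that(1) unfolding P_def by auto
    have "(g x, g y) \<in> \<theta>"
      unfolding g_def using congruence_meet(1)[OF C congruence_join(1)[OF C that(2) car(2)] car(1)] .
    moreover have "(i, j) \<notin> \<theta>" using n congruence_sym[OF C] by auto
    ultimately show ?thesis using n gij congruence_carrier[OF C that(2)] by metis
  qed
  have "g x = g y" if "(x, y) \<in> U" for x y
    using that unfolding U_def by (induction rule: trancl_induct) (use geq in auto)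
  moreover have "g i = i" "g j = j"
    using join_absorb[of i i] join_absorb[of i j] meet_absorb[of i j] meet_absorb[of j j] car le
    unfolding g_def by (auto simp: join_commute[of j i])
  ultimately have PU: "P U" using CU ne unfolding P_def by auto
  have max: "\<theta> \<subseteq> U" if "P \<theta>" for \<theta> using that unfolding U_def by auto
  have eq: "Greatest P = U" by (rule Greatest_equality) (use PU max in auto)
  show "P (Greatest P)" "\<And>\<theta>. P \<theta> \<Longrightarrow> \<theta> \<subseteq> Greatest P" unfolding eq using PU max by auto
qed

text \<open>A congruence strictly above \<Theta> must contract (j, i), so it contains the congruence
  generated by \<Theta> and this pair. That congruence is therefore the only cover of
  \<Theta>.\<close>

lemma meet_irreducible_Greatest:
  assumes car: "j \<in> carrier L" "i \<in> carrier L"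
    and P: "lattice_congruence L \<Theta>" "(j, i) \<notin> \<Theta>"
    and max: "\<And>\<theta>. lattice_congruence L \<theta> \<Longrightarrow> (j, i) \<notin> \<theta> \<Longrightarrow> \<theta> \<subseteq> \<Theta>"
  shows "meet_irreducible (congruences L) \<Theta>"
proof -
  let ?H = "lattice_congruence L hull (insert (j, i) \<Theta>)"
  have "insert (j, i) \<Theta> \<subseteq> carrier L \<times> carrier L"
    using car congruence_carrier[OF P(1)] by auto
  then have H: "lattice_congruence L ?H" by (rule congruence_hull)
  have sub: "insert (j, i) \<Theta> \<subseteq> ?H" by (rule hull_subset)
  have above: "?H \<subseteq> \<theta>" if "lattice_congruence L \<theta>" "\<Theta> \<subset> \<theta>" for \<theta>
  proof (rule hull_minimal)
    have "(j, i) \<in> \<theta>" using max[OF that(1)] that(2) by auto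
    then show "insert (j, i) \<Theta> \<subseteq> \<theta>" using that(2) by auto
  qed (rule that(1))
  have cov: "covers (congruences L) \<theta> \<Theta> \<longleftrightarrow>
      lattice_congruence L \<theta> \<and> \<Theta> \<subset> \<theta> \<and> (\<forall>z. lattice_congruence L z \<longrightarrow> \<not> (\<Theta> \<subset> z \<and> z \<subset> \<theta>))" for \<theta>
    using P(1) by (simp add: covers_def congruences_def lless_def psubset_eq)
  have lt: "\<Theta> \<subset> ?H" using sub P(2) by auto
  have "covers (congruences L) ?H \<Theta>"
    unfolding cov
  proof (intro conjI allI impI notI)
    fix z assume "lattice_congruence L z" "\<Theta> \<subset> z \<and> z \<subset> ?H"
    then show False using above[of z] by (simp add: psubset_eq)
  qed (rule H lt)+
  moreover have "\<theta> = ?H" if "covers (congruences L) \<theta> \<Theta>" for \<theta>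
  proof (rule ccontr)
    assume "\<theta> \<noteq> ?H"
    then have "?H \<subset> \<theta>" using above[of \<theta>] that[unfolded cov] by (simp add: psubset_eq)
    then show False using that[unfolded cov] H lt by simp
  qed
  ultimately have "\<exists>!\<theta>. covers (congruences L) \<theta> \<Theta>" by (rule ex1I)
  then show ?thesis using P(1) by (simp add: meet_irreducible_def congruences_def)
qed

end

section \<open>Signed permutations and inversion sets\<close>

abbreviation pts :: "nat \<Rightarrow> int set" where
  "pts \<equiv> signed_points"

abbreviation weak_congruence :: "nat \<Rightarrow> (int \<Rightarrow> int) rel \<Rightarrow> bool" where
  "weak_congruence n \<equiv> lattice_congruence (weak_order n)"

text \<open>Pairs of entries are recorded, not pairs of positions, so that passing to a cover only
  adds pairs. A reflection shows up as (c, d) together with (- d, - c); the two coincide when d = -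
  c.\<close>

definition invs :: "nat \<Rightarrow> (int \<Rightarrow> int) \<Rightarrow> (int \<times> int) set" where
  "invs n w = {(c, d). c \<in> pts n \<and> d \<in> pts n \<and> d < c \<and> inv w c < inv w d}"

lemma signed_points_iff: "c \<in> pts n \<longleftrightarrow> - int n \<le> c \<and> c \<le> int n \<and> c \<noteq> 0"
  by (auto simp: signed_points_def)

lemma finite_signed_points [simp]: "finite (pts n)"
  by (simp add: signed_points_def)

lemma uminus_signed_points [simp]: "- c \<in> pts n \<longleftrightarrow> c \<in> pts n"
  by (auto simp: signed_points_iff)

lemma signed_perms_permutes: "w \<in> signed_perms n \<Longrightarrow> w permutes pts n"
  by (simp add: signed_perms_def)

lemma signed_perms_uminus: "w \<in> signed_perms n \<Longrightarrow> w (- i) = - w i"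
  by (simp add: signed_perms_def)

lemma signed_perms_inv:
  assumes "w \<in> signed_perms n" shows "inv w \<in> signed_perms n"
proof -
  have p: "w permutes pts n" using assms by (rule signed_perms_permutes)
  have "inv w (- i) = - inv w i" for i
  proof -
    have "w (- inv w i) = - i"
      using signed_perms_uminus[OF assms] permutes_inverses(1)[OF p] by simp
    then show ?thesis using permutes_inverses(2)[OF p] by metis
  qed
  then show ?thesis using permutes_inv[OF p] by (simp add: signed_perms_def)
qed

lemma signed_perms_comp:
  "v \<in> signed_perms n \<Longrightarrow> w \<in> signed_perms n \<Longrightarrow> v \<circ> w \<in> signed_perms n"
  by (auto simp: signed_perms_def permutes_compose)

lemma signed_perms_in [simp]: "w \<in> signed_perms n \<Longrightarrow> w c \<in> pts n \<longleftrightarrow> c \<in> pts n"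
  by (simp add: signed_perms_permutes permutes_in_image)

lemma signed_perms_eq_iff: "w \<in> signed_perms n \<Longrightarrow> w c = w d \<longleftrightarrow> c = d"
  using permutes_inj[OF signed_perms_permutes] by (auto simp: inj_eq)

lemma signed_perms_inverses:
  assumes "w \<in> signed_perms n" shows "w (inv w c) = c" "inv w (w c) = c"
  using permutes_inverses[OF signed_perms_permutes[OF assms]] by auto

text \<open>Counting up from a value of at least 1 bounds each entry from below by its position;
  counting down from a value of at most n bounds it from above.\<close>

lemma increasing_signed_perm_is_id:
  assumes g: "g \<in> signed_perms n" and pos: "n > 0 \<Longrightarrow> g 1 > 0"
    and inc: "\<And>i. 1 \<le> i \<Longrightarrow> i < int n \<Longrightarrow> g i < g (i + 1)"
  shows "g = id"
proof -
  have lower: "1 \<le> k \<Longrightarrow> k \<le> n \<Longrightarrow> int k \<le> g (int k)" for k :: nat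
  proof (induction k)
    case (Suc k)
    show ?case
    proof (cases "k = 0")
      case True then show ?thesis using pos Suc by simp
    next
      case False
      then show ?thesis using Suc inc[of "int k"] by (simp add: add.commute)
    qed
  qed simp
  have upper: "k < n \<Longrightarrow> g (int (n - k)) \<le> int (n - k)" for k
  proof (induction k)
    case 0
    then have "g (int n) \<in> pts n"
      by (subst signed_perms_in[OF g]) (simp add: signed_points_iff)
    then show ?case by (simp add: signed_points_iff)
  next
    case (Suc k)
    have e: "int (n - k) = int (n - Suc k) + 1" using Suc.prems by simp
    have "g (int (n - Suc k)) < g (int (n - k))" unfolding e using Suc.prems by (intro inc) auto
    then show ?case using Suc e by simp
  qed
  have pos_eq: "g (int k) = int k" if "1 \<le> k" "k \<le> n" for k
    using lower[OF that] upper[of "n - k"] that by simp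
  have "g i = i" for i
  proof (cases "i \<in> pts n")
    case False then show ?thesis using signed_perms_permutes[OF g] by (simp add: permutes_def)
  next
    case True
    show ?thesis
    proof (cases "i > 0")
      case True
      then have "1 \<le> nat i" "nat i \<le> n" using \<open>i \<in> pts n\<close> by (auto simp: signed_points_iff)
      then show ?thesis using pos_eq[of "nat i"] True by simp
    next
      case False
      then have "1 \<le> nat (- i)" "nat (- i) \<le> n" using \<open>i \<in> pts n\<close> by (auto simp: signed_points_iff)
      then show ?thesis using pos_eq[of "nat (- i)"] False signed_perms_uminus[OF g, of i] by simp
    qed
  qed
  then show ?thesis by auto
qed

lemma invs_iff:
  "(c, d) \<in> invs n w \<longleftrightarrow> c \<in> pts n \<and> d \<in> pts n \<and> d < c \<and> inv w c < inv w d"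
  by (simp add: invs_def)

lemma invs_uminus:
  assumes "w \<in> signed_perms n"
  shows "(- d, - c) \<in> invs n w \<longleftrightarrow> (c, d) \<in> invs n w"
  using signed_perms_uminus[OF signed_perms_inv[OF assms]] by (auto simp: invs_iff)

lemma before_iff_invs:
  assumes w: "w \<in> signed_perms n" and "c \<in> pts n" "d \<in> pts n"
  shows "inv w c < inv w d \<longleftrightarrow> (d < c \<and> (c, d) \<in> invs n w) \<or> (c < d \<and> (d, c) \<notin> invs n w)"
  using assms signed_perms_eq_iff[OF signed_perms_inv[OF w], of c d]
  by (auto simp: invs_iff)

lemma invs_trans:
  "(c, e) \<in> invs n w \<Longrightarrow> (e, d) \<in> invs n w \<Longrightarrow> (c, d) \<in> invs n w"
  by (auto simp: invs_iff)

lemma invs_cotrans: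
  assumes "w \<in> signed_perms n" "(c, d) \<in> invs n w" "e \<in> pts n" "d < e" "e < c"
  shows "(c, e) \<in> invs n w \<or> (e, d) \<in> invs n w"
  using assms signed_perms_eq_iff[OF signed_perms_inv[OF assms(1)], of c e] by (auto simp: invs_iff)

text \<open>A finite total order on the signed points that is reversed by negation is the position
  order of exactly one signed permutation; biclosed sets encode such orders.\<close>

definition biclosed :: "nat \<Rightarrow> (int \<times> int) set \<Rightarrow> bool" where
  "biclosed n X \<longleftrightarrow>
     (\<forall>c d. (c, d) \<in> X \<longrightarrow> c \<in> pts n \<and> d \<in> pts n \<and> d < c \<and> (- d, - c) \<in> X) \<and>
     (\<forall>c e d. (c, e) \<in> X \<longrightarrow> (e, d) \<in> X \<longrightarrow> (c, d) \<in> X) \<and>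
     (\<forall>c e d. (c, d) \<in> X \<longrightarrow> e \<in> pts n \<longrightarrow> d < e \<longrightarrow> e < c \<longrightarrow> (c, e) \<in> X \<or> (e, d) \<in> X)"

lemma card_signed_points: "card (pts n) = 2 * n"
proof -
  have "card (pts n) = card {- int n .. int n} - 1"
    unfolding signed_points_def by (subst card_Diff_singleton) auto
  then show ?thesis by simp
qed

lemma biclosed_invs: "w \<in> signed_perms n \<Longrightarrow> biclosed n (invs n w)"
  unfolding biclosed_def
  using invs_uminus invs_trans invs_cotrans by (auto simp: invs_iff)

text \<open>X is read as an order \<open>lt\<close> on the entries, and each entry is placed
  according to the number m of its predecessors.\<close>

lemma ex_signed_perm_invs:
  assumes "biclosed n X"
  shows "\<exists>w \<in> signed_perms n. invs n w = X"
proof -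
  let ?S = "pts n"
  note B = assms[unfolded biclosed_def]
  note A1 = B[THEN conjunct1, rule_format]
  note A2 = B[THEN conjunct2, THEN conjunct1, rule_format]
  note X3 = B[THEN conjunct2, THEN conjunct2, rule_format]
  have X1: "c \<in> ?S" "d \<in> ?S" "d < c" "(- d, - c) \<in> X" if "(c, d) \<in> X" for c d
    using A1[OF that] by simp_all
  have X2: "(c, d) \<in> X" if "(c, e) \<in> X" "(e, d) \<in> X" for c d e
    using A2[OF that] .
  define lt where "lt c d \<longleftrightarrow> (d < c \<and> (c, d) \<in> X) \<or> (c < d \<and> (d, c) \<notin> X)" for c d
  have irr: "\<not> lt c c" for c by (simp add: lt_def)
  have tot: "lt c d \<or> lt d c" if "c \<noteq> d" for c d using that unfolding lt_def by (cases c d rule: linorder_cases) auto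
  have asym: "\<not> (lt c d \<and> lt d c)" for c d unfolding lt_def by auto
  \<comment> \<open>Each of the six relative orders of c, d, e is an instance of closedness or
    coclosedness of X.\<close>
  have tr: "lt c e" if "lt c d" "lt d e" "c \<in> ?S" "d \<in> ?S" "e \<in> ?S" for c d e
  proof -
    show ?thesis
      using that(1,2) X2[of c d e] X3[of c e d, OF _ that(4)] X2[of d e c] X3[of d c e, OF _ that(5)]
        X2[of e c d] X3[of e d c, OF _ that(3)] X3[of e c d, OF _ that(4)] X3[of d e c, OF _ that(3)]
        X3[of c d e, OF _ that(5)]
      unfolding lt_def by (smt (verit))
  qed
  have odd: "lt (- d) (- c)" if "lt c d" for c d
    using that X1(4)[of c d] X1(4)[of "- c" "- d"] unfolding lt_def by auto
  define m where "m c = card {d \<in> ?S. lt d c}" for c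
  have m_less: "m c < m d" if cd: "lt c d" "c \<in> ?S" "d \<in> ?S" for c d
  proof -
    have "{x \<in> ?S. lt x c} \<subseteq> {x \<in> ?S. lt x d}" using tr[OF _ cd(1) _ cd(2,3)] by blast
    moreover have "c \<in> {x \<in> ?S. lt x d}" "c \<notin> {x \<in> ?S. lt x c}" using cd irr by auto
    ultimately have "{x \<in> ?S. lt x c} \<subset> {x \<in> ?S. lt x d}" by blast
    then show ?thesis unfolding m_def by (intro psubset_card_mono) auto
  qed
  have m_iff: "m c < m d \<longleftrightarrow> lt c d" if "c \<in> ?S" "d \<in> ?S" for c d
    using m_less[OF _ that] m_less[OF _ that(2,1)] tot[of c d] by (cases "c = d") (auto simp: irr)
  have m_bound: "m c < 2 * n" if "c \<in> ?S" for c
  proof -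
    have "{x \<in> ?S. lt x c} \<subset> ?S" using that irr by blast
    then have "m c < card ?S" unfolding m_def by (intro psubset_card_mono) auto
    then show ?thesis by (simp add: card_signed_points)
  qed
  \<comment> \<open>Negation reverses \<open>lt\<close>, so m (- c) counts the successors of c; with
    its predecessors these are the 2n - 1 other points.\<close>
  have m_neg: "int (m (- c)) = 2 * int n - 1 - int (m c)" if c: "c \<in> ?S" for c
  proof -
    have "{d \<in> ?S. lt d (- c)} = uminus ` {d \<in> ?S. lt c d}"
    proof
      show "{d \<in> ?S. lt d (- c)} \<subseteq> uminus ` {d \<in> ?S. lt c d}"
      proof
        fix d assume "d \<in> {d \<in> ?S. lt d (- c)}"
        then show "d \<in> uminus ` {d \<in> ?S. lt c d}" using odd[of d "- c"] by (intro image_eqI[of _ _ "- d"]) auto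
      qed
      show "uminus ` {d \<in> ?S. lt c d} \<subseteq> {d \<in> ?S. lt d (- c)}" using odd by auto
    qed
    then have 1: "m (- c) = card {d \<in> ?S. lt c d}"
      unfolding m_def by (simp add: card_image)
    have "?S = insert c ({d \<in> ?S. lt d c} \<union> {d \<in> ?S. lt c d})" using tot c by blast
    then have "card ?S = card (insert c ({d \<in> ?S. lt d c} \<union> {d \<in> ?S. lt c d}))" by (rule arg_cong)
    also have "\<dots> = Suc (card ({d \<in> ?S. lt d c} \<union> {d \<in> ?S. lt c d}))"
      by (rule card_insert_disjoint) (auto simp: irr)
    also have "card ({d \<in> ?S. lt d c} \<union> {d \<in> ?S. lt c d}) = m c + m (- c)"
      unfolding 1 m_def[of c] by (rule card_Un_disjoint) (use asym in auto)
    finally show ?thesis by (simp add: card_signed_points)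
  qed
  \<comment> \<open>m takes the values 0 to 2n - 1. Subtracting n sends the first half to the
    negative positions; the extra 1 in the second half skips position 0.\<close>
  define p where "p c = (if c \<in> ?S then if m c < n then int (m c) - int n else int (m c) - int n + 1 else c)" for c
  have p_in: "p c \<in> ?S" if "c \<in> ?S" for c
    using that m_bound[OF that] by (auto simp: p_def signed_points_iff)
  have p_less: "p c < p d \<longleftrightarrow> lt c d" if "c \<in> ?S" "d \<in> ?S" for c d
    unfolding m_iff[OF that, symmetric] using that by (auto simp: p_def)
  have p_neg: "p (- c) = - p c" for c
  proof (cases "c \<in> ?S")
    case True then show ?thesis using m_neg[OF True] m_bound[OF True] by (auto simp: p_def)
  qed (auto simp: p_def)
  have "inj_on p ?S"
  proof (rule inj_onI)
    fix c d assume "c \<in> ?S" "d \<in> ?S" "p c = p d"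
    then show "c = d" using p_less[of c d] p_less[of d c] tot[of c d] by auto
  qed
  moreover from this have "p ` ?S = ?S" using p_in by (intro card_subset_eq) (auto simp: card_image)
  ultimately have "bij_betw p ?S ?S" by (simp add: bij_betw_def)
  then have pp: "p permutes ?S" by (rule bij_imp_permutes) (simp add: p_def)
  then have P: "p \<in> signed_perms n" using p_neg by (simp add: signed_perms_def)
  \<comment> \<open>p sends an entry to its position, so the permutation wanted is its
    inverse.\<close>
  have "inv (inv p) = p" using permutes_bij[OF pp] by (rule inv_inv_eq)
  then have "invs n (inv p) = X"
    using p_less X1 by (auto simp: invs_def lt_def)
  then show ?thesis using signed_perms_inv[OF P] by blast
qed

text \<open>Equal inversion sets give equal position orders, so \<open>inv w \<circ> v\<close> is
  increasing and hence the identity.\<close>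

lemma invs_inject:
  assumes v: "v \<in> signed_perms n" and w: "w \<in> signed_perms n" and eq: "invs n v = invs n w"
  shows "v = w"
proof -
  let ?g = "inv w \<circ> v"
  have less: "?g i < ?g j" if "i < j" "i \<in> pts n" "j \<in> pts n" for i j
  proof -
    have "inv v (v i) < inv v (v j)" using that signed_perms_inverses[OF v] by simp
    then show ?thesis
      using that v by (simp add: before_iff_invs[OF v] before_iff_invs[OF w] eq)
  qed
  have g: "?g \<in> signed_perms n" using signed_perms_comp[OF signed_perms_inv[OF w] v] .
  have "?g = id"
  proof (rule increasing_signed_perm_is_id[OF g])
    assume "n > 0"
    then show "?g 1 > 0" using less[of "- 1" 1] signed_perms_uminus[OF g, of 1] by (simp add: signed_points_iff)
  next
    fix i assume "1 \<le> i" "i < int n"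
    then show "?g i < ?g (i + 1)" by (intro less) (auto simp: signed_points_iff)
  qed
  then have "w \<circ> (inv w \<circ> v) = w" by simp
  then show ?thesis using signed_perms_inverses[OF w] by (simp add: fun_eq_iff)
qed

section \<open>Position keys\<close>

text \<open>A key models the map from entries to positions, but with gaps allowed. Entries can thus
  be placed next to each other or far outside without computing their actual positions.\<close>

definition key :: "nat \<Rightarrow> (int \<Rightarrow> int) \<Rightarrow> bool" where
  "key n f \<longleftrightarrow> inj_on f (pts n) \<and> (\<forall>c \<in> pts n. f (- c) = - f c)"

definition key_invs :: "nat \<Rightarrow> (int \<Rightarrow> int) \<Rightarrow> (int \<times> int) set" where
  "key_invs n f = {(c, d). c \<in> pts n \<and> d \<in> pts n \<and> d < c \<and> f c < f d}"

text \<open>For b = - a the last two tests repeat the first two, so the formula also covers the swap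
  at the centre.\<close>

definition swap_values :: "int \<Rightarrow> int \<Rightarrow> int \<Rightarrow> int" where
  "swap_values a b c = (if c = a then b else if c = b then a else if c = - a then - b
     else if c = - b then - a else c)"

lemma keyD:
  assumes "key n f"
  shows "c \<in> pts n \<Longrightarrow> f (- c) = - f c"
    and "c \<in> pts n \<Longrightarrow> d \<in> pts n \<Longrightarrow> f c = f d \<longleftrightarrow> c = d"
    and "c \<in> pts n \<Longrightarrow> f c \<noteq> 0"
proof -
  show 1: "f (- c) = - f c" if "c \<in> pts n" for c using assms that by (simp add: key_def)
  show 2: "f c = f d \<longleftrightarrow> c = d" if "c \<in> pts n" "d \<in> pts n" for c d
    using assms that by (auto simp: key_def inj_on_def)
  show "f c \<noteq> 0" if "c \<in> pts n"
    using 1[OF that] 2[OF that, of "- c"] that by (auto simp: signed_points_iff)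
qed

lemma key_inv: "w \<in> signed_perms n \<Longrightarrow> key n (inv w)"
  using signed_perms_uminus[OF signed_perms_inv] signed_perms_eq_iff[OF signed_perms_inv]
  by (auto simp: key_def inj_on_def)

lemma invs_eq_key_invs: "invs n w = key_invs n (inv w)"
  by (simp add: invs_def key_invs_def)

lemma swap_values_in: "a \<in> pts n \<Longrightarrow> b \<in> pts n \<Longrightarrow> c \<in> pts n \<Longrightarrow> swap_values a b c \<in> pts n"
  by (auto simp: swap_values_def signed_points_iff)

lemma key_swap:
  assumes "key n f" "a \<in> pts n" "b \<in> pts n" "a \<noteq> b"
  shows "key n (f \<circ> swap_values a b)"
proof -
  have "swap_values a b (swap_values a b c) = c" if "c \<in> pts n" for c
    using that assms(2-) by (auto simp: swap_values_def signed_points_iff)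
  then have "inj_on (swap_values a b) (pts n)" by (rule inj_on_inverseI)
  moreover have "swap_values a b ` pts n \<subseteq> pts n"
    using swap_values_in assms by auto
  ultimately have "inj_on (f \<circ> swap_values a b) (pts n)"
    using assms(1) by (meson comp_inj_on inj_on_subset key_def)
  moreover have "swap_values a b (- c) = - swap_values a b c" if "c \<in> pts n" for c
    using that assms(2-) by (auto simp: swap_values_def signed_points_iff)
  ultimately show ?thesis
    using assms swap_values_in by (auto simp: key_def)
qed

text \<open>As a and b are adjacent for f, any third entry compares in the same way with both; only
  the comparison of a with b and its negative change.\<close>

lemma key_invs_swap:
  assumes f: "key n f" and ab: "a \<in> pts n" "b \<in> pts n" "a < b" "f a < f b"
    and adj: "\<And>c. c \<in> pts n \<Longrightarrow> \<not> (f a < f c \<and> f c < f b)"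
  shows "key_invs n (f \<circ> swap_values a b) = insert (b, a) (insert (- a, - b) (key_invs n f))"
proof -
  have cmp: "f c < f a \<or> f b < f c" if "c \<in> pts n" "c \<noteq> a" "c \<noteq> b" for c
    using adj[OF that(1)] keyD(2)[OF f that(1) ab(1)] keyD(2)[OF f that(1) ab(2)] that by linarith
  have cmp': "f c < - f b \<or> - f a < f c" if "c \<in> pts n" "c \<noteq> - a" "c \<noteq> - b" for c
    using cmp[of "- c"] that keyD(1)[OF f that(1)] by auto
  have ne: "a \<noteq> - a" "b \<noteq> - b" using ab by (auto simp: signed_points_iff)
  have neg: "f (- a) = - f a" "f (- b) = - f b" using keyD(1)[OF f] ab by auto
  have fa: "f a \<noteq> 0" "f b \<noteq> 0" using keyD(3)[OF f] ab by auto
  have P: "f (swap_values a b c) < f (swap_values a b d) \<longleftrightarrow>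
      (c = b \<and> d = a) \<or> (c = - a \<and> d = - b) \<or> f c < f d"
    if cd: "c \<in> pts n" "d \<in> pts n" "d < c" for c d
  proof -
    define g where "g x = f (swap_values a b x)" for x
    have g: "g x = (if x = a then f b else if x = b then f a else if x = - a then f (- b)
        else if x = - b then f (- a) else f x)" for x
      by (simp add: g_def swap_values_def)
    have f: "x = a \<Longrightarrow> f x = f a" "x = b \<Longrightarrow> f x = f b" "x = - a \<Longrightarrow> f x = - f a" "x = - b \<Longrightarrow> f x = - f b" for x
      using neg by auto
    have "b \<noteq> - a \<Longrightarrow> f (- a) < f a \<or> f b < f (- a)" "b \<noteq> - a \<Longrightarrow> f (- b) < f a \<or> f b < f (- b)"
      using cmp[of "- a"] cmp[of "- b"] ab ne by auto
    then have "g c < g d \<longleftrightarrow> (c = b \<and> d = a) \<or> (c = - a \<and> d = - b) \<or> f c < f d"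
      using g[of c] g[of d] f[of c] f[of d] cmp[OF cd(1)] cmp[OF cd(2)] cmp'[OF cd(1)] cmp'[OF cd(2)]
        ne neg fa ab(3,4) cd(3)
      by (smt (verit))
    then show ?thesis by (simp add: g_def)
  qed
  show ?thesis
    unfolding key_invs_def using P ab by auto
qed

lemma biclosed_key:
  assumes "key n f" shows "biclosed n (key_invs n f)"
  unfolding biclosed_def
proof (intro conjI allI impI)
  fix c e d assume "(c, d) \<in> key_invs n f" "e \<in> pts n" "d < e" "e < c"
  then show "(c, e) \<in> key_invs n f \<or> (e, d) \<in> key_invs n f"
    using keyD(2)[OF assms, of c e] unfolding key_invs_def by auto
qed (use keyD(1)[OF assms] in \<open>auto simp: key_invs_def\<close>)

text \<open>The standardization of f: it lists the entries in increasing order of their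
  keys.\<close>

definition perm_of_key :: "nat \<Rightarrow> (int \<Rightarrow> int) \<Rightarrow> int \<Rightarrow> int" where
  "perm_of_key n f = (THE w. w \<in> signed_perms n \<and> invs n w = key_invs n f)"

lemma perm_of_key:
  assumes "key n f"
  shows "perm_of_key n f \<in> signed_perms n" "invs n (perm_of_key n f) = key_invs n f"
proof -
  obtain w where w: "w \<in> signed_perms n" "invs n w = key_invs n f"
    using ex_signed_perm_invs[OF biclosed_key[OF assms]] by auto
  have "perm_of_key n f = w"
    unfolding perm_of_key_def by (rule the_equality) (use w invs_inject in auto)
  then show "perm_of_key n f \<in> signed_perms n" "invs n (perm_of_key n f) = key_invs n f"
    using w by auto
qed

text \<open>A cover in the weak order, expressed by inversion sets alone and labelled by the two
  entries exchanged. The label (- a, - b) describes the same cover, and the two added pairs coincide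
  if a = - b.\<close>

definition edge :: "nat \<Rightarrow> (int \<Rightarrow> int) \<Rightarrow> (int \<Rightarrow> int) \<Rightarrow> int \<Rightarrow> int \<Rightarrow> bool" where
  "edge n x y b a \<longleftrightarrow> x \<in> signed_perms n \<and> y \<in> signed_perms n \<and>
     a \<in> pts n \<and> b \<in> pts n \<and> a < b \<and> (b, a) \<notin> invs n x \<and>
     invs n y = insert (b, a) (insert (- a, - b) (invs n x))"

lemma edge_swap:
  assumes f: "key n f" and ab: "a \<in> pts n" "b \<in> pts n" "a < b" "f a < f b"
    and adj: "\<And>c. c \<in> pts n \<Longrightarrow> \<not> (f a < f c \<and> f c < f b)"
  shows "edge n (perm_of_key n f) (perm_of_key n (f \<circ> swap_values a b)) b a"
  using perm_of_key[OF f] perm_of_key[OF key_swap[OF f ab(1,2)]] key_invs_swap[OF assms] ab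
  unfolding edge_def by (auto simp: key_invs_def)

lemma simple_refl_in:
  assumes "i \<in> {0..<int n}" shows "simple_refl i \<in> signed_perms n"
proof -
  have "simple_refl i permutes pts n"
  proof (cases "i = 0")
    case True
    then show ?thesis using assms unfolding simple_refl_def
      by (auto intro!: permutes_swap_id simp: signed_points_iff)
  next
    case False
    then show ?thesis using assms unfolding simple_refl_def
      by (auto intro!: permutes_compose permutes_swap_id simp: signed_points_iff)
  qed
  moreover have "simple_refl i (- k) = - simple_refl i k" for k
    using assms by (auto simp: simple_refl_def transpose_def)
  ultimately show ?thesis by (simp add: signed_perms_def)
qed

lemma simple_refl_involution: "0 \<le> i \<Longrightarrow> simple_refl i (simple_refl i k) = k"
  by (auto simp: simple_refl_def transpose_def)

lemma weak_covers_edge: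
  assumes "\<pi> \<in> signed_perms n" and "n > 0"
  shows "\<pi> (- 1) < \<pi> 1 \<Longrightarrow> edge n \<pi> (\<pi> \<circ> simple_refl 0) (\<pi> 1) (\<pi> (- 1))"
    and "i \<in> {1..int n - 1} \<Longrightarrow> \<pi> i < \<pi> (i + 1) \<Longrightarrow> edge n \<pi> (\<pi> \<circ> simple_refl i) (\<pi> (i + 1)) (\<pi> i)"
proof -
  \<comment> \<open>The lower of the two exchanged positions is k, which is - 1 for i = 0 because
    there is no position 0. This treats all simple reflections at once.\<close>
  have main: "edge n \<pi> (\<pi> \<circ> simple_refl i) (\<pi> k') (\<pi> k)"
    if i: "i \<in> {0..<int n}" and k: "k = (if i = 0 then - 1 else i)" "k' = i + 1" and less: "\<pi> k < \<pi> k'"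
    for i k k'
  proof -
    let ?s = "\<pi> \<circ> simple_refl i"
    have s: "?s \<in> signed_perms n" using signed_perms_comp[OF assms(1) simple_refl_in[OF i]] .
    have kk: "k \<in> pts n" "k' \<in> pts n" using i k by (auto simp: signed_points_iff)
    have inv_s: "inv ?s c = simple_refl i (inv \<pi> c)" for c
    proof -
      have "?s (simple_refl i (inv \<pi> c)) = c"
        using i by (simp add: simple_refl_involution signed_perms_inverses[OF assms(1)])
      then show ?thesis using signed_perms_inverses(2)[OF s] by metis
    qed
    have S: "simple_refl i j = swap_values k k' j" for j
    proof -
      have "0 \<le> i" using i by simp
      then show ?thesis unfolding k swap_values_def simple_refl_def transpose_def comp_def by (smt (verit))
    qed
    have S': "swap_values (\<pi> k) (\<pi> k') (\<pi> j) = \<pi> (swap_values k k' j)" for j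
    proof -
      have "\<pi> j = - \<pi> i \<longleftrightarrow> j = - i" for i
        using signed_perms_eq_iff[OF assms(1), of j "- i"] signed_perms_uminus[OF assms(1), of i] by simp
      then show ?thesis
        by (simp add: swap_values_def signed_perms_eq_iff[OF assms(1)] signed_perms_uminus[OF assms(1)])
    qed
    have "inv ?s = inv \<pi> \<circ> swap_values (\<pi> k) (\<pi> k')"
    proof
      fix c
      have "inv ?s c = swap_values k k' (inv \<pi> c)" unfolding inv_s S ..
      also have "\<dots> = inv \<pi> (swap_values (\<pi> k) (\<pi> k') (\<pi> (inv \<pi> c)))"
        unfolding S' signed_perms_inverses(2)[OF assms(1)] ..
      finally show "inv ?s c = (inv \<pi> \<circ> swap_values (\<pi> k) (\<pi> k')) c"
        by (simp add: signed_perms_inverses(1)[OF assms(1)])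
    qed
    moreover have "key_invs n (inv \<pi> \<circ> swap_values (\<pi> k) (\<pi> k')) =
        insert (\<pi> k', \<pi> k) (insert (- \<pi> k, - \<pi> k') (key_invs n (inv \<pi>)))"
    proof (rule key_invs_swap[OF key_inv[OF assms(1)] _ _ less])
      show "\<pi> k \<in> pts n" "\<pi> k' \<in> pts n" using kk assms(1) by simp_all
      show "inv \<pi> (\<pi> k) < inv \<pi> (\<pi> k')" using i k by (simp add: signed_perms_inverses[OF assms(1)])
    next
      fix c assume "c \<in> pts n"
      then have "inv \<pi> c \<in> pts n" using signed_perms_inv[OF assms(1)] by simp
      then have "inv \<pi> c \<noteq> 0" by (simp add: signed_points_iff)
      then show "\<not> (inv \<pi> (\<pi> k) < inv \<pi> c \<and> inv \<pi> c < inv \<pi> (\<pi> k'))"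
        using i k by (auto simp: signed_perms_inverses[OF assms(1)])
    qed
    moreover have "(\<pi> k', \<pi> k) \<notin> invs n \<pi>"
      using k i by (simp add: invs_iff signed_perms_inverses[OF assms(1)])
    ultimately show ?thesis
      using assms(1) s kk less by (simp add: edge_def invs_eq_key_invs)
  qed
  show "\<pi> (- 1) < \<pi> 1 \<Longrightarrow> edge n \<pi> (\<pi> \<circ> simple_refl 0) (\<pi> 1) (\<pi> (- 1))"
    using main[of 0] assms(2) by simp
  show "i \<in> {1..int n - 1} \<Longrightarrow> \<pi> i < \<pi> (i + 1) \<Longrightarrow> edge n \<pi> (\<pi> \<circ> simple_refl i) (\<pi> (i + 1)) (\<pi> i)"
    using main[of i] by simp
qed

section \<open>The weak order as a lattice\<close>

lemma weak_covers_imp_edge: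
  assumes "weak_covers n \<sigma> \<pi>" "n > 0"
  shows "\<exists>b a. edge n \<pi> \<sigma> b a"
  using assms weak_covers_edge[of \<pi> n] unfolding weak_covers_def by metis

lemma edgeD:
  assumes "edge n x y b a"
  shows "x \<in> signed_perms n" "y \<in> signed_perms n" "a \<in> pts n" "b \<in> pts n" "a < b"
    "(b, a) \<notin> invs n x" "invs n y = insert (b, a) (insert (- a, - b) (invs n x))"
  using assms by (auto simp: edge_def)

lemma edge_uminus: "edge n x y b a \<Longrightarrow> edge n x y (- a) (- b)"
  using invs_uminus[of x n a b] by (auto simp: edge_def)

text \<open>If no ascent of x could be reversed inside the inversions of y, all neighbours in x
  would stand in the same order in y. Then \<open>inv y \<circ> x\<close> would be increasing, which
  forces x = y.\<close>

lemma ex_cover_below: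
  assumes x: "x \<in> signed_perms n" and y: "y \<in> signed_perms n" and n: "n > 0"
    and sub: "invs n x \<subset> invs n y"
  shows "\<exists>z. weak_covers n z x \<and> invs n z \<subseteq> invs n y"
proof -
  have sub': "invs n x \<subseteq> invs n y" using sub by blast
  have cover: "\<exists>z. weak_covers n z x \<and> invs n z \<subseteq> invs n y"
    if e: "edge n x z b a" and inv: "(b, a) \<in> invs n y" and c: "weak_covers n z x" for z b a
    using sub' inv invs_uminus[OF y, of a b] edgeD(7)[OF e] c by (intro exI[of _ z]) simp
  show ?thesis
  proof (rule ccontr)
    assume no: "\<not> ?thesis"
    let ?g = "inv y \<circ> x"
    have g: "?g \<in> signed_perms n" using signed_perms_comp[OF signed_perms_inv[OF y] x] .
    have less: "?g k < ?g k'"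
      if k: "k < k'" "k \<in> pts n" "k' \<in> pts n"
        and asc: "x k < x k' \<Longrightarrow> (x k', x k) \<notin> invs n y" for k k'
    proof (cases "x k < x k'")
      case True
      then show ?thesis
        using asc before_iff_invs[OF y, of "x k" "x k'"] k x by simp
    next
      case False
      then have "x k' < x k" using k(1) signed_perms_eq_iff[OF x, of k k'] by linarith
      then have "(x k, x k') \<in> invs n x"
        using k x by (simp add: invs_iff signed_perms_inverses[OF x])
      then have "(x k, x k') \<in> invs n y" using sub' by blast
      then show ?thesis by (simp add: invs_iff)
    qed
    have "?g = id"
    proof (rule increasing_signed_perm_is_id[OF g])
      have e: "weak_covers n (x \<circ> simple_refl 0) x" if "x (- 1) < x 1"
        using that x n signed_perms_comp[OF x simple_refl_in] by (simp add: weak_covers_def)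
      have "?g (- 1) < ?g 1"
        by (rule less) (use n e no cover[OF weak_covers_edge(1)[OF x n]] in \<open>auto simp: signed_points_iff\<close>)
      then show "?g 1 > 0" using signed_perms_uminus[OF g, of 1] by linarith
    next
      fix i :: int assume i: "1 \<le> i" "i < int n"
      have e: "weak_covers n (x \<circ> simple_refl i) x" if "x i < x (i + 1)"
        using that x i signed_perms_comp[OF x simple_refl_in, of i] by (auto simp: weak_covers_def)
      show "?g i < ?g (i + 1)"
      proof (rule less)
        show "(x (i + 1), x i) \<notin> invs n y" if "x i < x (i + 1)"
          using no cover[OF weak_covers_edge(2)[OF x n _ that] _ e[OF that]] i by auto
      qed (use i in \<open>auto simp: signed_points_iff\<close>)
    qed
    then have "y \<circ> (inv y \<circ> x) = y" by simp
    then have "x = y" using signed_perms_inverses[OF y] by (simp add: fun_eq_iff)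
    then show False using sub by simp
  qed
qed

lemma weak_order_simps [simp]:
  "carrier (weak_order n) = signed_perms n" "x .=\<^bsub>weak_order n\<^esub> y \<longleftrightarrow> x = y"
  by (simp_all add: weak_order_def)

lemma finite_invs [simp]: "finite (invs n w)"
  by (rule finite_subset[of _ "pts n \<times> pts n"]) (auto simp: invs_def)

lemma signed_perms_0:
  assumes "w \<in> signed_perms 0" shows "w = id"
  using assms by (simp add: signed_perms_def signed_points_def)

lemma weak_covers_invs:
  assumes "weak_covers n \<sigma> \<pi>" shows "invs n \<pi> \<subset> invs n \<sigma>"
proof (cases "n = 0")
  \<comment> \<open>For n = 0 there are no covers: the swap of positions - 1 and 1 is not a
    permutation of the empty set of points.\<close>
  case True
  have "\<pi> (- 1) < \<pi> 1 \<and> \<sigma> = \<pi> \<circ> simple_refl 0" "\<pi> \<in> signed_perms 0" "\<sigma> \<in> signed_perms 0"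
    using assms True by (auto simp: weak_covers_def)
  then have "\<pi> = id" "\<sigma> = id" using signed_perms_0 by auto
  then have "simple_refl 0 = id" using \<open>\<pi> (- 1) < \<pi> 1 \<and> \<sigma> = \<pi> \<circ> simple_refl 0\<close> by simp
  then have "simple_refl 0 1 = (1::int)" by simp
  then show ?thesis by (simp add: simple_refl_def)
next
  case False
  then obtain b a where "edge n \<pi> \<sigma> b a" using weak_covers_imp_edge[OF assms] by auto
  then show ?thesis using edgeD(6,7) by blast
qed

lemma weak_covers_carrier:
  "weak_covers n \<sigma> \<pi> \<Longrightarrow> \<pi> \<in> signed_perms n \<and> \<sigma> \<in> signed_perms n"
  by (auto simp: weak_covers_def)

lemma weak_le_imp_invs:
  "(\<lambda>\<pi> \<sigma>. weak_covers n \<sigma> \<pi>)\<^sup>*\<^sup>* x y \<Longrightarrow> invs n x \<subseteq> invs n y"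
  by (induction rule: rtranclp_induct) (use weak_covers_invs in blast)+

lemma invs_imp_weak_le:
  assumes "x \<in> signed_perms n" "y \<in> signed_perms n" "invs n x \<subseteq> invs n y"
  shows "(\<lambda>\<pi> \<sigma>. weak_covers n \<sigma> \<pi>)\<^sup>*\<^sup>* x y"
  using assms
proof (induction "card (invs n y - invs n x)" arbitrary: x rule: less_induct)
  case less
  show ?case
  proof (cases "x = y")
    case False
    have n: "n > 0" using False signed_perms_0 less.prems by (cases n) auto
    have "invs n x \<subset> invs n y" using less.prems invs_inject False by blast
    then obtain z where z: "weak_covers n z x" "invs n z \<subseteq> invs n y"
      using ex_cover_below less.prems n by blast
    have "card (invs n y - invs n z) < card (invs n y - invs n x)"
      by (rule psubset_card_mono) (use z weak_covers_invs[OF z(1)] in auto)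
    then have "(\<lambda>\<pi> \<sigma>. weak_covers n \<sigma> \<pi>)\<^sup>*\<^sup>* z y"
      using less.hyps z less.prems weak_covers_carrier[OF z(1)] by blast
    then show ?thesis using z(1) by (meson converse_rtranclp_into_rtranclp)
  qed simp
qed

lemma weak_le_iff:
  assumes "x \<in> signed_perms n" "y \<in> signed_perms n"
  shows "x \<sqsubseteq>\<^bsub>weak_order n\<^esub> y \<longleftrightarrow> invs n x \<subseteq> invs n y"
  using weak_le_imp_invs[of n x y] invs_imp_weak_le[OF assms] by (auto simp: weak_order_def)

text \<open>Some cover z of x lies below y. The pair that z adds can only be (b, a) or its negative,
  so z has all the inversions of y.\<close>

lemma edge_imp_weak_covers:
  assumes e: "edge n x y b a" shows "weak_covers n y x"
proof -
  have n: "n > 0" using edgeD(3)[OF e] by (auto simp: signed_points_iff)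
  have "invs n x \<subset> invs n y" using edgeD(6,7)[OF e] by blast
  then obtain z where z: "weak_covers n z x" "invs n z \<subseteq> invs n y"
    using ex_cover_below edgeD(1,2)[OF e] n by blast
  obtain b' a' where e': "edge n x z b' a'" using weak_covers_imp_edge[OF z(1) n] by auto
  have "(b', a') \<in> {(b, a), (- a, - b)}" using edgeD(6,7)[OF e'] edgeD(7)[OF e] z(2) by auto
  then have "invs n z = invs n y" using edgeD(7)[OF e'] edgeD(7)[OF e] by auto
  then have "z = y" using invs_inject edgeD(2)[OF e] edgeD(2)[OF e'] by blast
  then show ?thesis using z(1) by simp
qed

lemma edge_no_between:
  assumes e: "edge n x y b a" and z: "z \<in> signed_perms n"
    and le: "invs n x \<subseteq> invs n z" "invs n z \<subseteq> invs n y"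
  shows "z = x \<or> z = y"
proof (cases "(b, a) \<in> invs n z")
  case True
  then have "invs n z = invs n y"
    using le edgeD(7)[OF e] invs_uminus[OF z, of a b] by auto
  then show ?thesis using invs_inject[OF z edgeD(2)[OF e]] by simp
next
  case False
  then have "invs n z = invs n x"
    using le edgeD(7)[OF e] invs_uminus[OF z, of a b] by auto
  then show ?thesis using invs_inject[OF z edgeD(1)[OF e]] by simp
qed

section \<open>Joins and meets computed on biclosed sets\<close>

definition all_pairs :: "nat \<Rightarrow> (int \<times> int) set" where
  "all_pairs n = {(c, d). c \<in> pts n \<and> d \<in> pts n \<and> d < c}"

lemma biclosed_Compl:
  assumes "biclosed n X" shows "biclosed n (all_pairs n - X)"
proof -
  note B = assms[unfolded biclosed_def]
  note A1 = B[THEN conjunct1, rule_format]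
  note A2 = B[THEN conjunct2, THEN conjunct1, rule_format]
  note A3 = B[THEN conjunct2, THEN conjunct2, rule_format]
  show ?thesis
    unfolding biclosed_def
  proof (intro conjI allI impI)
    fix c d assume "(c, d) \<in> all_pairs n - X"
    then show "c \<in> pts n" "d \<in> pts n" "d < c" "(- d, - c) \<in> all_pairs n - X"
      using A1[of "- d" "- c"] by (auto simp: all_pairs_def)
  next
    fix c e d assume "(c, e) \<in> all_pairs n - X" "(e, d) \<in> all_pairs n - X"
    then show "(c, d) \<in> all_pairs n - X" using A3[of c d e] by (auto simp: all_pairs_def)
  next
    fix c e d assume "(c, d) \<in> all_pairs n - X" "e \<in> pts n" "d < e" "e < c"
    then show "(c, e) \<in> all_pairs n - X \<or> (e, d) \<in> all_pairs n - X"
      using A2[of c e d] by (auto simp: all_pairs_def)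
  qed
qed

text \<open>A union of biclosed sets is already coclosed, and the closure keeps this property: a
  point e between the ends of a chain is either one of its vertices or lies strictly inside one
  link, which then splits at e.\<close>

lemma biclosed_trancl:
  assumes "biclosed n X" "biclosed n Y"
  shows "biclosed n ((X \<union> Y)\<^sup>+)"
proof -
  let ?U = "X \<union> Y"
  note BX = assms(1)[unfolded biclosed_def] and BY = assms(2)[unfolded biclosed_def]
  have U1: "c \<in> pts n \<and> d \<in> pts n \<and> d < c \<and> (- d, - c) \<in> ?U" if "(c, d) \<in> ?U" for c d
    using that BX[THEN conjunct1, rule_format, of c d] BY[THEN conjunct1, rule_format, of c d] by blast
  have U3: "(c, e) \<in> ?U \<or> (e, d) \<in> ?U"
    if "(c, d) \<in> ?U" "e \<in> pts n" "d < e" "e < c" for c e d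
    using that BX[THEN conjunct2, THEN conjunct2, rule_format, of c d e]
      BY[THEN conjunct2, THEN conjunct2, rule_format, of c d e] by blast
  have T1: "c \<in> pts n \<and> d \<in> pts n \<and> d < c \<and> (- d, - c) \<in> ?U\<^sup>+" if "(c, d) \<in> ?U\<^sup>+" for c d
    using that
  proof (induction rule: trancl_induct)
    case (base d) then show ?case using U1[OF base] by auto
  next
    case (step d e)
    have "(- e, - d) \<in> ?U" using U1[OF step.hyps(2)] by simp
    then have "(- e, - c) \<in> ?U\<^sup>+" using step.IH by (meson trancl_into_trancl2)
    then show ?case using U1[OF step.hyps(2)] step.IH by auto
  qed
  have T3: "(c, e) \<in> ?U\<^sup>+ \<or> (e, d) \<in> ?U\<^sup>+"
    if "(c, d) \<in> ?U\<^sup>+" "e \<in> pts n" "d < e" "e < c" for c e d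
    using that(1,3)
  proof (induction rule: trancl_induct)
    case (base d) then show ?case using U3[OF base(1) that(2) _ that(4)] by blast
  next
    case (step m d)
    consider "e = m" | "m < e" | "e < m" by linarith
    then show ?case
    proof cases
      case 1 then show ?thesis using step.hyps(1) by simp
    next
      case 2 then show ?thesis using step.IH step.hyps(2) by (meson trancl_into_trancl)
    next
      case 3
      then have "(m, e) \<in> ?U \<or> (e, d) \<in> ?U" using U3[OF step.hyps(2) that(2) step.prems] by blast
      then show ?thesis using step.hyps(1) by (meson r_into_trancl trancl_into_trancl)
    qed
  qed
  show ?thesis
    unfolding biclosed_def
  proof (intro conjI allI impI)
    fix c e d assume "(c, e) \<in> ?U\<^sup>+" "(e, d) \<in> ?U\<^sup>+"
    then show "(c, d) \<in> ?U\<^sup>+" by (rule trancl_trans)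
  qed (use T1 T3 in blast)+
qed

lemma invs_subset_all_pairs: "invs n w \<subseteq> all_pairs n"
  by (auto simp: invs_def all_pairs_def)

lemma weak_order_sup:
  assumes x: "x \<in> signed_perms n" and y: "y \<in> signed_perms n"
  shows "\<exists>s. is_lub (weak_order n) s {x, y} \<and> invs n s = (invs n x \<union> invs n y)\<^sup>+"
proof -
  obtain s where s: "s \<in> signed_perms n" "invs n s = (invs n x \<union> invs n y)\<^sup>+"
    using ex_signed_perm_invs biclosed_trancl biclosed_invs x y by meson
  have *: "invs n s \<subseteq> invs n z"
    if "invs n x \<subseteq> invs n z" "invs n y \<subseteq> invs n z" for z
  proof -
    have "(invs n z)\<^sup>+ = invs n z" by (rule trancl_id, rule transI, rule invs_trans)
    then show ?thesis unfolding s using that by (metis Un_least trancl_mono subrelI)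
  qed
  have "invs n x \<subseteq> invs n s" "invs n y \<subseteq> invs n s"
    unfolding s by auto
  note le = this
  have "is_lub (weak_order n) s {x, y}"
  proof -
    have "Upper (weak_order n) {x, y} =
        {u \<in> signed_perms n. invs n x \<subseteq> invs n u \<and> invs n y \<subseteq> invs n u}"
      unfolding Upper_def using x y weak_le_iff[OF x] weak_le_iff[OF y] by simp blast
    then show ?thesis
      unfolding least_def using s(1) * le weak_le_iff[OF s(1)] by simp
  qed
  then show ?thesis using s(2) by blast
qed

text \<open>Complementation in \<open>all_pairs n\<close> reverses inclusion and preserves biclosed
  sets, so the construction of joins is applied to the complements N x and N y.\<close>

lemma weak_order_inf:
  assumes x: "x \<in> signed_perms n" and y: "y \<in> signed_perms n"
  defines "N \<equiv> \<lambda>w. all_pairs n - invs n w"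
  shows "\<exists>s. is_glb (weak_order n) s {x, y} \<and> invs n s = all_pairs n - (N x \<union> N y)\<^sup>+"
proof -
  have b: "biclosed n (N w)" if "w \<in> signed_perms n" for w
    unfolding N_def using biclosed_Compl biclosed_invs that by blast
  obtain s where s: "s \<in> signed_perms n" "invs n s = all_pairs n - (N x \<union> N y)\<^sup>+"
    using ex_signed_perm_invs biclosed_Compl biclosed_trancl b[OF x] b[OF y] by meson
  have *: "invs n z \<subseteq> invs n s"
    if z: "z \<in> signed_perms n" "invs n z \<subseteq> invs n x" "invs n z \<subseteq> invs n y" for z
  proof -
    have "trans (N z)" using b[OF z(1)] unfolding biclosed_def trans_def by blast
    then have "(N z)\<^sup>+ = N z" by (rule trancl_id)
    moreover have "N x \<union> N y \<subseteq> N z" using z unfolding N_def by auto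
    ultimately have "(N x \<union> N y)\<^sup>+ \<subseteq> N z" by (metis trancl_mono subrelI)
    then show ?thesis unfolding s using invs_subset_all_pairs unfolding N_def by blast
  qed
  have "invs n s \<subseteq> invs n x" "invs n s \<subseteq> invs n y"
    unfolding s N_def by auto
  note le = this
  have "is_glb (weak_order n) s {x, y}"
  proof -
    have "Lower (weak_order n) {x, y} =
        {u \<in> signed_perms n. invs n u \<subseteq> invs n x \<and> invs n u \<subseteq> invs n y}"
      unfolding Lower_def using x y weak_le_iff[OF _ x] weak_le_iff[OF _ y] by simp blast
    then show ?thesis
      unfolding greatest_def using s(1) * le weak_le_iff[OF _ s(1)] by simp
  qed
  then show ?thesis using s(2) by blast
qed

lemma lattice_weak_order: "lattice (weak_order n)"
proof
  fix x y z
  assume "x \<sqsubseteq>\<^bsub>weak_order n\<^esub> y" "y \<sqsubseteq>\<^bsub>weak_order n\<^esub> z"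
  then show "x \<sqsubseteq>\<^bsub>weak_order n\<^esub> z" by (simp add: weak_order_def)
next
  fix x y assume "x \<in> carrier (weak_order n)" "y \<in> carrier (weak_order n)"
  then show "\<exists>s. is_lub (weak_order n) s {x, y}" "\<exists>s. is_glb (weak_order n) s {x, y}"
    using weak_order_sup[of x n y] weak_order_inf[of x n y] by auto
next
  fix x y assume "x \<sqsubseteq>\<^bsub>weak_order n\<^esub> y" "y \<sqsubseteq>\<^bsub>weak_order n\<^esub> x"
    "x \<in> carrier (weak_order n)" "y \<in> carrier (weak_order n)"
  then show "x .=\<^bsub>weak_order n\<^esub> y" by (simp add: weak_le_iff invs_inject)
qed (auto simp: weak_le_iff weak_order_def)

interpretation weak: lattice "weak_order n" for n by (rule lattice_weak_order)

lemma invs_join: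
  assumes x: "x \<in> signed_perms n" and y: "y \<in> signed_perms n"
  shows "invs n (x \<squnion>\<^bsub>weak_order n\<^esub> y) = (invs n x \<union> invs n y)\<^sup>+"
proof -
  obtain s where s: "is_lub (weak_order n) s {x, y}" "invs n s = (invs n x \<union> invs n y)\<^sup>+"
    using weak_order_sup assms by blast
  have "x \<squnion>\<^bsub>weak_order n\<^esub> y = s"
    unfolding join_def sup_def using s(1) weak.least_unique by (intro some_equality) auto
  then show ?thesis using s(2) by simp
qed

lemma invs_meet:
  assumes x: "x \<in> signed_perms n" and y: "y \<in> signed_perms n"
  shows "invs n (x \<sqinter>\<^bsub>weak_order n\<^esub> y) =
    all_pairs n - ((all_pairs n - invs n x) \<union> (all_pairs n - invs n y))\<^sup>+"
proof -
  obtain s where s: "is_glb (weak_order n) s {x, y}"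
    "invs n s = all_pairs n - ((all_pairs n - invs n x) \<union> (all_pairs n - invs n y))\<^sup>+"
    using weak_order_inf assms by blast
  have "x \<sqinter>\<^bsub>weak_order n\<^esub> y = s"
    unfolding meet_def inf_def using s(1) weak.greatest_unique by (intro some_equality) auto
  then show ?thesis using s(2) by simp
qed

text \<open>If the composite of a chain were in S, then its initial part or its last link would be
  in S. With complements of inversion sets for U this shows that meets keep a cotransitive set
  inside; with inversion sets themselves, that joins keep it outside.\<close>

lemma cotransitive_avoids_trancl:
  assumes "\<And>c e d. (c, d) \<in> S \<Longrightarrow> d < e \<Longrightarrow> e < c \<Longrightarrow> e \<in> pts n \<Longrightarrow> (c, e) \<in> S \<or> (e, d) \<in> S"
    and "U \<inter> S = {}" "U \<subseteq> all_pairs n"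
  shows "U\<^sup>+ \<inter> S = {}"
proof -
  have "(c, d) \<notin> S \<and> (c, d) \<in> all_pairs n" if "(c, d) \<in> U\<^sup>+" for c d
    using that
  proof (induction rule: trancl_induct)
    case (base d) then show ?case using assms(2,3) by blast
  next
    case (step e d)
    then have "(c, e) \<notin> S" "(e, d) \<notin> S" "d < e" "e < c" "e \<in> pts n" "(c, d) \<in> all_pairs n"
      using assms(2,3) by (auto simp: all_pairs_def)
    then show ?case using assms(1)[of c d e] by blast
  qed
  then show ?thesis by auto
qed

lemma meet_cotransitive:
  assumes "x \<in> signed_perms n" "y \<in> signed_perms n"
    and "\<And>c e d. (c, d) \<in> S \<Longrightarrow> d < e \<Longrightarrow> e < c \<Longrightarrow> e \<in> pts n \<Longrightarrow> (c, e) \<in> S \<or> (e, d) \<in> S"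
    and "S \<subseteq> invs n x" "S \<subseteq> invs n y"
  shows "S \<subseteq> invs n (x \<sqinter>\<^bsub>weak_order n\<^esub> y)"
proof -
  have "((all_pairs n - invs n x) \<union> (all_pairs n - invs n y))\<^sup>+ \<inter> S = {}"
    by (rule cotransitive_avoids_trancl) (use assms(3-) in auto)
  then show ?thesis using invs_subset_all_pairs[of n x] assms(4) invs_meet[OF assms(1,2)] by auto
qed

lemma join_cotransitive:
  assumes "x \<in> signed_perms n" "y \<in> signed_perms n"
    and "\<And>c e d. (c, d) \<in> S \<Longrightarrow> d < e \<Longrightarrow> e < c \<Longrightarrow> e \<in> pts n \<Longrightarrow> (c, e) \<in> S \<or> (e, d) \<in> S"
    and "S \<inter> invs n x = {}" "S \<inter> invs n y = {}"
  shows "S \<inter> invs n (x \<squnion>\<^bsub>weak_order n\<^esub> y) = {}"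
proof -
  have "(invs n x \<union> invs n y)\<^sup>+ \<inter> S = {}"
    by (rule cotransitive_avoids_trancl) (use assms(3-) invs_subset_all_pairs[of n x] invs_subset_all_pairs[of n y] in auto)
  then show ?thesis using invs_join[OF assms(1,2)] by auto
qed

section \<open>Shards and the congruences they define\<close>

text \<open>The cover \<open>y\<close> of \<open>x\<close> swaps \<open>a\<close> and \<open>b\<close>, and the points to the left of its arc from \<open>b\<close> to \<open>a\<close> are
  the points of \<open>\<Lambda>\<close> between \<open>a\<close> and \<open>b\<close>; outside this interval \<open>\<Lambda>\<close> is irrelevant.\<close>

definition edge_on :: "nat \<Rightarrow> int set \<Rightarrow> (int \<Rightarrow> int) \<Rightarrow> (int \<Rightarrow> int) \<Rightarrow> int \<Rightarrow> int \<Rightarrow> bool" where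
  "edge_on n \<Lambda> x y b a \<longleftrightarrow> edge n x y b a \<and>
     (\<forall>c \<in> pts n. a < c \<longrightarrow> c < b \<longrightarrow> ((b, c) \<in> invs n y \<longleftrightarrow> c \<notin> \<Lambda>))"

text \<open>The shard of \<open>b\<close>, \<open>a\<close> is contained in the inversion set of \<open>y\<close> iff \<open>y\<close> lies above the
  join-irreducible permutation of the arc from \<open>b\<close> to \<open>a\<close> with left points \<open>\<Lambda>\<close>.\<close>

definition shard :: "nat \<Rightarrow> int set \<Rightarrow> int \<Rightarrow> int \<Rightarrow> (int \<times> int) set" where
  "shard n \<Lambda> b a = {(c, d) \<in> all_pairs n. a \<le> d \<and> c \<le> b \<and> (c = b \<or> c \<in> \<Lambda>) \<and> (d = a \<or> d \<notin> \<Lambda>)}"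

lemma shard_iff:
  "(c, d) \<in> shard n \<Lambda> b a \<longleftrightarrow> c \<in> pts n \<and> d \<in> pts n \<and> d < c \<and>
     a \<le> d \<and> c \<le> b \<and> (c = b \<or> c \<in> \<Lambda>) \<and> (d = a \<or> d \<notin> \<Lambda>)"
  by (auto simp: shard_def all_pairs_def)

text \<open>An intermediate point e can serve as the upper member of a pair if it is in \<Lambda>
  and as the lower member otherwise. This is what makes shards compatible with meets and
  joins.\<close>

lemma shard_cotransitive:
  "(c, d) \<in> shard n \<Lambda> b a \<Longrightarrow> d < e \<Longrightarrow> e < c \<Longrightarrow> e \<in> pts n \<Longrightarrow>
     (c, e) \<in> shard n \<Lambda> b a \<or> (e, d) \<in> shard n \<Lambda> b a"
  by (auto simp: shard_iff)

text \<open>If both (b, c) and (c, a) were inversions of y, they would already be inversions of x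
  and compose to (b, a). One of them is needed because (b, a) is an inversion of y.\<close>

lemma edge_side:
  assumes e: "edge n x y b a" and c: "c \<in> pts n" "a < c" "c < b"
  shows "(c, a) \<in> invs n y \<longleftrightarrow> (b, c) \<notin> invs n y"
proof -
  have ba: "(b, a) \<in> invs n y" using edgeD(7)[OF e] by simp
  have "(c, a) \<in> invs n y \<Longrightarrow> (b, c) \<in> invs n y \<Longrightarrow> (b, a) \<in> invs n x"
  proof -
    assume 1: "(c, a) \<in> invs n y" "(b, c) \<in> invs n y"
    have "(c, a) \<in> invs n x" "(b, c) \<in> invs n x"
      using 1 edgeD(7)[OF e] c by auto
    then show ?thesis by (meson invs_trans)
  qed
  then show ?thesis using edgeD(6)[OF e] invs_cotrans[OF edgeD(2)[OF e] ba c] by blast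
qed

lemma edge_onD: "edge_on n \<Lambda> x y b a \<Longrightarrow> edge n x y b a"
  by (simp add: edge_on_def)

text \<open>In y the intermediate points of \<Lambda> stand before b, and the other intermediate
  points stand after a. A point of the first kind therefore precedes every point of the second
  kind.\<close>

lemma shard_subset_invs:
  assumes e: "edge_on n \<Lambda> x y b a"
  shows "shard n \<Lambda> b a \<subseteq> invs n y"
proof (rule subrelI)
  fix c d assume "(c, d) \<in> shard n \<Lambda> b a"
  then have cd: "c \<in> pts n" "d \<in> pts n" "d < c" "a \<le> d" "c \<le> b"
    "c = b \<or> c \<in> \<Lambda>" "d = a \<or> d \<notin> \<Lambda>" by (auto simp: shard_iff)
  note ed = edge_onD[OF e]
  have ba: "(b, a) \<in> invs n y" using edgeD(7)[OF ed] by simp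
  have c: "(c, a) \<in> invs n y \<and> (b, c) \<notin> invs n y" if "c \<noteq> b"
    using e cd that edge_side[OF ed cd(1)] unfolding edge_on_def by auto
  have d: "(b, d) \<in> invs n y" if "d \<noteq> a"
    using e cd that unfolding edge_on_def by auto
  show "(c, d) \<in> invs n y"
  proof (cases "c = b \<or> d = a")
    case True then show ?thesis using ba c d by auto
  next
    case False
    then show ?thesis using c d invs_cotrans[OF edgeD(2)[OF ed] _ cd(1,3), of b] cd by auto
  qed
qed

lemma edge_on_cong:
  assumes "edge_on n \<Lambda> x y b a" "\<And>c. c \<in> pts n \<Longrightarrow> a < c \<Longrightarrow> c < b \<Longrightarrow> c \<in> \<Lambda> \<longleftrightarrow> c \<in> \<Lambda>'"
  shows "edge_on n \<Lambda>' x y b a"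
  using assms by (auto simp: edge_on_def)

text \<open>The half-turn exchanges the two sides of an arc, so the left points of the turned arc
  are the negatives of the right points.\<close>

lemma edge_on_uminus:
  assumes e: "edge_on n \<Lambda> x y b a"
  shows "edge_on n {c. - c \<notin> \<Lambda>} x y (- a) (- b)"
proof -
  note ed = edge_onD[OF e]
  have "(- a, c) \<in> invs n y \<longleftrightarrow> - c \<in> \<Lambda>"
    if c: "c \<in> pts n" "- b < c" "c < - a" for c
  proof -
    have "(- a, c) \<in> invs n y \<longleftrightarrow> (- c, a) \<in> invs n y"
      using invs_uminus[OF edgeD(2)[OF ed], of a "- c"] by simp
    then show ?thesis using edge_side[OF ed, of "- c"] e c unfolding edge_on_def by auto
  qed
  then show ?thesis using edge_uminus[OF ed] by (auto simp: edge_on_def)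
qed

lemma invs_meet_subset:
  assumes "x \<in> signed_perms n" "y \<in> signed_perms n"
  shows "invs n (x \<sqinter>\<^bsub>weak_order n\<^esub> y) \<subseteq> invs n x \<inter> invs n y"
  unfolding invs_meet[OF assms] by auto

text \<open>The two edges are linked through m, the meet of y and y', and k, the meet of x and y'.
  The common shard survives in m, so m has the inversion (b, a), which k lacks. Meeting (x, y) with
  y' gives (k, m), and joining this with x' gives (x', y').\<close>

lemma same_arc:
  assumes C: "weak_congruence n \<theta>"
    and e: "edge_on n \<Lambda> x y b a" and e': "edge_on n \<Lambda> x' y' b a" and xy: "(x, y) \<in> \<theta>"
  shows "(x', y') \<in> \<theta>"
proof -
  note ed = edge_onD[OF e] and ed' = edge_onD[OF e']
  note car = edgeD(1,2)[OF ed] edgeD(1,2)[OF ed']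
  let ?m = "y \<sqinter>\<^bsub>weak_order n\<^esub> y'" and ?k = "x \<sqinter>\<^bsub>weak_order n\<^esub> y'"
  have mk: "?m \<in> signed_perms n" "?k \<in> signed_perms n"
    using weak.meet_closed[of _ n] car by auto
  have "shard n \<Lambda> b a \<subseteq> invs n ?m"
    by (rule meet_cotransitive[OF car(2,4)])
      (erule (3) shard_cotransitive | rule shard_subset_invs[OF e] shard_subset_invs[OF e'])+
  moreover have "(b, a) \<in> shard n \<Lambda> b a" using edgeD[OF ed] by (simp add: shard_iff)
  ultimately have m: "(b, a) \<in> invs n ?m" by blast
  have k: "(b, a) \<notin> invs n ?k" "invs n ?k \<subseteq> invs n y'"
    using invs_meet_subset[OF car(1,4)] edgeD(6)[OF ed] by blast+
  have "invs n ?k \<subseteq> invs n x'"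
    using k edgeD(7)[OF ed'] invs_uminus[OF mk(2), of a b] by auto
  then have kx: "?k \<squnion>\<^bsub>weak_order n\<^esub> x' = x'"
    using weak.join_absorb[of ?k n x'] mk car by (simp add: weak_le_iff)
  have my: "invs n ?m \<subseteq> invs n y'" using invs_meet_subset[OF car(2,4)] by blast
  have mc: "?m \<squnion>\<^bsub>weak_order n\<^esub> x' \<in> signed_perms n"
    using weak.join_closed[of ?m n x'] mk car by simp
  have below: "invs n (?m \<squnion>\<^bsub>weak_order n\<^esub> x') \<subseteq> invs n y'"
  proof -
    have "?m \<squnion>\<^bsub>weak_order n\<^esub> x' \<sqsubseteq>\<^bsub>weak_order n\<^esub> y'"
      using weak.join_le[of n ?m y' x'] my edgeD(7)[OF ed'] mk car by (auto simp: weak_le_iff)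
    then show ?thesis using mc car by (simp add: weak_le_iff)
  qed
  have "invs n ?m \<union> invs n x' \<subseteq> invs n (?m \<squnion>\<^bsub>weak_order n\<^esub> x')"
    unfolding invs_join[OF mk(1) car(3)] by (intro subrelI r_into_trancl)
  then have above: "invs n x' \<subseteq> invs n (?m \<squnion>\<^bsub>weak_order n\<^esub> x')"
    "(b, a) \<in> invs n (?m \<squnion>\<^bsub>weak_order n\<^esub> x')"
    using m by blast+
  have "?m \<squnion>\<^bsub>weak_order n\<^esub> x' = y'"
    using edge_no_between[OF ed' mc above(1) below] edgeD(6)[OF ed'] above(2) by metis
  moreover have "(?k \<squnion>\<^bsub>weak_order n\<^esub> x', ?m \<squnion>\<^bsub>weak_order n\<^esub> x') \<in> \<theta>"
    using weak.congruence_join(1)[OF C weak.congruence_meet(1)[OF C xy]] car by simp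
  ultimately show ?thesis using kx by simp
qed

section \<open>The congruence defined by shards\<close>

definition shards_below :: "nat \<Rightarrow> int set \<Rightarrow> (int \<Rightarrow> int) \<Rightarrow> (int \<times> int) set" where
  "shards_below n \<Lambda> x = {(b, a) \<in> all_pairs n. shard n \<Lambda> b a \<subseteq> invs n x}"

text \<open>The dual of \<open>shards_below\<close>: complementing the inversion set reverses the
  order of the entries and so exchanges the sides of an arc, whence - \<Lambda>.\<close>

definition shards_above :: "nat \<Rightarrow> int set \<Rightarrow> (int \<Rightarrow> int) \<Rightarrow> (int \<times> int) set" where
  "shards_above n \<Lambda> x = {(b, a) \<in> all_pairs n. shard n (- \<Lambda>) b a \<inter> invs n x = {}}"

definition shard_congruence :: "nat \<Rightarrow> int set \<Rightarrow> (int \<Rightarrow> int) rel" where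
  "shard_congruence n \<Lambda> = {(x, y). x \<in> signed_perms n \<and> y \<in> signed_perms n \<and>
     shards_below n \<Lambda> x = shards_below n \<Lambda> y}"

text \<open>Take a pair (c, d) of the dual shard in X with c - d minimal. For f outside \<Lambda>
  between d and c, the pair (f, d) is in the dual shard but, being shorter, not in X, so
  coclosedness puts (c, f) into X; for e in \<Lambda> it likewise puts (e, d) into X. X is any
  biclosed set so that complements of inversion sets are covered too.\<close>

lemma ex_shard_inside:
  assumes X: "biclosed n X" and cd: "(c, d) \<in> shard n (- \<Lambda>) b a" "(c, d) \<in> X"
  shows "\<exists>c d. (c, d) \<in> shard n (- \<Lambda>) b a \<and> shard n \<Lambda> c d \<subseteq> X"
  using cd
proof (induction "nat (c - d)" arbitrary: c d rule: less_induct)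
  case less
  have X3: "(p, r) \<in> X \<or> (r, q) \<in> X"
    if "(p, q) \<in> X" "r \<in> pts n" "q < r" "r < p" for p q r
    using X that unfolding biclosed_def by blast
  let ?T = "shard n (- \<Lambda>) b a"
  show ?case
  proof (cases "\<exists>p q. (p, q) \<in> ?T \<and> (p, q) \<in> X \<and> nat (p - q) < nat (c - d)")
    case True
    then show ?thesis using less.hyps by blast
  next
    case False
    have min: "(p, q) \<notin> X" if "(p, q) \<in> ?T" "p - q < c - d" for p q
      using False that by (auto simp: shard_iff)
    have "(e, f) \<in> X" if "(e, f) \<in> shard n \<Lambda> c d" for e f
    proof -
      have ef: "e \<in> pts n" "f \<in> pts n" "f < e" "d \<le> f" "e \<le> c"
        "e = c \<or> e \<in> \<Lambda>" "f = d \<or> f \<notin> \<Lambda>" using that by (auto simp: shard_iff)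
      have f: "(f, d) \<notin> X \<and> (c, f) \<in> X" if "f \<noteq> d"
      proof -
        have "(f, d) \<in> ?T" using less.prems(1) ef that by (auto simp: shard_iff)
        then show ?thesis using min[of f d] X3[OF less.prems(2) ef(2)] ef that by auto
      qed
      have e: "(e, d) \<in> X" if "e \<noteq> c"
      proof -
        have "(c, e) \<in> ?T" using less.prems(1) ef that by (auto simp: shard_iff)
        then show ?thesis using min[of c e] X3[OF less.prems(2) ef(1)] ef that by auto
      qed
      show ?thesis
      proof (cases "e = c \<or> f = d")
        case True then show ?thesis using e f less.prems(2) by auto
      next
        case False
        then show ?thesis using X3[of e d f] e f ef by auto
      qed
    qed
    then have "shard n \<Lambda> c d \<subseteq> X" by (rule subrelI)
    then show ?thesis using less.prems(1) by auto
  qed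
qed

text \<open>With the next lemma, each of the two families determines the other. Meets intersect one
  family and joins intersect the other, so both operations respect the relation.\<close>

lemma shards_above_determined:
  assumes x: "x \<in> signed_perms n"
  shows "shards_above n \<Lambda> x =
    {(b, a) \<in> all_pairs n. \<forall>(c, d) \<in> shard n (- \<Lambda>) b a. (c, d) \<notin> shards_below n \<Lambda> x}"
proof -
  have *: "shard n (- \<Lambda>) b a \<inter> invs n x \<noteq> {} \<longleftrightarrow>
      (\<exists>c d. (c, d) \<in> shard n (- \<Lambda>) b a \<and> shard n \<Lambda> c d \<subseteq> invs n x)" for b a
  proof
    assume "shard n (- \<Lambda>) b a \<inter> invs n x \<noteq> {}"
    then show "\<exists>c d. (c, d) \<in> shard n (- \<Lambda>) b a \<and> shard n \<Lambda> c d \<subseteq> invs n x"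
      using ex_shard_inside[OF biclosed_invs[OF x]] by fast
  next
    assume "\<exists>c d. (c, d) \<in> shard n (- \<Lambda>) b a \<and> shard n \<Lambda> c d \<subseteq> invs n x"
    then obtain c d where "(c, d) \<in> shard n (- \<Lambda>) b a" "shard n \<Lambda> c d \<subseteq> invs n x" by blast
    moreover from this have "(c, d) \<in> shard n \<Lambda> c d" by (simp add: shard_iff)
    ultimately show "shard n (- \<Lambda>) b a \<inter> invs n x \<noteq> {}" by blast
  qed
  have m: "(c, d) \<in> shards_below n \<Lambda> x \<longleftrightarrow> shard n \<Lambda> c d \<subseteq> invs n x"
    if "(c, d) \<in> shard n (- \<Lambda>) b a" for b a c d
    using that by (auto simp: shard_iff all_pairs_def shards_below_def)
  have "shard n (- \<Lambda>) b a \<inter> invs n x = {} \<longleftrightarrow>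
      (\<forall>(c, d) \<in> shard n (- \<Lambda>) b a. (c, d) \<notin> shards_below n \<Lambda> x)" for b a
    unfolding Ball_def split_paired_All prod.case using *[of b a] m[of _ _ b a] by metis
  then show ?thesis unfolding shards_above_def by simp
qed

lemma shards_below_determined:
  assumes x: "x \<in> signed_perms n"
  shows "shards_below n \<Lambda> x =
    {(b, a) \<in> all_pairs n. \<forall>(c, d) \<in> shard n \<Lambda> b a. (c, d) \<notin> shards_above n \<Lambda> x}"
proof -
  have sub: "shard n M b a \<subseteq> all_pairs n" for M b a by (auto simp: shard_iff all_pairs_def)
  have *: "\<not> shard n \<Lambda> b a \<subseteq> invs n x \<longleftrightarrow>
      (\<exists>c d. (c, d) \<in> shard n \<Lambda> b a \<and> shard n (- \<Lambda>) c d \<inter> invs n x = {})" for b a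
  proof
    assume "\<not> shard n \<Lambda> b a \<subseteq> invs n x"
    \<comment> \<open>Writing \<Lambda> as - (- \<Lambda>) lets \<open>ex_shard_inside\<close> be
      applied to - \<Lambda> and the complement of the inversion set.\<close>
    then obtain c d where "(c, d) \<in> shard n (- (- \<Lambda>)) b a" "(c, d) \<in> all_pairs n - invs n x"
      using sub[of \<Lambda> b a] by auto
    then obtain c d where "(c, d) \<in> shard n (- (- \<Lambda>)) b a" "shard n (- \<Lambda>) c d \<subseteq> all_pairs n - invs n x"
      using ex_shard_inside[OF biclosed_Compl[OF biclosed_invs[OF x]]] by meson
    then show "\<exists>c d. (c, d) \<in> shard n \<Lambda> b a \<and> shard n (- \<Lambda>) c d \<inter> invs n x = {}" by auto
  next
    assume "\<exists>c d. (c, d) \<in> shard n \<Lambda> b a \<and> shard n (- \<Lambda>) c d \<inter> invs n x = {}"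
    then obtain c d where "(c, d) \<in> shard n \<Lambda> b a" "shard n (- \<Lambda>) c d \<inter> invs n x = {}" by blast
    moreover from this have "(c, d) \<in> shard n (- \<Lambda>) c d" by (simp add: shard_iff)
    ultimately show "\<not> shard n \<Lambda> b a \<subseteq> invs n x" by blast
  qed
  have m: "(c, d) \<in> shards_above n \<Lambda> x \<longleftrightarrow> shard n (- \<Lambda>) c d \<inter> invs n x = {}"
    if "(c, d) \<in> shard n \<Lambda> b a" for b a c d
    using that by (auto simp: shard_iff all_pairs_def shards_above_def)
  have "shard n \<Lambda> b a \<subseteq> invs n x \<longleftrightarrow>
      (\<forall>(c, d) \<in> shard n \<Lambda> b a. (c, d) \<notin> shards_above n \<Lambda> x)" for b a
    unfolding Ball_def split_paired_All prod.case using *[of b a] m[of _ _ b a] by metis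
  then show ?thesis unfolding shards_below_def by simp
qed

lemma shard_congruence_iff_above:
  assumes "x \<in> signed_perms n" "y \<in> signed_perms n"
  shows "(x, y) \<in> shard_congruence n \<Lambda> \<longleftrightarrow> shards_above n \<Lambda> x = shards_above n \<Lambda> y"
proof
  assume "(x, y) \<in> shard_congruence n \<Lambda>"
  then show "shards_above n \<Lambda> x = shards_above n \<Lambda> y"
    using assms by (simp add: shard_congruence_def shards_above_determined)
next
  assume "shards_above n \<Lambda> x = shards_above n \<Lambda> y"
  then show "(x, y) \<in> shard_congruence n \<Lambda>"
    using assms by (simp add: shard_congruence_def shards_below_determined)
qed

lemma shards_below_meet:
  assumes "x \<in> signed_perms n" "y \<in> signed_perms n"
  shows "shards_below n \<Lambda> (x \<sqinter>\<^bsub>weak_order n\<^esub> y) = shards_below n \<Lambda> x \<inter> shards_below n \<Lambda> y"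
proof -
  have "shard n \<Lambda> b a \<subseteq> invs n (x \<sqinter>\<^bsub>weak_order n\<^esub> y) \<longleftrightarrow>
      shard n \<Lambda> b a \<subseteq> invs n x \<and> shard n \<Lambda> b a \<subseteq> invs n y" for b a
    using meet_cotransitive[OF assms, of "shard n \<Lambda> b a"] shard_cotransitive[of _ _ n \<Lambda> b a]
      invs_meet_subset[OF assms] by auto
  then show ?thesis unfolding shards_below_def by auto
qed

lemma shards_above_join:
  assumes "x \<in> signed_perms n" "y \<in> signed_perms n"
  shows "shards_above n \<Lambda> (x \<squnion>\<^bsub>weak_order n\<^esub> y) = shards_above n \<Lambda> x \<inter> shards_above n \<Lambda> y"
proof -
  have "shard n (- \<Lambda>) b a \<inter> invs n (x \<squnion>\<^bsub>weak_order n\<^esub> y) = {} \<longleftrightarrow>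
      shard n (- \<Lambda>) b a \<inter> invs n x = {} \<and> shard n (- \<Lambda>) b a \<inter> invs n y = {}" for b a
  proof
    assume "shard n (- \<Lambda>) b a \<inter> invs n (x \<squnion>\<^bsub>weak_order n\<^esub> y) = {}"
    moreover have "invs n x \<union> invs n y \<subseteq> invs n (x \<squnion>\<^bsub>weak_order n\<^esub> y)"
      unfolding invs_join[OF assms] by auto
    ultimately show "shard n (- \<Lambda>) b a \<inter> invs n x = {} \<and> shard n (- \<Lambda>) b a \<inter> invs n y = {}"
      by blast
  next
    assume *: "shard n (- \<Lambda>) b a \<inter> invs n x = {} \<and> shard n (- \<Lambda>) b a \<inter> invs n y = {}"
    show "shard n (- \<Lambda>) b a \<inter> invs n (x \<squnion>\<^bsub>weak_order n\<^esub> y) = {}"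
      by (rule join_cotransitive[OF assms]) (erule (3) shard_cotransitive | simp add: *)+
  qed
  then show ?thesis unfolding shards_above_def by auto
qed

lemma lattice_congruence_shard_congruence: "weak_congruence n (shard_congruence n \<Lambda>)"
  unfolding lattice_congruence_def
proof (intro conjI allI impI)
  show "equiv (carrier (weak_order n)) (shard_congruence n \<Lambda>)"
    by (intro equivI refl_onI symI transI) (auto simp: shard_congruence_def)
next
  fix x x' y y' assume xy: "(x, x') \<in> shard_congruence n \<Lambda>" "(y, y') \<in> shard_congruence n \<Lambda>"
  then have car: "x \<in> signed_perms n" "x' \<in> signed_perms n" "y \<in> signed_perms n" "y' \<in> signed_perms n"
    by (auto simp: shard_congruence_def)
  have c: "x \<squnion>\<^bsub>weak_order n\<^esub> y \<in> signed_perms n" "x' \<squnion>\<^bsub>weak_order n\<^esub> y' \<in> signed_perms n"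
    "x \<sqinter>\<^bsub>weak_order n\<^esub> y \<in> signed_perms n" "x' \<sqinter>\<^bsub>weak_order n\<^esub> y' \<in> signed_perms n"
    using weak.join_closed[of _ n] weak.meet_closed[of _ n] car by auto
  show "(x \<squnion>\<^bsub>weak_order n\<^esub> y, x' \<squnion>\<^bsub>weak_order n\<^esub> y') \<in> shard_congruence n \<Lambda>"
    using xy car c by (simp add: shard_congruence_iff_above shards_above_join)
  show "(x \<sqinter>\<^bsub>weak_order n\<^esub> y, x' \<sqinter>\<^bsub>weak_order n\<^esub> y') \<in> shard_congruence n \<Lambda>"
    using xy car c by (simp add: shard_congruence_def shards_below_meet)
qed

text \<open>For the second claim, a shard contained in y but not in x must contain one of the two
  added pairs. If it is the negative pair, the half-turn and the symmetry of \<Lambda> lead back to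
  (b, a).\<close>

lemma edge_in_shard_congruence:
  assumes ed: "edge n x y b a"
  shows "edge_on n \<Lambda> x y b a \<Longrightarrow> (x, y) \<notin> shard_congruence n \<Lambda>"
    and "(\<And>c. c \<in> pts n \<Longrightarrow> \<bar>c\<bar> < int n \<Longrightarrow> c \<in> \<Lambda> \<longleftrightarrow> - c \<notin> \<Lambda>) \<Longrightarrow>
      (x, y) \<notin> shard_congruence n \<Lambda> \<Longrightarrow> edge_on n \<Lambda> x y b a"
proof -
  assume e: "edge_on n \<Lambda> x y b a"
  have ba: "(b, a) \<in> all_pairs n" "(b, a) \<in> shard n \<Lambda> b a"
    using edgeD[OF ed] by (auto simp: all_pairs_def shard_iff)
  then have "(b, a) \<in> shards_below n \<Lambda> y" "(b, a) \<notin> shards_below n \<Lambda> x"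
    using shard_subset_invs[OF e] edgeD(6)[OF ed] unfolding shards_below_def by auto
  then show "(x, y) \<notin> shard_congruence n \<Lambda>" by (auto simp: shard_congruence_def)
next
  assume sym: "\<And>c. c \<in> pts n \<Longrightarrow> \<bar>c\<bar> < int n \<Longrightarrow> c \<in> \<Lambda> \<longleftrightarrow> - c \<notin> \<Lambda>"
    and no: "(x, y) \<notin> shard_congruence n \<Lambda>"
  have sub: "invs n x \<subseteq> invs n y" using edgeD(7)[OF ed] by auto
  \<comment> \<open>A shard containing (b, a) also contains (b, c) for c outside \<Lambda> and (c,
    a) for c in \<Lambda>, which fixes the side of every intermediate point.\<close>
  have main: "edge_on n \<Lambda> x y b a"
    if ed: "edge n x y b a" and sh: "(b, a) \<in> shard n \<Lambda> B A" "shard n \<Lambda> B A \<subseteq> invs n y" for b a B A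
  proof -
    have "(b, c) \<in> invs n y" if "c \<in> pts n" "a < c" "c < b" "c \<notin> \<Lambda>" for c
    proof -
      have "(b, c) \<in> shard n \<Lambda> B A" using sh(1) that by (auto simp: shard_iff)
      then show ?thesis using sh(2) by blast
    qed
    moreover have "(b, c) \<notin> invs n y" if "c \<in> pts n" "a < c" "c < b" "c \<in> \<Lambda>" for c
    proof -
      have "(c, a) \<in> shard n \<Lambda> B A" using sh(1) that by (auto simp: shard_iff)
      then show ?thesis using sh(2) edge_side[OF ed that(1-3)] by blast
    qed
    ultimately show ?thesis using ed unfolding edge_on_def by blast
  qed
  have "shards_below n \<Lambda> x \<subseteq> shards_below n \<Lambda> y" using sub unfolding shards_below_def by auto
  moreover have "shards_below n \<Lambda> x \<noteq> shards_below n \<Lambda> y"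
    using no edgeD(1,2)[OF ed] by (simp add: shard_congruence_def)
  ultimately obtain B A where "(B, A) \<in> shards_below n \<Lambda> y" "(B, A) \<notin> shards_below n \<Lambda> x" by auto
  then have BA: "shard n \<Lambda> B A \<subseteq> invs n y" "\<not> shard n \<Lambda> B A \<subseteq> invs n x"
    by (auto simp: shards_below_def)
  then have "(b, a) \<in> shard n \<Lambda> B A \<or> (- a, - b) \<in> shard n \<Lambda> B A" using edgeD(7)[OF ed] by auto
  then show "edge_on n \<Lambda> x y b a"
  proof
    assume "(b, a) \<in> shard n \<Lambda> B A" then show ?thesis using main[OF ed _ BA(1)] by simp
  next
    assume "(- a, - b) \<in> shard n \<Lambda> B A"
    then have "edge_on n \<Lambda> x y (- a) (- b)" using main[OF edge_uminus[OF ed] _ BA(1)] by simp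
    from edge_on_uminus[OF this] have "edge_on n {c. - c \<notin> \<Lambda>} x y b a" by simp
    then show ?thesis
    proof (rule edge_on_cong)
      fix c assume c: "c \<in> pts n" "a < c" "c < b"
      then have "\<bar>c\<bar> < int n" using edgeD(3,4)[OF ed] by (auto simp: signed_points_iff abs_less_iff)
      then show "c \<in> {c. - c \<notin> \<Lambda>} \<longleftrightarrow> c \<in> \<Lambda>" using sym[OF c(1)] by blast
    qed
  qed
qed

lemma weak_polygon:
  assumes C: "weak_congruence n \<theta>"
    and car: "u \<in> signed_perms n" "v \<in> signed_perms n" "w \<in> signed_perms n" "p \<in> signed_perms n" "q \<in> signed_perms n"
    and le: "invs n u \<subseteq> invs n v" "invs n v \<subseteq> invs n p"
      "invs n u \<subseteq> invs n w" "invs n w \<subseteq> invs n q"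
    and meet: "invs n p \<inter> invs n w \<subseteq> invs n u" "invs n q \<inter> invs n v \<subseteq> invs n u"
    and join: "invs n p \<subseteq> (invs n v \<union> invs n w)\<^sup>+" "invs n q \<subseteq> (invs n v \<union> invs n w)\<^sup>+"
    and contr: "(u, v) \<in> \<theta> \<or> (u, w) \<in> \<theta>"
  shows "(v, p) \<in> \<theta>" "(w, q) \<in> \<theta>"
proof -
  have cl: "p \<sqinter>\<^bsub>weak_order n\<^esub> w \<in> signed_perms n" "q \<sqinter>\<^bsub>weak_order n\<^esub> v \<in> signed_perms n"
    "v \<squnion>\<^bsub>weak_order n\<^esub> w \<in> signed_perms n"
    using weak.join_closed[of _ n] weak.meet_closed[of _ n] car by auto
  have le': "u \<sqsubseteq>\<^bsub>weak_order n\<^esub> v" "v \<sqsubseteq>\<^bsub>weak_order n\<^esub> p" "u \<sqsubseteq>\<^bsub>weak_order n\<^esub> w" "w \<sqsubseteq>\<^bsub>weak_order n\<^esub> q"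
    using le car by (auto simp: weak_le_iff)
  have meet': "p \<sqinter>\<^bsub>weak_order n\<^esub> w \<sqsubseteq>\<^bsub>weak_order n\<^esub> u" "q \<sqinter>\<^bsub>weak_order n\<^esub> v \<sqsubseteq>\<^bsub>weak_order n\<^esub> u"
    using invs_meet_subset[of p n w] invs_meet_subset[of q n v] car cl meet
    by (auto simp: weak_le_iff)
  have join': "p \<sqsubseteq>\<^bsub>weak_order n\<^esub> v \<squnion>\<^bsub>weak_order n\<^esub> w" "q \<sqsubseteq>\<^bsub>weak_order n\<^esub> v \<squnion>\<^bsub>weak_order n\<^esub> w"
    using join car cl by (auto simp: weak_le_iff invs_join)
  have "(v, p) \<in> \<theta> \<and> (w, q) \<in> \<theta>"
    using contr
  proof
    assume "(u, v) \<in> \<theta>"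
    then show ?thesis
      using weak.congruence_polygon[OF C _ _ _ _ _ le' meet' join'] car by simp
  next
    assume "(u, w) \<in> \<theta>"
    then show ?thesis
      using weak.congruence_polygon[OF C _ _ _ _ _ le'(3,4,1,2) meet'(2,1)] join' car
      by (simp add: weak.join_commute[of n w v])
  qed
  then show "(v, p) \<in> \<theta>" "(w, q) \<in> \<theta>" by auto
qed

section \<open>Polygons\<close>

text \<open>The entries in Y take values in a zone Z, where h inverts f; all others keep their
  values up to a shift by K. As K exceeds the diameter 2n of the points, differently shifted values
  never meet.\<close>

lemma key_piecewise:
  fixes K :: int
  assumes neg: "\<And>c. c \<in> pts n \<Longrightarrow> f (- c) = - f c" and K: "\<bar>K\<bar> > 2 * int n"
    and special: "\<And>c. c \<in> Y \<Longrightarrow> Z (f c) \<and> h (f c) = c"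
    and shift: "\<And>c. c \<in> pts n \<Longrightarrow> c \<notin> Y \<Longrightarrow> \<not> Z (f c) \<and> (f c = c \<or> f c = c + K \<or> f c = c - K)"
  shows "key n f"
proof -
  have "c = c'" if cc: "f c = f c'" "c \<in> pts n" "c' \<in> pts n" for c c'
  proof (cases "c \<in> Y \<or> c' \<in> Y")
    case True
    then have "c \<in> Y" "c' \<in> Y" using special shift cc by metis+
    then show ?thesis using special cc(1) by metis
  next
    case False
    then have "f c = c \<or> f c = c + K \<or> f c = c - K" "f c' = c' \<or> f c' = c' + K \<or> f c' = c' - K"
      using shift cc(2,3) by blast+
    moreover have "\<bar>c\<bar> \<le> int n" "\<bar>c'\<bar> \<le> int n" using cc(2,3) by (auto simp: signed_points_iff)
    ultimately show ?thesis using cc(1) K by (elim disjE) linarith+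
  qed
  then show ?thesis using neg by (simp add: key_def inj_on_def)
qed

text \<open>After the swap b and a are adjacent with b first, so comparing g c with g b alone
  decides the side of c.\<close>

lemma edge_on_swap:
  assumes f: "key n f" and ab: "a \<in> pts n" "b \<in> pts n" "a < b" "f a < f b"
    and adj: "\<And>c. c \<in> pts n \<Longrightarrow> \<not> (f a < f c \<and> f c < f b)"
    and g: "g = f \<circ> swap_values a b"
    and side: "\<And>c. c \<in> pts n \<Longrightarrow> a < c \<Longrightarrow> c < b \<Longrightarrow> g b < g c \<longleftrightarrow> c \<notin> \<Lambda>"
  shows "edge_on n \<Lambda> (perm_of_key n f) (perm_of_key n g) b a"
proof -
  have "invs n (perm_of_key n g) = key_invs n g"
    unfolding g by (rule perm_of_key(2)[OF key_swap[OF f ab(1,2)]]) (use ab in simp)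
  then show ?thesis
    using edge_swap[OF f ab adj] side ab unfolding edge_on_def g by (auto simp: key_invs_def)
qed

text \<open>Three points in consecutive positions span a hexagon of the weak order. The positions to the
  right (\<open>s = 1\<close>) or to the left (\<open>s = -1\<close>) of the centre can host them, with the points of \<open>X\<close>
  moved further outside.\<close>

lemma hexagon:
  fixes s :: int
  assumes pts: "a \<in> pts n" "e \<in> pts n" "b \<in> pts n"
    and ord: "a < e" "e < b" and ne: "b \<noteq> - a" "e \<noteq> - a" "e \<noteq> - b" and s: "s = 1 \<or> s = - 1"
    and X: "X = {c \<in> pts n. a < c \<and> c < b \<and> c \<noteq> e \<and> (c \<in> \<Lambda> \<longleftrightarrow> s = - 1)}"
    and sep: "\<And>c. c \<in> X \<Longrightarrow> - c \<notin> X \<and> - c \<noteq> a \<and> - c \<noteq> b \<and> - c \<noteq> e"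
  shows "\<exists>u v w x y. edge_on n \<Lambda> u v e a \<and> edge_on n \<Lambda> u w b e \<and> edge_on n \<Lambda> x y b a \<and>
    (\<forall>\<theta>. weak_congruence n \<theta> \<longrightarrow> (u, v) \<in> \<theta> \<or> (u, w) \<in> \<theta> \<longrightarrow> (x, y) \<in> \<theta>)"
proof -
  \<comment> \<open>The slots t - 1, t, t + 1 have absolute values n + 1 to n + 3, just beyond the
    unshifted entries. A shift by K moves an entry of X to absolute value at least 2n + 10, beyond
    the slots.\<close>
  define t where "t = s * (int n + 2)"
  define K where "K = s * (3 * int n + 10)"
  \<comment> \<open>Unshifted entries lie between the slots and their negatives. Only points that
    belong on the outer side of the slots are moved: right points if s = 1, left points if s = - 1.
    Their negatives move oppositely to keep the function odd.\<close>
  define base where "base c = (if c \<in> X then c + K else if - c \<in> X then c - K else c)" for c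
  define k where "k p q r c = (if c = a then p else if c = e then q else if c = b then r
    else if c = - a then - p else if c = - e then - q else if c = - b then - r else base c)" for p q r c :: int
  have nz: "a \<noteq> 0" "e \<noteq> 0" "b \<noteq> 0" using pts by (auto simp: signed_points_iff)
  have d: "a \<noteq> e" "a \<noteq> b" "e \<noteq> b" "e \<noteq> a" "b \<noteq> a" "b \<noteq> e" "a \<noteq> - a" "e \<noteq> - e" "b \<noteq> - b" "- a \<noteq> a" "- e \<noteq> e" "- b \<noteq> b"
    "b \<noteq> - a" "e \<noteq> - a" "e \<noteq> - b" "a \<noteq> - b" "a \<noteq> - e" "b \<noteq> - e" "- a \<noteq> b" "- a \<noteq> e" "- b \<noteq> e" "- b \<noteq> a" "- e \<noteq> a" "- e \<noteq> b"
    using ord ne nz by auto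
  have kv: "k p q r a = p" "k p q r e = q" "k p q r b = r" "k p q r (- a) = - p" "k p q r (- e) = - q" "k p q r (- b) = - r" for p q r
    using d by (simp_all add: k_def)
  have base_far: "\<bar>base c\<bar> \<le> int n \<or> \<bar>base c\<bar> > int n + 3" if "c \<in> pts n" for c
    using that s unfolding base_def K_def signed_points_iff by auto
  have base_neg: "base (- c) = - base c" for c
    unfolding base_def using sep[of c] sep[of "- c"] by auto
  have t: "\<bar>t\<bar> = int n + 2" using s unfolding t_def by auto
  have kodd: "k p q r (- c) = - k p q r c" if "c \<in> pts n" for c p q r
  proof (cases "c = a \<or> c = e \<or> c = b \<or> c = - a \<or> c = - e \<or> c = - b")
    case True
    then show ?thesis by (elim disjE) (simp_all add: kv)
  next
    case False
    then have "- c \<noteq> a" "- c \<noteq> e" "- c \<noteq> b" "- c \<noteq> - a" "- c \<noteq> - e" "- c \<noteq> - b" by linarith+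
    then have "k p q r (- c) = base (- c)" unfolding k_def by (simp only: if_False)
    moreover have "k p q r c = base c" using False unfolding k_def by (simp only: if_False de_Morgan_disj)
    ultimately show ?thesis using base_neg by simp
  qed
  have key0: "key n (k (t - 1) t (t + 1))"
  proof -
    let ?k = "k (t - 1) t (t + 1)"
    let ?Y = "{a, e, b, - a, - e, - b}"
    define h where "h v = (if v = t - 1 then a else if v = t then e else if v = t + 1 then b
          else if v = - (t - 1) then - a else if v = - t then - e else - b)" for v
    show ?thesis
    proof (rule key_piecewise[where K = K and Y = ?Y and h = h and Z = "\<lambda>v. \<bar>v\<bar> > int n \<and> \<bar>v\<bar> \<le> int n + 3"])
      show "?k (- c) = - ?k c" if "c \<in> pts n" for c by (rule kodd[OF that])
      show "\<bar>K\<bar> > 2 * int n" using s unfolding K_def by auto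
      show "(\<bar>?k c\<bar> > int n \<and> \<bar>?k c\<bar> \<le> int n + 3) \<and> h (?k c) = c" if "c \<in> ?Y" for c
        using that unfolding insert_iff empty_iff
        by (elim disjE FalseE; hypsubst; unfold kv h_def) (use t in \<open>auto simp: abs_if split: if_splits\<close>)
      fix c assume c: "c \<in> pts n" "c \<notin> ?Y"
      then have "?k c = base c" by (simp add: k_def)
      then show "\<not> (\<bar>?k c\<bar> > int n \<and> \<bar>?k c\<bar> \<le> int n + 3) \<and> (?k c = c \<or> ?k c = c + K \<or> ?k c = c - K)"
        using base_far[OF c(1)] by (auto simp: base_def)
    qed
  qed
  have eqs: "k t (t - 1) (t + 1) = k (t - 1) t (t + 1) \<circ> swap_values a e"
    "k (t + 1) (t - 1) t = k t (t - 1) (t + 1) \<circ> swap_values a b"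
    "k (t - 1) (t + 1) t = k (t - 1) t (t + 1) \<circ> swap_values e b"
    "k t (t + 1) (t - 1) = k (t - 1) (t + 1) t \<circ> swap_values a b"
  proof -
    have eqI: "f = g"
      if "f a = g a" "f e = g e" "f b = g b" "f (- a) = g (- a)" "f (- e) = g (- e)" "f (- b) = g (- b)"
        "\<And>c. c \<noteq> a \<Longrightarrow> c \<noteq> e \<Longrightarrow> c \<noteq> b \<Longrightarrow> c \<noteq> - a \<Longrightarrow> c \<noteq> - e \<Longrightarrow> c \<noteq> - b \<Longrightarrow> f c = g c" for f g :: "int \<Rightarrow> int"
    proof (rule ext)
      fix c show "f c = g c"
        using that by (cases "c = a \<or> c = e \<or> c = b \<or> c = - a \<or> c = - e \<or> c = - b") auto
    qed
    have out: "k p q r c = base c"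
      if "c \<noteq> a" "c \<noteq> e" "c \<noteq> b" "c \<noteq> - a" "c \<noteq> - e" "c \<noteq> - b" for p q r c
      using that by (simp add: k_def)
    show "k t (t - 1) (t + 1) = k (t - 1) t (t + 1) \<circ> swap_values a e"
      "k (t + 1) (t - 1) t = k t (t - 1) (t + 1) \<circ> swap_values a b"
      "k (t - 1) (t + 1) t = k (t - 1) t (t + 1) \<circ> swap_values e b"
      "k t (t + 1) (t - 1) = k (t - 1) (t + 1) t \<circ> swap_values a b"
      by (rule eqI; simp add: swap_values_def kv d nz out)+
  qed
  have key1: "key n (k t (t - 1) (t + 1))" "key n (k (t - 1) (t + 1) t)"
    unfolding eqs using key_swap[OF key0 pts(1,2)] key_swap[OF key0 pts(2,3)] d by simp_all
  have side: "(t + 1 < k p q r c \<longleftrightarrow> c \<notin> \<Lambda>) \<and> (k p q r c < t - 1 \<longleftrightarrow> c \<in> \<Lambda>)"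
    if c: "c \<in> pts n" "a < c" "c < b" "c \<noteq> e"
      and pqr: "\<bar>p - t\<bar> \<le> 1" "\<bar>q - t\<bar> \<le> 1" "\<bar>r - t\<bar> \<le> 1" for c p q r
  proof -
    have cX: "c \<in> X \<longleftrightarrow> (c \<in> \<Lambda> \<longleftrightarrow> s = - 1)" using c unfolding X by simp
    show ?thesis
    proof (cases "c = - a \<or> c = - e \<or> c = - b")
      case True
      then have "c \<notin> X" using sep[of c] by auto
      moreover have "k p q r c \<in> {- p, - q, - r}" using True kv by auto
      ultimately show ?thesis using cX s pqr unfolding t_def by auto
    next
      case False
      then have "k p q r c = base c" using c unfolding k_def by auto
      moreover have "\<bar>c\<bar> \<le> int n" using c by (auto simp: signed_points_iff)
      ultimately show ?thesis using cX s sep[of c] unfolding base_def t_def K_def by auto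
    qed
  qed
  let ?P = "\<lambda>p q r. perm_of_key n (k p q r)"
  have e1: "edge_on n \<Lambda> (?P (t - 1) t (t + 1)) (?P t (t - 1) (t + 1)) e a"
  proof (rule edge_on_swap[OF key0 pts(1,2) ord(1) _ _ eqs(1)])
    fix c assume c: "c \<in> pts n" "a < c" "c < e"
    show "k t (t - 1) (t + 1) e < k t (t - 1) (t + 1) c \<longleftrightarrow> c \<notin> \<Lambda>"
      using side[of c t "t - 1" "t + 1"] c ord unfolding kv by auto
  qed (use kv in auto)
  have e2: "edge_on n \<Lambda> (?P (t - 1) t (t + 1)) (?P (t - 1) (t + 1) t) b e"
  proof (rule edge_on_swap[OF key0 pts(2,3) ord(2) _ _ eqs(3)])
    fix c assume c: "c \<in> pts n" "e < c" "c < b"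
    show "k (t - 1) (t + 1) t b < k (t - 1) (t + 1) t c \<longleftrightarrow> c \<notin> \<Lambda>"
      using side[of c "t - 1" "t + 1" t] c ord unfolding kv by auto
  qed (use kv in auto)
  have e3: "edge n (?P t (t - 1) (t + 1)) (?P (t + 1) (t - 1) t) b a"
    unfolding eqs(2) by (rule edge_swap[OF key1(1) pts(1,3)]) (use kv ord in auto)
  have e4: "edge n (?P (t - 1) (t + 1) t) (?P t (t + 1) (t - 1)) b a"
    unfolding eqs(4) by (rule edge_swap[OF key1(2) pts(1,3)]) (use kv ord in auto)
  note E = edge_onD[OF e1] edge_onD[OF e2] e3 e4
  \<comment> \<open>In the slots, u reads a e b. One side of the hexagon continues with e a b (v)
    and e b a (p), the other with a b e (w) and b a e (q); both end at b e a.\<close>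
  let ?u = "?P (t - 1) t (t + 1)" and ?v = "?P t (t - 1) (t + 1)" and ?w = "?P (t - 1) (t + 1) t"
    and ?p = "?P (t + 1) (t - 1) t" and ?q = "?P t (t + 1) (t - 1)"
  have I: "invs n ?v = insert (e, a) (insert (- a, - e) (invs n ?u))"
    "invs n ?w = insert (b, e) (insert (- e, - b) (invs n ?u))"
    "invs n ?p = insert (b, a) (insert (- a, - b) (invs n ?v))"
    "invs n ?q = insert (b, a) (insert (- a, - b) (invs n ?w))"
    using edgeD(7)[OF E(1)] edgeD(7)[OF E(2)] edgeD(7)[OF E(3)] edgeD(7)[OF E(4)] .
  have J: "(b, a) \<in> (invs n ?v \<union> invs n ?w)\<^sup>+" "(- a, - b) \<in> (invs n ?v \<union> invs n ?w)\<^sup>+"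
    unfolding I by (rule trancl_trans[of _ e] trancl_trans[of _ "- e"]; auto intro: r_into_trancl')+
  have poly: "(?v, ?p) \<in> \<theta> \<and> (?w, ?q) \<in> \<theta>"
    if C: "weak_congruence n \<theta>" and c: "(?u, ?v) \<in> \<theta> \<or> (?u, ?w) \<in> \<theta>" for \<theta>
  proof -
    have U: "invs n ?v \<union> invs n ?w \<subseteq> (invs n ?v \<union> invs n ?w)\<^sup>+" by auto
    have "invs n ?p \<subseteq> (invs n ?v \<union> invs n ?w)\<^sup>+"
      "invs n ?q \<subseteq> (invs n ?v \<union> invs n ?w)\<^sup>+"
      unfolding I(3,4) using U J by simp_all
    moreover have "invs n ?p \<inter> invs n ?w \<subseteq> invs n ?u"
      "invs n ?q \<inter> invs n ?v \<subseteq> invs n ?u"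
      unfolding I using d by auto
    moreover have "invs n ?u \<subseteq> invs n ?v" "invs n ?v \<subseteq> invs n ?p"
      "invs n ?u \<subseteq> invs n ?w" "invs n ?w \<subseteq> invs n ?q"
      using I by auto
    ultimately show ?thesis
      using weak_polygon[OF C, of ?u ?v ?w ?p ?q] c edgeD(1,2)[OF E(1)] edgeD(1,2)[OF E(2)]
        edgeD(1,2)[OF E(3)] edgeD(1,2)[OF E(4)] by simp
  qed
  have ab: "a < b" using ord by simp
  \<comment> \<open>Both middle edges exchange a and b. On the side of v the point e stands before
    them, on the side of w after them, so membership of e in \<Lambda> selects the edge with the
    wanted arc.\<close>
  have e5: "edge_on n \<Lambda> ?v ?p b a" if e: "e \<in> \<Lambda>"
  proof (rule edge_on_swap[OF key1(1) pts(1,3) ab _ _ eqs(2)])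
    fix c assume c: "c \<in> pts n" "a < c" "c < b"
    show "k (t + 1) (t - 1) t b < k (t + 1) (t - 1) t c \<longleftrightarrow> c \<notin> \<Lambda>"
      using side[of c "t + 1" "t - 1" t] c e kv by (cases "c = e") auto
  qed (use kv in auto)
  have e6: "edge_on n \<Lambda> ?w ?q b a" if e: "e \<notin> \<Lambda>"
  proof (rule edge_on_swap[OF key1(2) pts(1,3) ab _ _ eqs(4)])
    fix c assume c: "c \<in> pts n" "a < c" "c < b"
    show "k t (t + 1) (t - 1) b < k t (t + 1) (t - 1) c \<longleftrightarrow> c \<notin> \<Lambda>"
      using side[of c t "t + 1" "t - 1"] c e kv by (cases "c = e") auto
  qed (use kv in auto)
  show ?thesis
  proof (cases "e \<in> \<Lambda>")
    case True
    then show ?thesis using e1 e2 e5 poly by blast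
  next
    case False
    then show ?thesis using e1 e2 e6 poly by blast
  qed
qed


text \<open>Here e, b and their negatives fill the four central positions, whose rearrangements form
  a copy of B_2. Each side of the octagon has two middle edges, one exchanging b with - b and one
  exchanging b with - e. The point e is left of both arcs on the side of v and right of both on the
  side of w.\<close>

lemma octagon:
  assumes pts: "e \<in> pts n" "b \<in> pts n" and ord: "0 < e" "e < b"
    and sym: "\<And>c. c \<in> pts n \<Longrightarrow> \<bar>c\<bar> < b \<Longrightarrow> c \<in> \<Lambda> \<longleftrightarrow> - c \<notin> \<Lambda>"
  shows "\<exists>u v w x y z t. edge_on n \<Lambda> u v e (- e) \<and> edge_on n \<Lambda> u w b e \<and>
    edge_on n \<Lambda> x y b (- b) \<and> edge_on n \<Lambda> z t b (- e) \<and>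
    (\<forall>\<theta>. weak_congruence n \<theta> \<longrightarrow> (u, v) \<in> \<theta> \<or> (u, w) \<in> \<theta> \<longrightarrow> (x, y) \<in> \<theta> \<and> (z, t) \<in> \<theta>)"
proof -
  define K where "K = 3 * int n + 10"
  \<comment> \<open>Entries with absolute value below b are sent far out to their side. Those above
    b stay; since b >= 2 they have absolute value at least 3 and avoid the four central
    positions.\<close>
  define base where "base c = (if \<bar>c\<bar> < b then if c \<in> \<Lambda> then c - K else c + K else c)" for c
  define k where "k p q c = (if c = b then p else if c = e then q
    else if c = - b then - p else if c = - e then - q else base c)" for p q c :: int
  have npts: "- e \<in> pts n" "- b \<in> pts n" using pts by simp_all
  have d: "e \<noteq> b" "b \<noteq> e" "e \<noteq> - e" "b \<noteq> - b" "- e \<noteq> e" "- b \<noteq> b" "e \<noteq> - b" "b \<noteq> - e" "- e \<noteq> b" "- b \<noteq> e"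
    "e \<noteq> 0" "b \<noteq> 0" using ord by auto
  have kv: "k p q b = p" "k p q e = q" "k p q (- b) = - p" "k p q (- e) = - q" for p q
    using d by (simp_all add: k_def)
  have out: "k p q c = base c" if "c \<noteq> b" "c \<noteq> e" "c \<noteq> - b" "c \<noteq> - e" for p q c
    using that by (simp add: k_def)
  have base_far: "\<bar>base c\<bar> > 2" if "c \<in> pts n" "c \<noteq> b" "c \<noteq> - b" for c
    using that ord unfolding base_def K_def signed_points_iff by auto
  have base_neg: "base (- c) = - base c" if "c \<in> pts n" for c
    unfolding base_def using sym[of c] that by auto
  have kodd: "k p q (- c) = - k p q c" if "c \<in> pts n" for c p q
  proof (cases "c = b \<or> c = e \<or> c = - b \<or> c = - e")
    case True
    then show ?thesis by (elim disjE) (simp_all add: kv)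
  next
    case False
    then have "- c \<noteq> b" "- c \<noteq> e" "- c \<noteq> - b" "- c \<noteq> - e" by linarith+
    then have "k p q (- c) = base (- c)" by (rule out)
    moreover have "k p q c = base c" by (rule out) (use False in auto)
    ultimately show ?thesis using base_neg[OF that] by simp
  qed
  have key0: "key n (k 2 1)"
  proof -
    let ?Y = "{b, e, - b, - e}"
    define h where "h v = (if v = 2 then b else if v = 1 then e else if v = - 2 then - b else - e)" for v :: int
    show ?thesis
    proof (rule key_piecewise[where K = K and Y = ?Y and h = h and Z = "\<lambda>v. \<bar>v\<bar> \<le> 2"])
      show "k 2 1 (- c) = - k 2 1 c" if "c \<in> pts n" for c by (rule kodd[OF that])
      show "\<bar>K\<bar> > 2 * int n" unfolding K_def by simp
      show "\<bar>k 2 1 c\<bar> \<le> 2 \<and> h (k 2 1 c) = c" if "c \<in> ?Y" for c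
        using that unfolding insert_iff empty_iff
        by (elim disjE FalseE; hypsubst; unfold kv h_def) auto
      fix c assume c: "c \<in> pts n" "c \<notin> ?Y"
      then have "k 2 1 c = base c" using out by simp
      then show "\<not> \<bar>k 2 1 c\<bar> \<le> 2 \<and> (k 2 1 c = c \<or> k 2 1 c = c + K \<or> k 2 1 c = c - K)"
        using base_far[OF c(1)] c(2) by (auto simp: base_def)
    qed
  qed
  have eqI: "f = g"
    if "f e = g e" "f b = g b" "f (- e) = g (- e)" "f (- b) = g (- b)"
      "\<And>c. c \<noteq> e \<Longrightarrow> c \<noteq> b \<Longrightarrow> c \<noteq> - e \<Longrightarrow> c \<noteq> - b \<Longrightarrow> f c = g c" for f g :: "int \<Rightarrow> int"
  proof (rule ext)
    fix c show "f c = g c"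
      using that by (cases "c = e \<or> c = b \<or> c = - e \<or> c = - b") auto
  qed
  have eqs: "k 2 (- 1) = k 2 1 \<circ> swap_values (- e) e"
    "k 1 (- 2) = k 2 (- 1) \<circ> swap_values (- b) e"
    "k (- 1) (- 2) = k 1 (- 2) \<circ> swap_values (- b) b"
    "k 1 2 = k 2 1 \<circ> swap_values e b"
    "k (- 1) 2 = k 1 2 \<circ> swap_values (- b) b"
    "k (- 2) 1 = k (- 1) 2 \<circ> swap_values (- e) b"
    by (rule eqI; simp add: swap_values_def kv d out)+
  have key_p1: "key n (k 2 (- 1))" unfolding eqs(1) by (rule key_swap[OF key0 npts(1) pts(1)]) (use d in auto)
  have key_p2: "key n (k 1 (- 2))" unfolding eqs(2) by (rule key_swap[OF key_p1 npts(2) pts(1)]) (use d in auto)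
  have key_q1: "key n (k 1 2)" unfolding eqs(4) by (rule key_swap[OF key0 pts(1,2)]) (use d in auto)
  have key_q2: "key n (k (- 1) 2)" unfolding eqs(5) by (rule key_swap[OF key_q1 npts(2) pts(2)]) (use d in auto)
  have side: "(2 < k p q c \<longleftrightarrow> c \<notin> \<Lambda>) \<and> (k p q c < - 2 \<longleftrightarrow> c \<in> \<Lambda>)"
    if c: "c \<in> pts n" "- b < c" "c < b" "c \<noteq> e" "c \<noteq> - e" for c p q
  proof -
    have "k p q c = base c" by (rule out) (use c in auto)
    moreover have "\<bar>c\<bar> \<le> int n" using c by (auto simp: signed_points_iff)
    ultimately show ?thesis using c unfolding base_def K_def by auto
  qed
  have nz: "k p q c \<noteq> 0" if "key n (k p q)" "c \<in> pts n" for p q c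
    using keyD(3)[OF that] .
  let ?P = "\<lambda>p q. perm_of_key n (k p q)"
  have e1: "edge_on n \<Lambda> (?P 2 1) (?P 2 (- 1)) e (- e)"
  proof (rule edge_on_swap[OF key0 npts(1) pts(1) _ _ _ eqs(1)])
    fix c assume c: "c \<in> pts n" "- e < c" "c < e"
    then show "k 2 (- 1) e < k 2 (- 1) c \<longleftrightarrow> c \<notin> \<Lambda>"
      using side[of c 2 "- 1"] ord unfolding kv by auto
  next
    fix c assume "c \<in> pts n"
    then show "\<not> (k 2 1 (- e) < k 2 1 c \<and> k 2 1 c < k 2 1 e)" using nz[OF key0] unfolding kv by force
  qed (use kv ord in auto)
  have e2: "edge_on n \<Lambda> (?P 2 1) (?P 1 2) b e"
  proof (rule edge_on_swap[OF key0 pts(1,2) ord(2) _ _ eqs(4)])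
    fix c assume c: "c \<in> pts n" "e < c" "c < b"
    then show "k 1 2 b < k 1 2 c \<longleftrightarrow> c \<notin> \<Lambda>"
      using side[of c 1 2] ord unfolding kv by auto
  qed (use kv in auto)
  have p12: "edge n (?P 2 (- 1)) (?P 1 (- 2)) e (- b)"
    unfolding eqs(2) by (rule edge_swap[OF key_p1 npts(2) pts(1)]) (use kv ord in auto)
  \<comment> \<open>A key never takes the value 0, so the values - 1 and 1 are adjacent.\<close>
  have adj: "\<not> (k p q (- b) < k p q c \<and> k p q c < k p q b)"
    if "p = 1" "key n (k p q)" "c \<in> pts n" for p q c
    using nz[OF that(2,3)] that(1) unfolding kv by auto
  have p23: "edge n (?P 1 (- 2)) (?P (- 1) (- 2)) b (- b)"
    unfolding eqs(3) by (rule edge_swap[OF key_p2 npts(2) pts(2)]) (use kv ord adj[OF refl key_p2] in auto)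
  have q12: "edge n (?P 1 2) (?P (- 1) 2) b (- b)"
    unfolding eqs(5) by (rule edge_swap[OF key_q1 npts(2) pts(2)]) (use kv ord adj[OF refl key_q1] in auto)
  have q23: "edge n (?P (- 1) 2) (?P (- 2) 1) b (- e)"
    unfolding eqs(6) by (rule edge_swap[OF key_q2 npts(1) pts(2)]) (use kv ord in auto)
  note E = edge_onD[OF e1] p12 p23 edge_onD[OF e2] q12 q23
  \<comment> \<open>The central entries read -b -e e b in u. Through v they become -b e -e b, then e
    -b b -e, then e b -b -e; through w they become -e -b b e, then -e b -b e, then b -e e
    -b.\<close>
  let ?u = "?P 2 1" and ?v = "?P 2 (- 1)" and ?p2 = "?P 1 (- 2)" and ?p = "?P (- 1) (- 2)"
    and ?w = "?P 1 2" and ?q2 = "?P (- 1) 2" and ?q = "?P (- 2) 1"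
  have I: "invs n ?v = insert (e, - e) (invs n ?u)"
    "invs n ?p2 = insert (e, - b) (insert (b, - e) (invs n ?v))"
    "invs n ?p = insert (b, - b) (invs n ?p2)"
    "invs n ?w = insert (b, e) (insert (- e, - b) (invs n ?u))"
    "invs n ?q2 = insert (b, - b) (invs n ?w)"
    "invs n ?q = insert (b, - e) (insert (e, - b) (invs n ?q2))"
    using edgeD(7)[OF E(1)] edgeD(7)[OF E(2)] edgeD(7)[OF E(3)] edgeD(7)[OF E(4)]
      edgeD(7)[OF E(5)] edgeD(7)[OF E(6)] by simp_all
  let ?T = "(invs n ?v \<union> invs n ?w)\<^sup>+"
  have U: "invs n ?v \<union> invs n ?w \<subseteq> ?T" by auto
  then have J0: "(b, e) \<in> ?T" "(e, - e) \<in> ?T" "(- e, - b) \<in> ?T" unfolding I by blast+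
  have J1: "(b, - e) \<in> ?T" using J0(1,2) by (rule trancl_trans)
  have J2: "(e, - b) \<in> ?T" using J0(2,3) by (rule trancl_trans)
  have J3: "(b, - b) \<in> ?T" using J0(1) J2 by (rule trancl_trans)
  have poly: "(?v, ?p2) \<in> \<theta> \<and> (?p2, ?p) \<in> \<theta> \<and> (?w, ?q2) \<in> \<theta> \<and> (?q2, ?q) \<in> \<theta>"
    if C: "weak_congruence n \<theta>" and c: "(?u, ?v) \<in> \<theta> \<or> (?u, ?w) \<in> \<theta>" for \<theta>
  proof -
    have a1: "invs n ?p \<subseteq> ?T" "invs n ?q \<subseteq> ?T"
      unfolding I(2,3,5,6) using U J1 J2 J3 by simp_all
    have a2: "invs n ?p \<inter> invs n ?w \<subseteq> invs n ?u"
      "invs n ?q \<inter> invs n ?v \<subseteq> invs n ?u"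
      unfolding I using d ord by auto
    have a3: "invs n ?u \<subseteq> invs n ?v" "invs n ?v \<subseteq> invs n ?p2" "invs n ?p2 \<subseteq> invs n ?p"
      "invs n ?u \<subseteq> invs n ?w" "invs n ?w \<subseteq> invs n ?q2" "invs n ?q2 \<subseteq> invs n ?q"
      unfolding I by blast+
    note car = edgeD(1,2)[OF E(1)] edgeD(1,2)[OF E(3)] edgeD(1,2)[OF E(4)] edgeD(1,2)[OF E(6)]
    have vp: "(?v, ?p) \<in> \<theta>" and wq: "(?w, ?q) \<in> \<theta>"
      using weak_polygon[OF C, of ?u ?v ?w ?p ?q, OF _ _ _ _ _ a3(1) subset_trans[OF a3(2,3)] a3(4)
          subset_trans[OF a3(5,6)] a2 a1 c] car by simp_all
    have "(?v, ?p2) \<in> \<theta>" "(?p2, ?p) \<in> \<theta>"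
      by (rule weak.congruence_interval[OF C vp]; use a3 car in \<open>simp add: weak_le_iff\<close>)+
    moreover have "(?w, ?q2) \<in> \<theta>" "(?q2, ?q) \<in> \<theta>"
      by (rule weak.congruence_interval[OF C wq]; use a3 car in \<open>simp add: weak_le_iff\<close>)+
    ultimately show ?thesis by blast
  qed
  have bb: "- b < b" using ord by simp
  have es: "- e \<in> \<Lambda> \<longleftrightarrow> e \<notin> \<Lambda>" using sym[OF pts(1)] ord by auto
  show ?thesis
  proof (cases "e \<in> \<Lambda>")
    case True
    \<comment> \<open>This edge is found as an exchange of e with - b and then read, by the
      half-turn, as an exchange of b with - e.\<close>
    have "edge_on n {c. - c \<notin> \<Lambda>} ?v ?p2 e (- b)"
    proof (rule edge_on_swap[OF key_p1 npts(2) pts(1) _ _ _ eqs(2)])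
      fix c assume c: "c \<in> pts n" "- b < c" "c < e"
      then have "c \<in> \<Lambda> \<longleftrightarrow> - c \<notin> \<Lambda>" using sym[of c] ord by auto
      then show "k 1 (- 2) e < k 1 (- 2) c \<longleftrightarrow> c \<notin> {c. - c \<notin> \<Lambda>}"
        using side[of c 1 "- 2"] c ord True kv by (cases "c = - e") auto
    qed (use kv ord in auto)
    from edge_on_uminus[OF this] have x: "edge_on n \<Lambda> ?v ?p2 b (- e)" by simp
    have "edge_on n \<Lambda> ?p2 ?p b (- b)"
    proof (rule edge_on_swap[OF key_p2 npts(2) pts(2) bb _ _ eqs(3)])
      fix c assume c: "c \<in> pts n" "- b < c" "c < b"
      consider "c = e" | "c = - e" | "c \<noteq> e" "c \<noteq> - e" by blast
      then show "k (- 1) (- 2) b < k (- 1) (- 2) c \<longleftrightarrow> c \<notin> \<Lambda>"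
        by cases (use side[of c "- 1" "- 2"] c True es kv in auto)
    qed (use kv adj[OF refl key_p2] in auto)
    then show ?thesis using e1 e2 x poly by blast
  next
    case False
    have x: "edge_on n \<Lambda> ?q2 ?q b (- e)"
    proof (rule edge_on_swap[OF key_q2 npts(1) pts(2) _ _ _ eqs(6)])
      fix c assume c: "c \<in> pts n" "- e < c" "c < b"
      then show "k (- 2) 1 b < k (- 2) 1 c \<longleftrightarrow> c \<notin> \<Lambda>"
        using side[of c "- 2" 1] ord False kv by (cases "c = e") auto
    qed (use kv ord in auto)
    have "edge_on n \<Lambda> ?w ?q2 b (- b)"
    proof (rule edge_on_swap[OF key_q1 npts(2) pts(2) bb _ _ eqs(5)])
      fix c assume c: "c \<in> pts n" "- b < c" "c < b"
      consider "c = e" | "c = - e" | "c \<noteq> e" "c \<noteq> - e" by blast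
      then show "k (- 1) 2 b < k (- 1) 2 c \<longleftrightarrow> c \<notin> \<Lambda>"
        by cases (use side[of c "- 1" 2] c False es kv in auto)
    qed (use kv adj[OF refl key_q1] in auto)
    then show ?thesis using e1 e2 x poly by blast
  qed
qed

section \<open>Forcing\<close>

text \<open>Suppose c stands between b and a in y. If c is outside the interval from a to b, it
  stands between them in x too, although x has a before b; inside the interval
  \<open>edge_side\<close> excludes it.\<close>

lemma edge_consecutive:
  assumes e: "edge n x y b a" and c: "c \<in> pts n"
  shows "\<not> (inv y b < inv y c \<and> inv y c < inv y a)"
proof
  assume f: "inv y b < inv y c \<and> inv y c < inv y a"
  note ed = edgeD[OF e]
  have ne: "c \<noteq> a" "c \<noteq> b" using f by auto
  have "\<not> (inv x b < inv x a)" using ed(3-6) by (auto simp: invs_iff)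
  moreover have "inv x b < inv x c \<and> inv x c < inv x a"
    if "c < a \<or> b < c"
  proof -
    have "(c, a) \<in> invs n x \<longleftrightarrow> (c, a) \<in> invs n y" "(b, c) \<in> invs n x \<longleftrightarrow> (b, c) \<in> invs n y"
      unfolding ed(7) using ne ed(5) that by auto
    moreover have "(c, b) \<in> invs n x \<Longrightarrow> (c, b) \<in> invs n y" "(a, c) \<in> invs n x \<Longrightarrow> (a, c) \<in> invs n y"
      unfolding ed(7) by auto
    ultimately show ?thesis
      using f that ed(5) before_iff_invs[OF ed(1) ed(4) c] before_iff_invs[OF ed(1) c ed(3)]
        before_iff_invs[OF ed(2) ed(4) c] before_iff_invs[OF ed(2) c ed(3)]
      by auto
  qed
  moreover have False if "a < c" "c < b"
    using edge_side[OF e c that] f that ed(3,4) c by (auto simp: invs_iff)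
  ultimately show False using ne by force
qed

text \<open>A central arc is its own half-turn, so its two descriptions of the left points
  agree.\<close>

lemma edge_on_central:
  assumes e: "edge_on n \<Lambda> x y b (- b)" and c: "c \<in> pts n" "\<bar>c\<bar> < b"
  shows "c \<in> \<Lambda> \<longleftrightarrow> - c \<notin> \<Lambda>"
proof -
  have "edge_on n {c. - c \<notin> \<Lambda>} x y b (- b)" using edge_on_uminus[OF e] by simp
  then show ?thesis using e c unfolding edge_on_def by auto
qed

text \<open>Two lifts of a long arc are disjoint: one of them lies to the right of the other.\<close>

lemma edge_on_one_sided:
  assumes e: "edge_on n \<Lambda> x y b a" and ne: "b \<noteq> - a"
  obtains s :: int where "s = 1 \<or> s = - 1"
    "\<And>c. c \<in> pts n \<Longrightarrow> a < c \<Longrightarrow> c < b \<Longrightarrow> (c \<in> \<Lambda> \<longleftrightarrow> s = - 1) \<Longrightarrow>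
       - c \<noteq> a \<and> - c \<noteq> b \<and> \<not> (a < - c \<and> - c < b \<and> (- c \<in> \<Lambda> \<longleftrightarrow> s = - 1))"
proof -
  note ed = edgeD[OF edge_onD[OF e]]
  let ?f = "inv y"
  have f: "key n ?f" using key_inv[OF ed(2)] .
  have "(b, a) \<in> invs n y" using ed(7) by simp
  then have ba: "?f b < ?f a" by (simp add: invs_iff)
  have neg: "?f (- c) = - ?f c" if "c \<in> pts n" for c using keyD(1)[OF f that] .
  have R: "?f b < ?f c" if "c \<in> pts n" "a < c" "c < b" "c \<notin> \<Lambda>" for c
    using e that unfolding edge_on_def by (auto simp: invs_iff)
  have L: "?f c < ?f a" if "c \<in> pts n" "a < c" "c < b" "c \<in> \<Lambda>" for c
    using edge_side[OF edge_onD[OF e] that(1-3)] e that unfolding edge_on_def by (auto simp: invs_iff)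
  show thesis
  \<comment> \<open>The sign s names the half of the positions that contains b and a. Points on the
    outer side of the pair lie in the same half, so their negatives lie in the other one.\<close>
  proof (cases "?f b > 0")
    case True
    show thesis
    proof (rule that[of 1])
      fix c assume c: "c \<in> pts n" "a < c" "c < b" "c \<in> \<Lambda> \<longleftrightarrow> (1::int) = - 1"
      have c0: "?f (- c) < 0" using R[OF c(1-3)] c(4) True neg[OF c(1)] by simp
      have "?f b < ?f (- c)" if "a < - c" "- c < b" "- c \<notin> \<Lambda>" using R[of "- c"] that c by simp
      then show "- c \<noteq> a \<and> - c \<noteq> b \<and> \<not> (a < - c \<and> - c < b \<and> (- c \<in> \<Lambda> \<longleftrightarrow> (1::int) = - 1))"
        using c0 True ba by auto
    qed simp
  next
    case False
    have b0: "?f b < 0" using False keyD(3)[OF f ed(4)] by linarith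
    \<comment> \<open>On opposite sides of the centre the neighbours b and a would have opposite
      positions, giving b = - a.\<close>
    have a0: "?f a < 0"
    proof (rule ccontr)
      assume "\<not> ?thesis"
      then have "?f a > 0" using keyD(3)[OF f ed(3)] by linarith
      then have "?f (- b) = ?f a"
        using edge_consecutive[OF edge_onD[OF e], of "- a"] edge_consecutive[OF edge_onD[OF e], of "- b"]
          neg[OF ed(3)] neg[OF ed(4)] ed(3,4) b0 by auto
      then show False using keyD(2)[OF f, of "- b" a] ed(3,4) ne by auto
    qed
    show thesis
    proof (rule that[of "- 1"])
      fix c assume c: "c \<in> pts n" "a < c" "c < b" "c \<in> \<Lambda> \<longleftrightarrow> (- 1::int) = - 1"
      have c0: "?f (- c) > 0" using L[OF c(1-3)] c(4) a0 neg[OF c(1)] by simp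
      have "?f (- c) < ?f a" if "a < - c" "- c < b" "- c \<in> \<Lambda>" using L[of "- c"] that c by simp
      then show "- c \<noteq> a \<and> - c \<noteq> b \<and> \<not> (a < - c \<and> - c < b \<and> (- c \<in> \<Lambda> \<longleftrightarrow> (- 1::int) = - 1))"
        using c0 a0 b0 by auto
    qed simp
  qed
qed

text \<open>Induction on the length of the arc: cut it at a point e other than d. One piece still
  has d between its ends and is contracted by induction, and this forces the whole arc. No cut is
  available only for the shortest arcs with a point inside, which are supplied by the three
  hypotheses on generators.\<close>

lemma misplaced_point_contracted:
  assumes C: "weak_congruence n \<theta>"
    and sym: "\<And>c. c \<in> pts n \<Longrightarrow> \<bar>c\<bar> < int n \<Longrightarrow> c \<in> M \<longleftrightarrow> - c \<notin> M"
    and gen: "\<And>d. 2 \<le> d \<Longrightarrow> d < int n \<Longrightarrow> \<exists>\<Lambda> x y. edge_on n \<Lambda> x y (d + 1) (d - 1) \<and> (d \<in> \<Lambda> \<longleftrightarrow> d \<notin> M) \<and> (x, y) \<in> \<theta>"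
    and gen_long: "2 \<le> n \<Longrightarrow> \<exists>\<Lambda> x y. edge_on n \<Lambda> x y 2 (- 1) \<and> (1 \<in> \<Lambda> \<longleftrightarrow> 1 \<notin> M) \<and> (x, y) \<in> \<theta>"
    and gen_orbifold: "2 \<le> n \<Longrightarrow> \<exists>\<Lambda> x y. edge_on n \<Lambda> x y 2 (- 2) \<and> (1 \<in> \<Lambda> \<longleftrightarrow> 1 \<notin> M) \<and> (x, y) \<in> \<theta>"
    and e: "edge_on n \<Lambda> x y b a" and d: "d \<in> pts n" "a < d" "d < b" "d \<in> \<Lambda> \<longleftrightarrow> d \<notin> M"
  shows "(x, y) \<in> \<theta>"
  using e d
proof (induction "nat (b - a)" arbitrary: \<Lambda> x y b a d rule: less_induct)
  case less
  have IH: "(x', y') \<in> \<theta>"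
    if "edge_on n \<Lambda>' x' y' b' a'" "b' - a' < b - a" "d' \<in> pts n" "a' < d'" "d' < b'" "d' \<in> \<Lambda>' \<longleftrightarrow> d' \<notin> M"
    for \<Lambda>' x' y' b' a' d'
    using less.hyps[OF _ that(1,3-6)] that(2,4,5) by simp
  \<comment> \<open>The half-turn replaces d by - d and keeps the length, so only arcs with b' >= -
    a' need treatment.\<close>
  have main: "(x, y) \<in> \<theta>"
    if e: "edge_on n \<Lambda> x y b' a'" and len: "b' - a' = b - a" and ba: "b' \<ge> - a'"
      and d: "d \<in> pts n" "a' < d" "d < b'" "d \<in> \<Lambda> \<longleftrightarrow> d \<notin> M" for \<Lambda> b' a' d
  proof -
    note [simp] = len[symmetric]
    note ed = edgeD[OF edge_onD[OF e]]
    have rng: "\<bar>c\<bar> < int n" if "a' < c" "c < b'" for c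
      using that ed(3,4) by (auto simp: signed_points_iff abs_less_iff)
    have pts: "c \<in> pts n" if "a' \<le> c" "c \<le> b'" "c \<noteq> 0" for c
      using that ed(3,4) by (auto simp: signed_points_iff)
    have d0: "d \<noteq> 0" using d(1) by (simp add: signed_points_iff)
    have hex: "(x, y) \<in> \<theta>"
      if e': "e \<in> pts n" "a' < e" "e < b'" "e \<noteq> d" "b' \<noteq> - a'" "e \<noteq> - a'" "e \<noteq> - b'"
        and s: "s = 1 \<or> s = - 1"
        and sep: "\<And>c. c \<in> pts n \<Longrightarrow> a' < c \<Longrightarrow> c < b' \<Longrightarrow> c \<noteq> e \<Longrightarrow> (c \<in> \<Lambda> \<longleftrightarrow> s = - 1) \<Longrightarrow>
           - c \<noteq> a' \<and> - c \<noteq> b' \<and> - c \<noteq> e \<and> \<not> (a' < - c \<and> - c < b' \<and> (- c \<in> \<Lambda> \<longleftrightarrow> s = - 1))"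
      for e s :: int
    proof -
      let ?X = "{c \<in> pts n. a' < c \<and> c < b' \<and> c \<noteq> e \<and> (c \<in> \<Lambda> \<longleftrightarrow> s = - 1)}"
      have "- c \<notin> ?X \<and> - c \<noteq> a' \<and> - c \<noteq> b' \<and> - c \<noteq> e" if "c \<in> ?X" for c
        using sep[of c] that by auto
      from hexagon[OF ed(3) e'(1) ed(4) e'(2,3,5-7) s refl this]
      obtain u v w x' y' where H: "edge_on n \<Lambda> u v e a'" "edge_on n \<Lambda> u w b' e" "edge_on n \<Lambda> x' y' b' a'"
        "\<And>\<theta>. weak_congruence n \<theta> \<Longrightarrow> (u, v) \<in> \<theta> \<or> (u, w) \<in> \<theta> \<Longrightarrow> (x', y') \<in> \<theta>"
        by blast
      have "(u, v) \<in> \<theta> \<or> (u, w) \<in> \<theta>"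
      proof (cases "d < e")
        case True
        then show ?thesis using IH[OF H(1) _ d(1,2) _ d(4)] e' by simp
      next
        case False
        then show ?thesis using IH[OF H(2) _ d(1) _ d(3,4)] e' by simp
      qed
      then show ?thesis using same_arc[OF C H(3) e] H(4)[OF C] by blast
    qed
    have a0: "a' \<noteq> 0" using ed(3) by (simp add: signed_points_iff)
    consider (central) "b' = - a'" | (ordinary) "b' \<noteq> - a'" "a' > 0" | (long) "b' \<noteq> - a'" "a' < 0"
      using a0 by linarith
    then show ?thesis
    proof cases
      case central
      have b0: "b' > 0" using ed(5) central by simp
      have eb: "edge_on n \<Lambda> x y b' (- b')" using e central by simp
      have sy: "c \<in> \<Lambda> \<longleftrightarrow> - c \<notin> \<Lambda>" if "c \<in> pts n" "\<bar>c\<bar> < b'" for c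
        using edge_on_central[OF eb that] .
      \<comment> \<open>On a central arc d and - d are misplaced together, so the positive one may
        be used.\<close>
      have dabs: "\<bar>d\<bar> \<in> pts n" "\<bar>d\<bar> \<in> \<Lambda> \<longleftrightarrow> \<bar>d\<bar> \<notin> M" "\<bar>d\<bar> < b'"
        using d central sy[of d] sym[of d] rng[of d] by (auto simp: abs_if)
      show ?thesis
      proof (cases "\<exists>e. 0 < e \<and> e < b' \<and> e \<noteq> \<bar>d\<bar>")
        case True
        then obtain e where e': "0 < e" "e < b'" "e \<noteq> \<bar>d\<bar>" by blast
        have ep: "e \<in> pts n" using pts[of e] e' central by simp
        obtain u v w x' y' where H: "edge_on n \<Lambda> u v e (- e)" "edge_on n \<Lambda> u w b' e" "edge_on n \<Lambda> x' y' b' (- b')"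
          "\<And>\<theta>. weak_congruence n \<theta> \<Longrightarrow> (u, v) \<in> \<theta> \<or> (u, w) \<in> \<theta> \<Longrightarrow> (x', y') \<in> \<theta>"
          using octagon[OF ep ed(4) e'(1,2) sy] by blast
        have "(u, v) \<in> \<theta> \<or> (u, w) \<in> \<theta>"
        proof (cases "\<bar>d\<bar> < e")
          case True
          then show ?thesis using IH[OF H(1) _ dabs(1) _ _ dabs(2)] e' central by simp
        next
          case False
          then show ?thesis using IH[OF H(2) _ dabs(1) _ dabs(3,2)] e' central by simp
        qed
        then show ?thesis using same_arc[OF C H(3) eb] H(4)[OF C] by blast
      next
        case False
        have F: "e = \<bar>d\<bar>" if "0 < e" "e < b'" for e using False that by blast
        have "\<bar>d\<bar> = 1" using F[of 1] dabs(3) d0 by linarith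
        moreover have "b' = 2" using F[of 2] dabs(3) calculation by linarith
        ultimately have b2: "b' = 2" "1 \<in> \<Lambda> \<longleftrightarrow> 1 \<notin> M" using dabs(2) by auto
        have n2: "2 \<le> n" using ed(4) b2 by (auto simp: signed_points_iff)
        obtain \<Lambda>' x' y' where g: "edge_on n \<Lambda>' x' y' 2 (- 2)" "1 \<in> \<Lambda>' \<longleftrightarrow> 1 \<notin> M" "(x', y') \<in> \<theta>"
          using gen_orbifold[OF n2] by blast
        have "edge_on n \<Lambda> x' y' 2 (- 2)"
        proof (rule edge_on_cong[OF g(1)])
          fix c :: int assume c: "c \<in> pts n" "- 2 < c" "c < 2"
          then have "c = 1 \<or> c = - 1" by (auto simp: signed_points_iff)
          then show "c \<in> \<Lambda>' \<longleftrightarrow> c \<in> \<Lambda>"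
            using g(2) b2 sy[of 1] edge_on_central[OF g(1), of 1] c by auto
        qed
        then show ?thesis using same_arc[OF C _ _ g(3)] eb b2 by auto
      qed
    next
      case ordinary
      show ?thesis
      proof (cases "\<exists>e. a' < e \<and> e < b' \<and> e \<noteq> d")
        case True
        then obtain e where e': "a' < e" "e < b'" "e \<noteq> d" by blast
        \<comment> \<open>All points between a' and b' are positive, so their negatives cannot
          interfere and the sign can be chosen freely.\<close>
        show ?thesis
          by (rule hex[of e 1]) (use e' ordinary pts[of e] in auto)
      next
        case False
        have "\<not> d + 1 < b'"
        proof
          assume "d + 1 < b'"
          then have "a' < d + 1 \<and> d + 1 < b' \<and> d + 1 \<noteq> d" using d(2) by simp
          then show False using False by blast
        qed
        moreover have "\<not> a' < d - 1"
        proof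
          assume "a' < d - 1"
          then have "a' < d - 1 \<and> d - 1 < b' \<and> d - 1 \<noteq> d" using d(3) by simp
          then show False using False by blast
        qed
        ultimately have ba': "b' = d + 1" "a' = d - 1" using d(2,3) by auto
        have "2 \<le> d" "d < int n" using ba' ordinary rng[OF d(2,3)] by auto
        then obtain \<Lambda>' x' y' where g: "edge_on n \<Lambda>' x' y' (d + 1) (d - 1)" "d \<in> \<Lambda>' \<longleftrightarrow> d \<notin> M" "(x', y') \<in> \<theta>"
          using gen by blast
        have "edge_on n \<Lambda> x' y' (d + 1) (d - 1)"
        proof (rule edge_on_cong[OF g(1)])
          fix c :: int assume "d - 1 < c" "c < d + 1"
          then have "c = d" by simp
          then show "c \<in> \<Lambda>' \<longleftrightarrow> c \<in> \<Lambda>" using g(2) d(4) by simp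
        qed
        then show ?thesis using same_arc[OF C _ _ g(3)] e ba' by auto
      qed
    next
      case long
      define q where "q = - a'"
      have q: "q > 0" "q < b'" "a' = - q" using long ba by (auto simp: q_def)
      obtain s :: int where s: "s = 1 \<or> s = - 1"
        and os: "\<And>c. c \<in> pts n \<Longrightarrow> a' < c \<Longrightarrow> c < b' \<Longrightarrow> (c \<in> \<Lambda> \<longleftrightarrow> s = - 1) \<Longrightarrow>
          - c \<noteq> a' \<and> - c \<noteq> b' \<and> \<not> (a' < - c \<and> - c < b' \<and> (- c \<in> \<Lambda> \<longleftrightarrow> s = - 1))"
        using edge_on_one_sided[OF e long(1)] by blast
      show ?thesis
      \<comment> \<open>A hexagon can cut at e unless - e is itself one of the points on the side
        given by s, which have to be moved outwards.\<close>
      proof (cases "\<exists>e. a' < e \<and> e < b' \<and> e \<noteq> 0 \<and> e \<noteq> d \<and> e \<noteq> q \<and> \<not> (a' < - e \<and> - e < b' \<and> (- e \<in> \<Lambda> \<longleftrightarrow> s = - 1))")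
        case True
        then obtain e where e': "a' < e" "e < b'" "e \<noteq> 0" "e \<noteq> d" "e \<noteq> q"
          "\<not> (a' < - e \<and> - e < b' \<and> (- e \<in> \<Lambda> \<longleftrightarrow> s = - 1))" by blast
        show ?thesis
        proof (rule hex[of e s])
          show "e \<noteq> - b'" using e' q by auto
          fix c assume c: "c \<in> pts n" "a' < c" "c < b'" "c \<noteq> e" "c \<in> \<Lambda> \<longleftrightarrow> s = - 1"
          have "- c \<noteq> e" using e'(6) c by auto
          then show "- c \<noteq> a' \<and> - c \<noteq> b' \<and> - c \<noteq> e \<and> \<not> (a' < - c \<and> - c < b' \<and> (- c \<in> \<Lambda> \<longleftrightarrow> s = - 1))"
            using os[OF c(1-3,5)] by blast
        qed (use e' pts[of e] long q s in auto)
      next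
        case False
        have all: "a' < - e \<and> - e < b' \<and> (- e \<in> \<Lambda> \<longleftrightarrow> s = - 1)"
          if "a' < e" "e < b'" "e \<noteq> 0" "e \<noteq> d" "e \<noteq> q" for e
          using False that by blast
        \<comment> \<open>Every point other than d and q now has its negative on side s. Since c and
          - c are not both equal to d, at least one of them is on that side; one-sidedness forbids
          both. So \<Lambda> is symmetric below q and the arc can be cut at q by an octagon.\<close>
        have inner: "c \<in> \<Lambda> \<longleftrightarrow> - c \<notin> \<Lambda>" if c: "c \<in> pts n" "\<bar>c\<bar> < q" for c
        proof -
          have c': "c \<noteq> 0" "- c \<in> pts n" "a' < c" "c < b'" "a' < - c" "- c < b'" "c \<noteq> q" "- c \<noteq> q"
            using c q by (auto simp: signed_points_iff)
          have "(c \<in> \<Lambda> \<longleftrightarrow> s = - 1) \<or> (- c \<in> \<Lambda> \<longleftrightarrow> s = - 1)"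
          proof -
            have "c \<noteq> d \<or> - c \<noteq> d" using c'(1) by linarith
            then show ?thesis
            proof
              assume "c \<noteq> d"
              from all[OF c'(3,4,1) this c'(7)] show ?thesis by blast
            next
              assume "- c \<noteq> d"
              from all[OF c'(5,6) _ this c'(8)] c'(1) show ?thesis by simp
            qed
          qed
          moreover have "\<not> ((c \<in> \<Lambda> \<longleftrightarrow> s = - 1) \<and> (- c \<in> \<Lambda> \<longleftrightarrow> s = - 1))"
            using os[of c] c c' by auto
          ultimately show ?thesis by blast
        qed
        \<comment> \<open>Agrees with \<Lambda> above - q, where the arc runs, and is made symmetric
          up to b' as \<open>octagon\<close> demands.\<close>
        define \<Lambda>' where "\<Lambda>' = {c. if \<bar>c\<bar> < q \<or> c > 0 then c \<in> \<Lambda> else - c \<notin> \<Lambda>}"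
        have qp: "q \<in> pts n" using ed(3) q(3) by simp
        have sy: "c \<in> \<Lambda>' \<longleftrightarrow> - c \<notin> \<Lambda>'" if "c \<in> pts n" "\<bar>c\<bar> < b'" for c
          using inner[of c] that unfolding \<Lambda>'_def by (auto simp: signed_points_iff)
        have agree: "c \<in> \<Lambda>' \<longleftrightarrow> c \<in> \<Lambda>" if "- q < c" for c
          using that q(1) unfolding \<Lambda>'_def by auto
        obtain u v w z t where H: "edge_on n \<Lambda>' u v q (- q)" "edge_on n \<Lambda>' u w b' q" "edge_on n \<Lambda>' z t b' (- q)"
          "\<And>\<theta>. weak_congruence n \<theta> \<Longrightarrow> (u, v) \<in> \<theta> \<or> (u, w) \<in> \<theta> \<Longrightarrow> (z, t) \<in> \<theta>"
          using octagon[OF qp ed(4) q(1,2) sy] by blast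
        have zt: "edge_on n \<Lambda> z t b' a'"
          unfolding q(3) by (rule edge_on_cong[OF H(3)]) (use agree in auto)
        have d': "d \<in> \<Lambda>' \<longleftrightarrow> d \<notin> M" using agree[of d] d q by simp
        consider "\<bar>d\<bar> < q" | "q < d" | "d = q" using d(2) q by linarith
        then show ?thesis
        proof cases
          case 1
          then have "(u, v) \<in> \<theta>" using IH[OF H(1) _ d(1) _ _ d'] q by (simp add: abs_less_iff)
          then show ?thesis using same_arc[OF C zt e] H(4)[OF C] by blast
        next
          case 2
          then have "(u, w) \<in> \<theta>" using IH[OF H(2) _ d(1) _ d(3) d'] q by simp
          then show ?thesis using same_arc[OF C zt e] H(4)[OF C] by blast
        next
          \<comment> \<open>Now d = q is an end of both pieces and inside neither. But every other
            point is blocked by its negative, which leaves only q = 1 and b' = 2: a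
            generator.\<close>
          case 3
          have "q = 1"
          proof (rule ccontr)
            assume "q \<noteq> 1"
            then have q2: "q > 1" using q(1) by simp
            have p1: "1 \<in> pts n" using pts[of 1] q by simp
            have "- 1 \<in> \<Lambda> \<longleftrightarrow> s = - 1" "1 \<in> \<Lambda> \<longleftrightarrow> s = - 1"
              using all[of 1] all[of "- 1"] q q2 3 by auto
            then show False using os[of 1] p1 q q2 by auto
          qed
          moreover have "b' = 2"
          proof (rule ccontr)
            assume "b' \<noteq> 2"
            then show False using all[of 2] q \<open>q = 1\<close> 3 by auto
          qed
          ultimately have b2: "b' = 2" "a' = - 1" "d = 1" using q 3 by auto
          have n2: "2 \<le> n" using ed(4) b2 by (auto simp: signed_points_iff)
          obtain \<Lambda>' x' y' where g: "edge_on n \<Lambda>' x' y' 2 (- 1)" "1 \<in> \<Lambda>' \<longleftrightarrow> 1 \<notin> M" "(x', y') \<in> \<theta>"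
            using gen_long[OF n2] by blast
          have "edge_on n \<Lambda> x' y' 2 (- 1)"
          proof (rule edge_on_cong[OF g(1)])
            fix c :: int assume c: "c \<in> pts n" "- 1 < c" "c < 2"
            then have "c = 1" by (auto simp: signed_points_iff)
            then show "c \<in> \<Lambda>' \<longleftrightarrow> c \<in> \<Lambda>" using g(2) d(4) b2 by simp
          qed
          then show ?thesis using same_arc[OF C _ _ g(3)] e b2 by auto
        qed
      qed
    qed
  qed
  show ?case
  proof (cases "b \<ge> - a")
    case True
    then show ?thesis using main[OF less.prems(1) refl] less.prems by blast
  next
    case False
    have "\<bar>d\<bar> < int n" "d \<in> pts n"
      using less.prems edgeD(3,4)[OF edge_onD[OF less.prems(1)]] by (auto simp: signed_points_iff abs_less_iff)
    then have "- d \<in> {c. - c \<notin> \<Lambda>} \<longleftrightarrow> - d \<notin> M" using less.prems(5) sym[of d] by auto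
    then show ?thesis
      using main[OF edge_on_uminus[OF less.prems(1)], of "- d"] False less.prems by simp
  qed
qed

section \<open>Join-irreducible elements and arcs\<close>

lemma weak_cover_between:
  assumes "x \<in> signed_perms n" "y \<in> signed_perms n" "invs n x \<subset> invs n y"
  shows "\<exists>z. weak_covers n y z \<and> invs n x \<subseteq> invs n z"
proof -
  have "(\<lambda>\<pi> \<sigma>. weak_covers n \<sigma> \<pi>)\<^sup>*\<^sup>* x y" using invs_imp_weak_le assms by blast
  then show ?thesis
  proof (cases rule: rtranclp.cases)
    case (rtrancl_into_rtrancl z)
    then show ?thesis using weak_le_imp_invs by blast
  qed (use assms in simp)
qed

text \<open>A congruent pair is replaced by its meet and join; a saturated chain between these
  consists of contracted edges.\<close>

lemma congruence_subset_if_edges: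
  assumes n: "n > 0" and C: "weak_congruence n \<theta>" and D: "weak_congruence n \<phi>"
    and edges: "\<And>x y b a. edge n x y b a \<Longrightarrow> (x, y) \<in> \<theta> \<Longrightarrow> (x, y) \<in> \<phi>"
  shows "\<theta> \<subseteq> \<phi>"
proof (rule subrelI)
  fix x y assume xy: "(x, y) \<in> \<theta>"
  have car: "x \<in> signed_perms n" "y \<in> signed_perms n" using weak.congruence_carrier[OF C xy] by simp_all
  let ?m = "x \<sqinter>\<^bsub>weak_order n\<^esub> y" and ?s = "x \<squnion>\<^bsub>weak_order n\<^esub> y"
  have ms: "(?m, ?s) \<in> \<theta>" using weak.congruence_inf_sup[OF C xy] .
  have car': "?m \<in> signed_perms n" "?s \<in> signed_perms n" using weak.congruence_carrier[OF C ms] by simp_all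
  have le: "invs n ?m \<subseteq> invs n x" "invs n ?m \<subseteq> invs n y"
    using invs_meet_subset[OF car] by blast+
  have "invs n x \<union> invs n y \<subseteq> invs n ?s"
    unfolding invs_join[OF car] by (intro subrelI r_into_trancl)
  then have le': "invs n x \<subseteq> invs n ?s" "invs n y \<subseteq> invs n ?s" by blast+
  have "(\<lambda>\<pi> \<sigma>. weak_covers n \<sigma> \<pi>)\<^sup>*\<^sup>* ?m z \<Longrightarrow> invs n z \<subseteq> invs n ?s \<Longrightarrow> (?m, z) \<in> \<phi>" for z
  proof (induction rule: rtranclp_induct)
    case base then show ?case using weak.congruence_refl[OF D] car' by simp
  next
    case (step w z)
    obtain b a where e: "edge n w z b a" using weak_covers_imp_edge[OF step.hyps(2) n] by blast
    have wz: "invs n w \<subseteq> invs n z" using weak_covers_invs[OF step.hyps(2)] by blast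
    have mw: "invs n ?m \<subseteq> invs n w" using weak_le_imp_invs[OF step.hyps(1)] .
    have "(w, z) \<in> \<theta>"
      using weak.congruence_interval[OF C ms, of w z] mw wz step.prems edgeD(1,2)[OF e] car'
      by (simp add: weak_le_iff)
    then have "(w, z) \<in> \<phi>" using edges[OF e] by simp
    moreover have "(?m, w) \<in> \<phi>" using step.IH wz step.prems by blast
    ultimately show ?case using weak.congruence_trans[OF D] by blast
  qed
  then have ms': "(?m, ?s) \<in> \<phi>"
    using invs_imp_weak_le[OF car'] le le' by blast
  have "(?m, x) \<in> \<phi>" "(?m, y) \<in> \<phi>"
    using weak.congruence_interval[OF D ms', of ?m x] weak.congruence_interval[OF D ms', of ?m y]
      car car' le le' by (simp_all add: weak_le_iff)
  then show "(x, y) \<in> \<phi>" using weak.congruence_sym[OF D] weak.congruence_trans[OF D] by blast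
qed

lemma invs_id [simp]: "invs n id = {}"
  by (auto simp: invs_def)

lemma id_signed_perm: "id \<in> signed_perms n"
  by (simp add: signed_perms_def permutes_id)

text \<open>j is the least permutation whose inversions contain the shard. Minimal cardinality is
  enough to find it, since shards survive meets. The given edge bounds j from above, which keeps the
  points of \<Lambda> on their side.\<close>

lemma ex_join_irreducible_edge:
  assumes n: "n > 0" and e0: "edge_on n \<Lambda> x0 y0 p q"
  shows "\<exists>x j. edge_on n \<Lambda> x j p q \<and> (\<forall>z b a. edge n z j b a \<longrightarrow> z = x \<and> (b, a) \<in> {(p, q), (- q, - p)})"
proof -
  let ?S = "shard n \<Lambda> p q"
  let ?P = "\<lambda>y. y \<in> signed_perms n \<and> ?S \<subseteq> invs n y"
  note ed0 = edgeD[OF edge_onD[OF e0]]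
  have y0: "?P y0" using shard_subset_invs[OF e0] ed0 by simp
  define j where "j = arg_min (\<lambda>y. card (invs n y)) ?P"
  have j: "j \<in> signed_perms n" "?S \<subseteq> invs n j"
    and min: "\<And>y. ?P y \<Longrightarrow> card (invs n j) \<le> card (invs n y)"
    using arg_min_natI[of ?P y0 "\<lambda>y. card (invs n y)"] arg_min_nat_le[of ?P _ "\<lambda>y. card (invs n y)"] y0
    unfolding j_def by auto
  have least: "invs n j \<subseteq> invs n y" if y: "?P y" for y
  proof -
    let ?m = "j \<sqinter>\<^bsub>weak_order n\<^esub> y"
    have "?S \<subseteq> invs n ?m"
      by (rule meet_cotransitive) (erule (3) shard_cotransitive | use j y in simp)+
    moreover have "?m \<in> signed_perms n" using weak.meet_closed[of j n y] j y by simp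
    ultimately have "card (invs n j) \<le> card (invs n ?m)" using min by blast
    moreover have sub: "invs n ?m \<subseteq> invs n j" "invs n ?m \<subseteq> invs n y"
      using invs_meet_subset[of j n y] j y by auto
    ultimately have "invs n ?m = invs n j" by (intro card_seteq) auto
    then show ?thesis using sub by simp
  qed
  have pq: "(p, q) \<in> invs n j" using j(2) ed0 by (auto simp: shard_iff)
  have side: "(p, c) \<in> invs n j \<longleftrightarrow> c \<notin> \<Lambda>" if c: "c \<in> pts n" "q < c" "c < p" for c
  proof (cases "c \<in> \<Lambda>")
    case True
    then have "(p, c) \<notin> invs n y0" using e0 c unfolding edge_on_def by auto
    then show ?thesis using True least[OF y0] by blast
  next
    case False
    then have "(p, c) \<in> ?S" using c ed0 by (auto simp: shard_iff)
    then show ?thesis using False j(2) by blast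
  qed
  \<comment> \<open>By leastness a lower cover of j loses a pair (c, d) of the shard, and c, d are
    neighbours in j. But p would stand between them if c were not p, and q if d were not q.\<close>
  have main: "edge n z j p q \<and> (b, a) \<in> {(p, q), (- q, - p)}" if e: "edge n z j b a" for z b a
  proof -
    note ed = edgeD[OF e]
    have "\<not> ?S \<subseteq> invs n z" using least[of z] ed(1,6,7) by blast
    then obtain c d where cd: "(c, d) \<in> ?S" "(c, d) \<in> {(b, a), (- a, - b)}"
      using j(2) ed(7) by auto
    then have e': "edge n z j c d" using e edge_uminus[OF e] by auto
    have s: "c \<in> pts n" "d \<in> pts n" "d < c" "q \<le> d" "c \<le> p" "c = p \<or> c \<in> \<Lambda>" "d = q \<or> d \<notin> \<Lambda>"
      using cd(1) by (auto simp: shard_iff)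
    have p_d: "inv j p < inv j d" if "d = q \<or> d < p"
      using that s pq side[of d] by (cases "d = q") (auto simp: invs_iff)
    have c_q: "inv j c < inv j q"
    proof (cases "c = p")
      case False
      have "(c, q) \<in> ?S" using s False ed0 by (auto simp: shard_iff)
      then show ?thesis using j(2) by (auto simp: invs_iff)
    qed (use pq in \<open>auto simp: invs_iff\<close>)
    have "c = p"
    proof (rule ccontr)
      assume ne: "c \<noteq> p"
      then have "(p, c) \<notin> invs n j" using side[of c] s by auto
      then have "inv j c < inv j p"
        using before_iff_invs[OF j(1) s(1) ed0(4)] ne s by auto
      then show False using edge_consecutive[OF e' ed0(4)] p_d s by auto
    qed
    moreover have "d = q"
    proof (rule ccontr)
      assume ne: "d \<noteq> q"
      then have "d \<notin> \<Lambda>" "q < d" "d < p" using s by auto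
      then have "inv j q < inv j d"
      proof -
        have "(d, q) \<notin> invs n j"
        proof
          assume "(d, q) \<in> invs n j"
          then have "(d, q) \<in> invs n y0" using least[OF y0] by blast
          then have "(p, d) \<notin> invs n y0"
            using edge_side[OF edge_onD[OF e0] s(2)] \<open>q < d\<close> \<open>d < p\<close> by simp
          then show False using e0 \<open>d \<notin> \<Lambda>\<close> s(2) \<open>q < d\<close> \<open>d < p\<close> unfolding edge_on_def by auto
        qed
        then show ?thesis using before_iff_invs[OF j(1) ed0(3) s(2)] \<open>q < d\<close> by auto
      qed
      then show False using edge_consecutive[OF e' ed0(3)] c_q by auto
    qed
    ultimately show ?thesis using e' cd(2) by auto
  qed
  have "invs n id \<subset> invs n j" using pq by auto
  then obtain x where "weak_covers n j x" using weak_cover_between[OF id_signed_perm j(1)] by blast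
  then obtain b a where "edge n x j b a" using weak_covers_imp_edge n by blast
  then have x: "edge n x j p q" using main by blast
  have uniq: "z = x" if "edge n z j b a" for z b a
  proof -
    have z: "edge n z j p q" using main[OF that] by blast
    have "invs n w = invs n j - {(p, q), (- q, - p)}" if "edge n w j p q" for w
    proof -
      have "(- q, - p) \<notin> invs n w"
        using edgeD(6)[OF that] invs_uminus[OF edgeD(1)[OF that], of q p] by simp
      then show ?thesis using edgeD(6,7)[OF that] by auto
    qed
    then show ?thesis using invs_inject[OF edgeD(1)[OF z] edgeD(1)[OF x]] x z by simp
  qed
  have "edge_on n \<Lambda> x j p q" using x side unfolding edge_on_def by blast
  then show ?thesis using main uniq by blast
qed

section \<open>Arc diagrams and join-irreducible elements\<close>

definition arc_of :: "nat \<Rightarrow> (int \<Rightarrow> int) \<Rightarrow> int \<Rightarrow> int \<Rightarrow> arc" where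
  "arc_of n w b a = Arc b a {c \<in> pts n. inv w c < inv w b \<and> a < c \<and> c < b}
     {c \<in> pts n. inv w a < inv w c \<and> a < c \<and> c < b}"

text \<open>Exchanging a and b twice restores w, so w is the upper end of the edge that starts at
  the swapped key.\<close>

lemma ex_edge_if_consecutive:
  assumes w: "w \<in> signed_perms n" and ab: "a \<in> pts n" "b \<in> pts n" "a < b" "inv w b < inv w a"
    and adj: "\<And>c. c \<in> pts n \<Longrightarrow> \<not> (inv w b < inv w c \<and> inv w c < inv w a)"
  shows "\<exists>x. edge n x w b a"
proof -
  let ?f = "inv w" and ?s = "swap_values a b"
  let ?g = "?f \<circ> ?s"
  have ne: "a \<noteq> b" using ab by simp
  have g: "key n ?g" using key_swap[OF key_inv[OF w] ab(1,2) ne] .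
  have v: "?s a = b" "?s b = a" by (simp_all add: swap_values_def)
  have e: "edge n (perm_of_key n ?g) (perm_of_key n (?g \<circ> ?s)) b a"
  proof (rule edge_swap[OF g ab(1-3)])
    show "?g a < ?g b" using v ab(4) by simp
    fix c assume "c \<in> pts n"
    then show "\<not> (?g a < ?g c \<and> ?g c < ?g b)"
      using adj[OF swap_values_in[OF ab(1,2)]] v by simp
  qed
  have "?s (?s c) = c" if "c \<in> pts n" for c
    using that ab by (auto simp: swap_values_def signed_points_iff)
  then have "key_invs n (?g \<circ> ?s) = invs n w"
    by (auto simp: key_invs_def invs_def)
  then have "invs n (perm_of_key n (?g \<circ> ?s)) = invs n w"
    using perm_of_key(2)[OF key_swap[OF g ab(1,2) ne]] by simp
  then have "perm_of_key n (?g \<circ> ?s) = w" using invs_inject[OF edgeD(2)[OF e] w] by simp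
  then show ?thesis using e by auto
qed

lemma edge_imp_before:
  assumes "edge n x w b a" shows "inv w b < inv w a"
proof -
  have "(b, a) \<in> invs n w" using edgeD(7)[OF assms] by simp
  then show ?thesis by (simp add: invs_iff)
qed

text \<open>A descent at consecutive positions is the same as a lower cover. This replaces positions
  by labels of edges, to which the shard machinery applies.\<close>

lemma arc_diagram_eq:
  assumes w: "w \<in> signed_perms n"
  shows "arc_diagram n w = {arc_of n w b a | b a. \<exists>x. edge n x w b a}"
proof (intro equalityI subsetI)
  have Seq: "{w c | c. c \<in> pts n \<and> P c \<and> Q (w c)} = {c \<in> pts n. P (inv w c) \<and> Q c}" for P Q
  proof (intro equalityI subsetI)
    fix c assume "c \<in> {c \<in> pts n. P (inv w c) \<and> Q c}"
    then show "c \<in> {w c | c. c \<in> pts n \<and> P c \<and> Q (w c)}"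
      using signed_perms_inverses(1)[OF w, of c] signed_perms_inv[OF w]
      by (auto intro!: exI[of _ "inv w c"])
  qed (use w signed_perms_inverses(2)[OF w] in auto)
  have arc: "Arc (w k) (w k')
        {w c | c. c \<in> pts n \<and> c < k \<and> w k' < w c \<and> w c < w k}
        {w c | c. c \<in> pts n \<and> k' < c \<and> w k' < w c \<and> w c < w k} = arc_of n w (w k) (w k')" for k k'
    unfolding arc_of_def signed_perms_inverses(2)[OF w]
      Seq[of "\<lambda>c. c < k" "\<lambda>c. w k' < c \<and> c < w k"] Seq[of "\<lambda>c. k' < c" "\<lambda>c. w k' < c \<and> c < w k"] ..
  {
    fix \<alpha> assume "\<alpha> \<in> arc_diagram n w"
    then obtain k k' where k: "k \<in> pts n" "k' \<in> pts n" "k < k'"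
      "\<forall>c \<in> pts n. \<not> (k < c \<and> c < k')" "w k' < w k" "\<alpha> = arc_of n w (w k) (w k')"
      unfolding arc_diagram_def arc by blast
    have "\<exists>x. edge n x w (w k) (w k')"
    proof (rule ex_edge_if_consecutive[OF w])
      fix c assume "c \<in> pts n"
      then have "inv w c \<in> pts n" using signed_perms_inv[OF w] by simp
      then show "\<not> (inv w (w k) < inv w c \<and> inv w c < inv w (w k'))"
        using k(4) signed_perms_inverses(2)[OF w] by simp
    qed (use k w signed_perms_inverses(2)[OF w] in simp_all)
    then show "\<alpha> \<in> {arc_of n w b a | b a. \<exists>x. edge n x w b a}" using k(6) by blast
  }
  {
    fix \<alpha> assume "\<alpha> \<in> {arc_of n w b a | b a. \<exists>x. edge n x w b a}"
    then obtain b a x where e: "edge n x w b a" "\<alpha> = arc_of n w b a" by blast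
    note ed = edgeD[OF e(1)]
    let ?k = "inv w b" and ?k' = "inv w a"
    have wk: "w ?k = b" "w ?k' = a" using signed_perms_inverses(1)[OF w] by simp_all
    have "?k \<in> pts n" "?k' \<in> pts n" using signed_perms_inv[OF w] ed by simp_all
    moreover have "?k < ?k'" using edge_imp_before[OF e(1)] .
    moreover have "\<forall>c \<in> pts n. \<not> (?k < c \<and> c < ?k')"
    proof
      fix c assume "c \<in> pts n"
      then have "w c \<in> pts n" using w by simp
      then show "\<not> (?k < c \<and> c < ?k')"
        using edge_consecutive[OF e(1), of "w c"] signed_perms_inverses(2)[OF w] by simp
    qed
    moreover have "w ?k' < w ?k" using wk ed(5) by simp
    moreover have "\<alpha> = arc_of n w (w ?k) (w ?k')" using e(2) wk by simp
    ultimately show "\<alpha> \<in> arc_diagram n w"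
      unfolding arc_diagram_def arc by blast
  }
qed

lemma half_turn_arc_of:
  assumes w: "w \<in> signed_perms n"
  shows "half_turn (arc_of n w b a) = arc_of n w (- a) (- b)"
proof -
  have neg: "inv w (- c) = - inv w c" for c using signed_perms_uminus[OF signed_perms_inv[OF w]] .
  have img: "uminus ` {c \<in> pts n. P c} = {c \<in> pts n. P (- c)}" for P
    by (auto intro!: image_eqI[of _ uminus "- c" for c])
  show ?thesis by (auto simp: half_turn_def arc_of_def img neg)
qed

lemma half_turn_half_turn [simp]: "half_turn (half_turn \<alpha>) = \<alpha>"
  by (cases \<alpha>) (simp add: half_turn_def image_image)

lemma orbifold_image_eq_iff: "orbifold_image \<alpha> = orbifold_image \<beta> \<longleftrightarrow> \<alpha> = \<beta> \<or> \<alpha> = half_turn \<beta>"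
  unfolding orbifold_image_def using half_turn_half_turn by (metis doubleton_eq_iff insertI1 insert_commute)

text \<open>This justifies the definite description. For uniqueness let u and v be join-irreducible
  with this arc. Their meet contains the shard; if u were not below v, the meet would lie below the
  only lower cover of u, which lacks (p, q).\<close>

lemma join_irreducible_of_arc_eq:
  assumes n: "n > 0" and e0: "edge_on n M x0 y0 p q"
  defines "\<beta> \<equiv> orbifold_image (Arc p q {c \<in> pts n. c \<in> M \<and> q < c \<and> c < p}
    {c \<in> pts n. c \<notin> M \<and> q < c \<and> c < p})"
  shows "edge_on n M (lower_cover n (join_irreducible_of_arc n \<beta>)) (join_irreducible_of_arc n \<beta>) p q"
proof -
  let ?\<alpha> = "Arc p q {c \<in> pts n. c \<in> M \<and> q < c \<and> c < p} {c \<in> pts n. c \<notin> M \<and> q < c \<and> c < p}"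
  obtain x j where e: "edge_on n M x j p q"
    and uniq: "\<And>z b a. edge n z j b a \<Longrightarrow> z = x \<and> (b, a) \<in> {(p, q), (- q, - p)}"
    using ex_join_irreducible_edge[OF n e0] by blast
  note ed = edge_onD[OF e]
  have arc_of_iff: "arc_of n w p q = ?\<alpha> \<longleftrightarrow> edge_on n M z w p q" if z: "edge n z w p q" for z w
  proof -
    note edz = edgeD[OF z]
    have "inv w c < inv w p \<longleftrightarrow> (p, c) \<notin> invs n w" "inv w q < inv w c \<longleftrightarrow> (p, c) \<in> invs n w"
      if "c \<in> pts n" "q < c" "c < p" for c
      using edge_side[OF z that] before_iff_invs[OF edz(2) that(1) edz(4)]
        before_iff_invs[OF edz(2) edz(3) that(1)] that by auto
    then show ?thesis using z unfolding arc_of_def edge_on_def by auto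
  qed
  have cover: "weak_covers n j z \<longleftrightarrow> z = x" for z
    using edge_imp_weak_covers[OF ed] weak_covers_imp_edge[OF _ n] uniq by blast
  then have JI: "join_irreducible n j" and lower: "lower_cover n j = x"
    using edgeD(2)[OF ed] by (auto simp: join_irreducible_def lower_cover_def)
  have "arc_diagram n j = {arc_of n j p q, arc_of n j (- q) (- p)}"
    unfolding arc_diagram_eq[OF edgeD(2)[OF ed]] using uniq ed edge_uminus[OF ed] by blast
  then have diag: "orbifold_diagram n j = {\<beta>}"
    using arc_of_iff[OF ed] e unfolding orbifold_diagram_def \<beta>_def half_turn_arc_of[OF edgeD(2)[OF ed], symmetric]
    by (auto simp: orbifold_image_def)
  have "j' = j" if j': "join_irreducible n j'" "orbifold_diagram n j' = {\<beta>}" for j'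
  proof -
    have J: "j' \<in> signed_perms n" using j'(1) by (simp add: join_irreducible_def)
    obtain \<alpha> where \<alpha>: "\<alpha> \<in> arc_diagram n j'" "orbifold_image \<alpha> = \<beta>"
      using j'(2) unfolding orbifold_diagram_def by (metis imageE insertI1)
    then obtain b a z where z: "edge n z j' b a" "\<alpha> = arc_of n j' b a"
      unfolding arc_diagram_eq[OF J] by blast
    have "arc_of n j' b a = ?\<alpha> \<or> arc_of n j' (- a) (- b) = ?\<alpha>"
    proof -
      consider "\<alpha> = ?\<alpha>" | "\<alpha> = half_turn ?\<alpha>"
        using \<alpha>(2) unfolding \<beta>_def orbifold_image_eq_iff by blast
      then show ?thesis
      proof cases
        case 2
        then have "half_turn \<alpha> = ?\<alpha>" by (simp only: half_turn_half_turn)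
        then show ?thesis using z(2) half_turn_arc_of[OF J] by simp
      qed (use z(2) in simp)
    qed
    then have "\<exists>b a. edge n z j' b a \<and> arc_of n j' b a = ?\<alpha>" using z(1) edge_uminus[OF z(1)] by blast
    then have z': "edge n z j' p q" "arc_of n j' p q = ?\<alpha>" by (auto simp: arc_of_def)
    then have ez: "edge_on n M z j' p q" using arc_of_iff by blast
    have le: "invs n u \<subseteq> invs n v"
      if u: "join_irreducible n u" "edge_on n M w u p q" and v: "edge_on n M w' v p q" for u w v w'
    proof (rule ccontr)
      assume no: "\<not> ?thesis"
      note edu = edgeD[OF edge_onD[OF u(2)]] and edv = edgeD[OF edge_onD[OF v]]
      let ?m = "u \<sqinter>\<^bsub>weak_order n\<^esub> v"
      have "shard n M p q \<subseteq> invs n ?m"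
        by (rule meet_cotransitive[OF edu(2) edv(2)])
          (erule (3) shard_cotransitive | rule shard_subset_invs[OF u(2)] shard_subset_invs[OF v])+
      then have pq: "(p, q) \<in> invs n ?m" using edu by (auto simp: shard_iff)
      have m: "?m \<in> signed_perms n" using weak.meet_closed[of u n v] edu edv by simp
      have "invs n ?m \<subset> invs n u" using invs_meet_subset[OF edu(2) edv(2)] no by blast
      then obtain t where t: "weak_covers n u t" "invs n ?m \<subseteq> invs n t"
        using weak_cover_between[OF m edu(2)] by blast
      have "t = w" using t(1) edge_imp_weak_covers[OF edge_onD[OF u(2)]] u(1) unfolding join_irreducible_def by blast
      then show False using t(2) pq edu(6) by blast
    qed
    show ?thesis
      using le[OF JI e ez] le[OF j'(1) ez e] invs_inject[OF J edgeD(2)[OF ed]] by blast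
  qed
  note unique = this
  have "join_irreducible_of_arc n \<beta> = j"
    unfolding join_irreducible_of_arc_def
  proof (rule the_equality)
    show "join_irreducible n j \<and> orbifold_diagram n j = {\<beta>}" using JI diag by (rule conjI)
    fix j' assume "join_irreducible n j' \<and> orbifold_diagram n j' = {\<beta>}"
    then show "j' = j" by (elim conjE) (rule unique)
  qed
  then show ?thesis using e lower by simp
qed

text \<open>By \<open>same_arc\<close> every edge with this arc can stand in for the
  join-irreducible element and its lower cover, so statements about contraction can be checked on
  any convenient edge.\<close>

lemma arc_congruence_separates:
  assumes n: "n > 0" and e0: "edge_on n M x0 y0 p q"
  defines "\<beta> \<equiv> orbifold_image (Arc p q {c \<in> pts n. c \<in> M \<and> q < c \<and> c < p}
    {c \<in> pts n. c \<notin> M \<and> q < c \<and> c < p})"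
  shows "weak_congruence n (arc_congruence n \<beta>)"
    and "edge_on n M x y p q \<Longrightarrow> (x, y) \<notin> arc_congruence n \<beta>"
    and "weak_congruence n \<theta> \<Longrightarrow> edge_on n M x y p q \<Longrightarrow> (x, y) \<notin> \<theta> \<Longrightarrow> \<theta> \<subseteq> arc_congruence n \<beta>"
    and "meet_irreducible (congruences (weak_order n)) (arc_congruence n \<beta>)"
proof -
  define j where "j = join_irreducible_of_arc n \<beta>"
  define i where "i = lower_cover n j"
  have e: "edge_on n M i j p q"
    unfolding i_def j_def \<beta>_def by (rule join_irreducible_of_arc_eq[OF n e0])
  note ed = edgeD[OF edge_onD[OF e]]
  define P where "P = (\<lambda>\<theta>. weak_congruence n \<theta> \<and> (j, i) \<notin> \<theta>)"
  have eq: "arc_congruence n \<beta> = Greatest P"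
    unfolding arc_congruence_def contracts_def P_def i_def j_def ..
  have car: "j \<in> carrier (weak_order n)" "i \<in> carrier (weak_order n)" using ed by simp_all
  have le: "i \<sqsubseteq>\<^bsub>weak_order n\<^esub> j" using ed by (auto simp: weak_le_iff)
  have ne: "i \<noteq> j" using ed(6,7) by auto
  have cov: "z = i \<or> z = j" if "z \<in> carrier (weak_order n)" "i \<sqsubseteq>\<^bsub>weak_order n\<^esub> z" "z \<sqsubseteq>\<^bsub>weak_order n\<^esub> j" for z
    using edge_no_between[OF edge_onD[OF e], of z] that ed(1,2) by (simp add: weak_le_iff)
  have G1: "P (arc_congruence n \<beta>)"
    unfolding eq P_def
    by (rule weak.Greatest_congruence_separating(1)[OF car le ne]; rule cov; assumption)
  have G2: "\<theta> \<subseteq> arc_congruence n \<beta>" if "P \<theta>" for \<theta>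
    unfolding eq P_def
  proof (rule weak.Greatest_congruence_separating(2)[OF car le ne])
    show "weak_congruence n \<theta> \<and> (j, i) \<notin> \<theta>" using that by (simp add: P_def)
  qed (rule cov)
  have sep: "(j, i) \<in> \<theta>" if "weak_congruence n \<theta>" "edge_on n M x y p q" "(x, y) \<in> \<theta>" for \<theta> x y
    using same_arc[OF that(1,2) e that(3)] weak.congruence_sym[OF that(1)] by blast
  have sep': "(x, y) \<in> \<theta>" if "weak_congruence n \<theta>" "edge_on n M x y p q" "(j, i) \<in> \<theta>" for \<theta> x y
    using same_arc[OF that(1) e that(2)] weak.congruence_sym[OF that(1,3)] by blast
  show "weak_congruence n (arc_congruence n \<beta>)" using G1 by (simp add: P_def)
  show "edge_on n M x y p q \<Longrightarrow> (x, y) \<notin> arc_congruence n \<beta>"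
    using G1 sep unfolding P_def by blast
  show "weak_congruence n \<theta> \<Longrightarrow> edge_on n M x y p q \<Longrightarrow> (x, y) \<notin> \<theta> \<Longrightarrow> \<theta> \<subseteq> arc_congruence n \<beta>"
    using G2[of \<theta>] sep' unfolding P_def by blast
  show "meet_irreducible (congruences (weak_order n)) (arc_congruence n \<beta>)"
  proof (rule weak.meet_irreducible_Greatest[OF car])
    show "weak_congruence n (arc_congruence n \<beta>)" using G1 unfolding P_def by (rule conjunct1)
    show "(j, i) \<notin> arc_congruence n \<beta>" using G1 unfolding P_def by (rule conjunct2)
    show "\<theta> \<subseteq> arc_congruence n \<beta>" if "weak_congruence n \<theta>" "(j, i) \<notin> \<theta>" for \<theta>
      by (rule G2) (simp add: P_def that)
  qed
qed

section \<open>The Cambrian congruence\<close>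

context
  fixes n :: nat and L R :: "int set"
  assumes n: "n \<ge> 2" and LR: "L \<union> R = {1..int n - 1}" "L \<inter> R = {}"
begin

definition left_side :: "int set" where
  "left_side = L \<union> uminus ` R"

text \<open>By \<open>same_arc\<close> one contracted edge stands for all edges with the same arc,
  so this is a property of the arc without misplaced points from b to a.\<close>

definition reaches :: "(int \<Rightarrow> int) rel \<Rightarrow> int \<Rightarrow> int \<Rightarrow> bool" where
  "reaches \<theta> b a \<longleftrightarrow> (\<exists>x y. edge_on n left_side x y b a \<and> (x, y) \<in> \<theta>)"

lemma n_pos: "n > 0" using n by simp

lemma left_side_iff:
  shows "c > 0 \<Longrightarrow> c \<in> left_side \<longleftrightarrow> c \<in> L" "c < 0 \<Longrightarrow> c \<in> left_side \<longleftrightarrow> - c \<in> R"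
proof -
  have pos: "c > 0" if "c \<in> L \<union> R" for c using that unfolding LR(1) by simp
  show "c \<in> left_side \<longleftrightarrow> c \<in> L" if "c > 0"
    using pos that unfolding left_side_def by (force simp: image_iff)
  show "c \<in> left_side \<longleftrightarrow> - c \<in> R" if "c < 0"
    using pos[of c] that unfolding left_side_def by (force simp: image_iff)
qed

lemma L_or_R: "0 < c \<Longrightarrow> c < int n \<Longrightarrow> c \<in> R \<longleftrightarrow> c \<notin> L"
proof -
  assume "0 < c" "c < int n"
  then have "c \<in> L \<union> R" unfolding LR(1) by simp
  then show ?thesis using LR(2) by blast
qed

lemma left_side_sym:
  assumes "c \<in> pts n" "\<bar>c\<bar> < int n"
  shows "c \<in> left_side \<longleftrightarrow> - c \<notin> left_side"
proof (cases "c > 0")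
  case True
  then show ?thesis using left_side_iff(1)[of c] left_side_iff(2)[of "- c"] L_or_R[of c] assms by simp
next
  case False
  then have "c < 0" using assms by (simp add: signed_points_iff)
  then show ?thesis using left_side_iff(2)[of c] left_side_iff(1)[of "- c"] L_or_R[of "- c"] assms by simp
qed

lemma Max_LR:
  shows "R \<noteq> {} \<Longrightarrow> Max R \<in> R \<and> (\<forall>q \<in> R. q \<le> Max R)"
    and "L \<noteq> {} \<Longrightarrow> Max L \<in> L \<and> (\<forall>q \<in> L. q \<le> Max L)"
    and "R \<subseteq> {1..int n - 1}" "L \<subseteq> {1..int n - 1}"
proof -
  show sub: "R \<subseteq> {1..int n - 1}" "L \<subseteq> {1..int n - 1}" using LR(1) by auto
  have "finite R" "finite L" using sub finite_subset by blast+
  then show "R \<noteq> {} \<Longrightarrow> Max R \<in> R \<and> (\<forall>q \<in> R. q \<le> Max R)" "L \<noteq> {} \<Longrightarrow> Max L \<in> L \<and> (\<forall>q \<in> L. q \<le> Max L)"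
    by auto
qed

lemma reachesD:
  assumes C: "weak_congruence n \<theta>" and r: "reaches \<theta> b a"
    and e: "edge_on n left_side u v b a"
  shows "(u, v) \<in> \<theta>"
proof -
  obtain x y where "edge_on n left_side x y b a" "(x, y) \<in> \<theta>" using r unfolding reaches_def by blast
  then show ?thesis using same_arc[OF C _ e] by blast
qed

text \<open>As \<open>left_side\<close> is symmetric, c and - c are never both moved outwards. Of
  the separation required by \<open>hexagon\<close> only the conditions at a, e and b
  remain.\<close>

lemma reaches_hexagon:
  fixes s :: int
  assumes C: "weak_congruence n \<theta>"
    and h: "reaches \<theta> e a \<or> reaches \<theta> b e"
    and pts: "a \<in> pts n" "e \<in> pts n" "b \<in> pts n"
    and ord: "a < e" "e < b" and ne: "b \<noteq> - a" "e \<noteq> - a" "e \<noteq> - b" and s: "s = 1 \<or> s = - 1"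
    and sep: "\<And>c. c \<in> pts n \<Longrightarrow> a < c \<Longrightarrow> c < b \<Longrightarrow> c \<noteq> e \<Longrightarrow> (c \<in> left_side \<longleftrightarrow> s = - 1) \<Longrightarrow>
       - c \<noteq> a \<and> - c \<noteq> b \<and> - c \<noteq> e"
  shows "reaches \<theta> b a"
proof -
  let ?X = "{c \<in> pts n. a < c \<and> c < b \<and> c \<noteq> e \<and> (c \<in> left_side \<longleftrightarrow> s = - 1)}"
  have X: "- c \<notin> ?X \<and> - c \<noteq> a \<and> - c \<noteq> b \<and> - c \<noteq> e" if "c \<in> ?X" for c
  proof -
    have "\<bar>c\<bar> < int n" using that pts by (auto simp: signed_points_iff abs_less_iff)
    then show ?thesis using sep[of c] left_side_sym[of c] that by auto
  qed
  have "\<exists>u v w x y. edge_on n left_side u v e a \<and> edge_on n left_side u w b e \<and> edge_on n left_side x y b a \<and>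
    (\<forall>\<theta>. weak_congruence n \<theta> \<longrightarrow> (u, v) \<in> \<theta> \<or> (u, w) \<in> \<theta> \<longrightarrow> (x, y) \<in> \<theta>)"
    by (rule hexagon[OF pts ord ne s refl X])
  then obtain u v w x y where H: "edge_on n left_side u v e a" "edge_on n left_side u w b e" "edge_on n left_side x y b a"
    "\<forall>\<theta>. weak_congruence n \<theta> \<longrightarrow> (u, v) \<in> \<theta> \<or> (u, w) \<in> \<theta> \<longrightarrow> (x, y) \<in> \<theta>"
    by (elim exE conjE) (rule that)
  have "(u, v) \<in> \<theta> \<or> (u, w) \<in> \<theta>"
  proof (rule disjE[OF h])
    assume "reaches \<theta> e a"
    then have "(u, v) \<in> \<theta>" by (rule reachesD[OF C _ H(1)])
    then show ?thesis ..
  next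
    assume "reaches \<theta> b e"
    then have "(u, w) \<in> \<theta>" by (rule reachesD[OF C _ H(2)])
    then show ?thesis ..
  qed
  note H4 = H(4)[rule_format, OF C this]
  show ?thesis unfolding reaches_def by (rule exI[of _ x], rule exI[of _ y], rule conjI[OF H(3) H4])
qed

lemma octagon_left_side:
  assumes e: "0 < e" "e < int n"
  shows "\<exists>u v w x y z t. edge_on n left_side u v e (- e) \<and> edge_on n left_side u w (int n) e \<and>
    edge_on n left_side x y (int n) (- int n) \<and> edge_on n left_side z t (int n) (- e) \<and>
    (\<forall>\<theta>. weak_congruence n \<theta> \<longrightarrow> (u, v) \<in> \<theta> \<or> (u, w) \<in> \<theta> \<longrightarrow> (x, y) \<in> \<theta> \<and> (z, t) \<in> \<theta>)"
proof (rule octagon)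
  show "e \<in> pts n" "int n \<in> pts n" using e n by (simp_all add: signed_points_iff)
qed (rule e left_side_sym; assumption)+

lemma reaches_octagon:
  assumes C: "weak_congruence n \<theta>" and e: "0 < e" "e < int n"
    and h: "reaches \<theta> e (- e) \<or> reaches \<theta> (int n) e"
  shows "reaches \<theta> (int n) (- int n)"
proof -
  obtain u v w x y z t where H: "edge_on n left_side u v e (- e)" "edge_on n left_side u w (int n) e"
    "edge_on n left_side x y (int n) (- int n)"
    "\<And>\<theta>. weak_congruence n \<theta> \<Longrightarrow> (u, v) \<in> \<theta> \<or> (u, w) \<in> \<theta> \<Longrightarrow> (x, y) \<in> \<theta> \<and> (z, t) \<in> \<theta>"
    using octagon_left_side[OF e] by blast
  have "(u, v) \<in> \<theta> \<or> (u, w) \<in> \<theta>"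
  proof (rule disjE[OF h])
    assume "reaches \<theta> e (- e)"
    then have "(u, v) \<in> \<theta>" by (rule reachesD[OF C _ H(1)])
    then show ?thesis ..
  next
    assume "reaches \<theta> (int n) e"
    then have "(u, w) \<in> \<theta>" by (rule reachesD[OF C _ H(2)])
    then show ?thesis ..
  qed
  note H4 = H(4)[OF C this]
  show ?thesis unfolding reaches_def by (rule exI[of _ x], rule exI[of _ y], rule conjI[OF H(3) conjunct1[OF H4]])
qed

lemma edge_on_left_side_uminus:
  assumes e: "edge_on n left_side x y b a"
  shows "edge_on n left_side x y (- a) (- b)"
proof (rule edge_on_cong[OF edge_on_uminus[OF e]])
  fix c assume c: "c \<in> pts n" "- b < c" "c < - a"
  then have "\<bar>c\<bar> < int n"
    using edgeD(3,4)[OF edge_onD[OF e]] by (auto simp: signed_points_iff abs_less_iff)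
  then show "c \<in> {c. - c \<notin> left_side} \<longleftrightarrow> c \<in> left_side" using left_side_sym[OF c(1)] by simp
qed

lemma edge_reaches_maximal:
  assumes C: "weak_congruence n \<theta>"
    and e: "edge_on n left_side x y b a" and xy: "(x, y) \<in> \<theta>"
  shows "reaches \<theta> (int n) (- int n) \<or> (R \<noteq> {} \<and> reaches \<theta> (int n) (- Max R)) \<or>
    (L \<noteq> {} \<and> reaches \<theta> (int n) (- Max L))"
proof -
  have main: ?thesis if r: "reaches \<theta> b a" and ba: "b \<ge> - a" for b a
  proof -
    have "edge n x y b a" if "edge_on n left_side x y b a" for x y using edge_onD[OF that] .
    then have pts: "a \<in> pts n" "b \<in> pts n" "a < b"
      using r edgeD(3-5) unfolding reaches_def by blast+
    have np: "int n \<in> pts n" using n by (simp add: signed_points_iff)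
    have rng: "- int n \<le> a" "b \<le> int n" "a \<noteq> 0" "b \<noteq> 0" using pts by (auto simp: signed_points_iff)
    show ?thesis
    proof (cases "b = - a")
      case True
      then have "b > 0" using pts by simp
      then show ?thesis
        using reaches_octagon[OF C, of b] r True rng by (cases "b = int n") auto
    next
      case False
      then have ba': "b > - a" using ba by simp
      have top: "reaches \<theta> (int n) a"
      proof (cases "b = int n")
        case False
        then have bn: "b < int n" using rng by simp
        \<comment> \<open>The only point that could collide when the upper end moves from b to n is
          - a. The sign is chosen so that it is not moved outwards: s = - 1 moves left points, s = 1
          moves right points.\<close>
        define s :: int where "s = (if a < 0 \<and> - a \<in> R then - 1 else 1)"
        show ?thesis
        proof (rule reaches_hexagon[OF C, of b a "int n" s])
          fix c assume c: "c \<in> pts n" "a < c" "c < int n" "c \<noteq> b" "c \<in> left_side \<longleftrightarrow> s = - 1"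
          have "- c \<noteq> a"
          proof
            assume "- c = a"
            then have ca: "c = - a" "c > 0" using c(2) by auto
            then have "c \<in> R \<longleftrightarrow> c \<notin> L" using L_or_R c(3) by simp
            then show False using c(5) ca left_side_iff(1)[of c] unfolding s_def by (auto split: if_splits)
          qed
          then show "- c \<noteq> a \<and> - c \<noteq> int n \<and> - c \<noteq> b" using c rng ba' by auto
        qed (use r pts np bn ba' rng in \<open>auto simp: s_def\<close>)
      qed (use r in simp)
      show ?thesis
      proof (cases "a > 0")
        case True
        then show ?thesis using reaches_octagon[OF C, of a] top pts rng by auto
      next
        case False
        define q where "q = - a"
        have q: "q > 0" "a = - q" "q < int n" using False ba' rng unfolding q_def by auto
        \<comment> \<open>The arc down to - m is cut at - q. Neither m nor q may be moved outwards,
          so both must be on the same side: right points stay for s = - 1, left points for s =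
          1.\<close>
        have ext: "reaches \<theta> (int n) (- m)"
          if m: "m \<in> X" "q \<le> m" "m < int n" and X: "q \<in> X"
            and s: "(X = R \<and> s = - 1) \<or> (X = L \<and> s = 1)" for X m and s :: int
        proof (cases "q = m")
          case False
          show ?thesis
          proof (rule reaches_hexagon[OF C, of "- q" "- m" "int n" s])
            fix c assume c: "c \<in> pts n" "- m < c" "c < int n" "c \<noteq> - q" "c \<in> left_side \<longleftrightarrow> s = - 1"
            have "c \<noteq> z" if "z \<in> X" "0 < z" "z < int n" for z
              using c(5) left_side_iff(1)[OF that(2)] L_or_R[OF that(2,3)] s that(1) by auto
            then show "- c \<noteq> - m \<and> - c \<noteq> int n \<and> - c \<noteq> - q" using m X q c by auto
          qed (use top q m np s False in \<open>auto simp: signed_points_iff\<close>)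
        qed (use top q in simp)
        show ?thesis
        proof (cases "q \<in> R")
          case True
          then have "reaches \<theta> (int n) (- Max R)"
            using ext[of "Max R" R "- 1"] Max_LR(1,3) by force
          then show ?thesis using True by auto
        next
          case False
          then have "q \<in> L" using L_or_R q by blast
          then have "reaches \<theta> (int n) (- Max L)"
            using ext[of "Max L" L 1] Max_LR(2,4) by force
          then show ?thesis using \<open>q \<in> L\<close> by auto
        qed
      qed
    qed
  qed
  show ?thesis
  proof (cases "b \<ge> - a")
    case True
    then show ?thesis using main e xy unfolding reaches_def by blast
  next
    case False
    have "edge_on n left_side x y (- a) (- b)" using edge_on_left_side_uminus[OF e] .
    then have "reaches \<theta> (- a) (- b)" using xy unfolding reaches_def by blast
    then show ?thesis using main False by simp
  qed
qed

section \<open>The generators and their misplaced points\<close>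

lemma lower_cover_edge:
  assumes j: "j \<in> signed_perms n" and i: "0 \<le> i" "i < int n"
    and desc: "j (i + 1) < j (if i = 0 then - 1 else i)"
    and asc: "\<And>k. 0 \<le> k \<Longrightarrow> k < int n \<Longrightarrow> k \<noteq> i \<Longrightarrow> j (if k = 0 then - 1 else k) < j (k + 1)"
  shows "edge n (lower_cover n j) j (j (if i = 0 then - 1 else i)) (j (i + 1))"
proof -
  let ?x = "j \<circ> simple_refl i"
  have x: "?x \<in> signed_perms n" using signed_perms_comp[OF j simple_refl_in] i by simp
  have inv: "w \<circ> simple_refl k \<circ> simple_refl k = w" if "0 \<le> k" for w :: "int \<Rightarrow> int" and k
    using simple_refl_involution[OF that] by (auto simp: fun_eq_iff)
  have val: "(w \<circ> simple_refl k) (if k = 0 then - 1 else k) = w (k + 1)"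
    "(w \<circ> simple_refl k) (k + 1) = w (if k = 0 then - 1 else k)" if "0 \<le> k" for w :: "int \<Rightarrow> int" and k
    using that by (auto simp: simple_refl_def transpose_def)
  have e: "edge n ?x j (j (if i = 0 then - 1 else i)) (j (i + 1))"
  proof (cases "i = 0")
    case True
    then show ?thesis
      using weak_covers_edge(1)[OF x n_pos] val[OF i(1), of j] inv[OF i(1), of j] desc by simp
  next
    case False
    then show ?thesis
      using weak_covers_edge(2)[OF x n_pos, of i] val[OF i(1), of j] inv[OF i(1), of j] desc i by simp
  qed
  \<comment> \<open>Passing to a lower cover undoes a descent, and j descends only at i.\<close>
  have uniq: "\<pi> = ?x" if c: "weak_covers n j \<pi>" for \<pi>
  proof -
    obtain k where k: "0 \<le> k" "k < int n" "\<pi> (if k = 0 then - 1 else k) < \<pi> (k + 1)" "j = \<pi> \<circ> simple_refl k"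
    proof -
      have "\<pi> (- 1) < \<pi> 1 \<and> j = \<pi> \<circ> simple_refl 0 \<or>
          (\<exists>k \<in> {1..int n - 1}. \<pi> k < \<pi> (k + 1) \<and> j = \<pi> \<circ> simple_refl k)"
        using c unfolding weak_covers_def by blast
      then show thesis
      proof
        assume "\<pi> (- 1) < \<pi> 1 \<and> j = \<pi> \<circ> simple_refl 0"
        then show thesis using that[of 0] n_pos by simp
      next
        assume "\<exists>k \<in> {1..int n - 1}. \<pi> k < \<pi> (k + 1) \<and> j = \<pi> \<circ> simple_refl k"
        then obtain k where "k \<in> {1..int n - 1}" "\<pi> k < \<pi> (k + 1)" "j = \<pi> \<circ> simple_refl k" by blast
        then show thesis using that[of k] by simp
      qed
    qed
    have "j (k + 1) < j (if k = 0 then - 1 else k)" unfolding k(4) val[OF k(1)] using k(3) .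
    then have "k = i" using asc[OF k(1,2)] by linarith
    then show ?thesis using inv[OF i(1), of \<pi>] k(4) by simp
  qed
  have "lower_cover n j = ?x"
    unfolding lower_cover_def by (rule the_equality, rule edge_imp_weak_covers[OF e], erule uniq)
  then show ?thesis using e by simp
qed

text \<open>d is the misplaced point: (d + 1, d) being an inversion puts d to the right of the arc,
  the wrong side exactly for a left point.\<close>

definition contracted_edge :: "int \<Rightarrow> int \<Rightarrow> (int \<Rightarrow> int) \<Rightarrow> bool" where
  "contracted_edge d a j \<longleftrightarrow> edge n (lower_cover n j) j (d + 1) a \<and> ((d + 1, d) \<in> invs n j \<longleftrightarrow> d \<in> L)"

text \<open>Tailored to explicit words: i is the only descent, p and q are the positions of d + 1
  and d, and the exchanged pair may be given up to the half-turn.\<close>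

lemma contracted_edgeI:
  assumes j: "j \<in> signed_perms n" and i: "0 \<le> i" "i < int n"
    and desc: "j (if i = 0 then - 1 else i) = b" "j (i + 1) = a" "a < b"
    and asc: "\<And>k. 1 \<le> k \<Longrightarrow> k < int n \<Longrightarrow> k \<noteq> i \<Longrightarrow> j k < j (k + 1)" "i \<noteq> 0 \<Longrightarrow> 0 < j 1"
    and d: "(b, a) = (d + 1, c) \<or> (b, a) = (- c, - d - 1)"
    and pq: "j p = d + 1" "j q = d" "p < q \<longleftrightarrow> d \<in> L" "0 < d" "d < int n"
  shows "contracted_edge d c j"
proof -
  have "edge n (lower_cover n j) j (j (if i = 0 then - 1 else i)) (j (i + 1))"
  proof (rule lower_cover_edge[OF j i])
    show "j (i + 1) < j (if i = 0 then - 1 else i)" using desc by simp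
    show "j (if k = 0 then - 1 else k) < j (k + 1)" if "0 \<le> k" "k < int n" "k \<noteq> i" for k
      using asc(1)[of k] asc(2) that signed_perms_uminus[OF j, of 1] by auto
  qed
  then have e: "edge n (lower_cover n j) j b a" unfolding desc .
  have "edge n (lower_cover n j) j (d + 1) c" using d e edge_uminus[OF e] by (auto simp: add.commute)
  moreover have "(d + 1, d) \<in> invs n j \<longleftrightarrow> d \<in> L"
    using pq signed_perms_inverses(2)[OF j, of p] signed_perms_inverses(2)[OF j, of q]
    by (auto simp: invs_iff signed_points_iff)
  ultimately show ?thesis by (simp add: contracted_edge_def)
qed

text \<open>The instances list i, b, a, d, c, p, q. For example, 2 (-1) descends at 1 from 2 to - 1,
  and its entry 1 stands at position - 2, hence to the left of the arc: wrong for a right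
  point.\<close>

lemma contracted_edge_generators:
  shows "1 \<in> R \<Longrightarrow> contracted_edge 1 (- 1) (simple_refl 0 \<circ> simple_refl 1)"
    and "1 \<in> R \<Longrightarrow> contracted_edge 1 (- 2) (simple_refl 0 \<circ> simple_refl 1 \<circ> simple_refl 0)"
    and "1 \<in> L \<Longrightarrow> contracted_edge 1 (- 2) (simple_refl 1 \<circ> simple_refl 0)"
    and "1 \<in> L \<Longrightarrow> contracted_edge 1 (- 1) (simple_refl 1 \<circ> simple_refl 0 \<circ> simple_refl 1)"
    and "d \<in> {2..int n - 1} \<Longrightarrow> d \<in> R \<Longrightarrow> contracted_edge d (d - 1) (simple_refl (d - 1) \<circ> simple_refl d)"
    and "d \<in> {2..int n - 1} \<Longrightarrow> d \<in> L \<Longrightarrow> contracted_edge d (d - 1) (simple_refl d \<circ> simple_refl (d - 1))"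
proof -
  have s: "simple_refl k \<in> signed_perms n" if "0 \<le> k" "k < int n" for k using simple_refl_in that by simp
  have v: "simple_refl k x = (if k = 0 then (if x = 1 then - 1 else if x = - 1 then 1 else x)
      else if x = k then k + 1 else if x = k + 1 then k else if x = - k then - k - 1 else if x = - k - 1 then - k else x)"
    if "0 \<le> k" for k x
    using that by (auto simp: simple_refl_def transpose_def)
  have vp: "simple_refl k x = (if x = k then k + 1 else if x = k + 1 then k else x)" if "1 \<le> k" "1 \<le> x" for k x
    using v[of k x] that by auto
  have nL: "c \<notin> L" if "c \<in> R" for c using LR(2) that by blast
  show "contracted_edge 1 (- 1) (simple_refl 0 \<circ> simple_refl 1)" if "1 \<in> R"
    by (rule contracted_edgeI[of _ 1 2 "- 1" 1 "- 1" 1 "- 2"])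
      (use n nL[OF that] in \<open>auto simp: v signed_perms_comp s\<close>)
  show "contracted_edge 1 (- 2) (simple_refl 0 \<circ> simple_refl 1 \<circ> simple_refl 0)" if "1 \<in> R"
    by (rule contracted_edgeI[of _ 0 2 "- 2" 1 "- 2" "- 1" "- 2"])
      (use n nL[OF that] in \<open>auto simp: v signed_perms_comp s\<close>)
  show "contracted_edge 1 (- 2) (simple_refl 1 \<circ> simple_refl 0)" if "1 \<in> L"
    by (rule contracted_edgeI[of _ 0 2 "- 2" 1 "- 2" "- 1" 2])
      (use n that in \<open>auto simp: v signed_perms_comp s\<close>)
  show "contracted_edge 1 (- 1) (simple_refl 1 \<circ> simple_refl 0 \<circ> simple_refl 1)" if "1 \<in> L"
    by (rule contracted_edgeI[of _ 1 1 "- 2" 1 "- 1" "- 2" 1])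
      (use n that in \<open>auto simp: v signed_perms_comp s\<close>)
  show "contracted_edge d (d - 1) (simple_refl (d - 1) \<circ> simple_refl d)" if "d \<in> {2..int n - 1}" "d \<in> R"
    by (rule contracted_edgeI[of _ d "d + 1" "d - 1" d "d - 1" d "d - 1"])
      (use that nL[OF that(2)] in \<open>simp_all add: vp signed_perms_comp s\<close>)
  show "contracted_edge d (d - 1) (simple_refl d \<circ> simple_refl (d - 1))" if "d \<in> {2..int n - 1}" "d \<in> L"
    by (rule contracted_edgeI[of _ "d - 1" "d + 1" "d - 1" d "d - 1" "d - 1" "d + 1"])
      (use that in \<open>simp_all add: vp signed_perms_comp s\<close>)
qed

text \<open>Supplies the shortest arcs at which the induction of
  \<open>misplaced_point_contracted\<close> ends.\<close>

lemma generators_complete: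
  shows "2 \<le> d \<Longrightarrow> d < int n \<Longrightarrow> \<exists>j \<in> cambrian_generators n L R. contracted_edge d (d - 1) j"
    and "\<exists>j \<in> cambrian_generators n L R. contracted_edge 1 (- 1) j"
    and "\<exists>j \<in> cambrian_generators n L R. contracted_edge 1 (- 2) j"
proof -
  have 1: "1 \<in> R \<or> 1 \<in> L" using L_or_R[of 1] n by auto
  show "\<exists>j \<in> cambrian_generators n L R. contracted_edge 1 (- 1) j"
    "\<exists>j \<in> cambrian_generators n L R. contracted_edge 1 (- 2) j"
    using 1 contracted_edge_generators(1-4) unfolding cambrian_generators_def by auto
  show "\<exists>j \<in> cambrian_generators n L R. contracted_edge d (d - 1) j" if d: "2 \<le> d" "d < int n"
  proof (cases "d \<in> L")
    case True
    then have "simple_refl d \<circ> simple_refl (d - 1) \<in> cambrian_generators n L R"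
      using d unfolding cambrian_generators_def by auto
    then show ?thesis using contracted_edge_generators(6)[of d] True d by auto
  next
    case False
    then have R: "d \<in> R" using L_or_R d by simp
    then have "simple_refl (d - 1) \<circ> simple_refl d \<in> cambrian_generators n L R"
      using d unfolding cambrian_generators_def by auto
    then show ?thesis using contracted_edge_generators(5)[of d] R d by auto
  qed
qed

lemma generators_sound:
  assumes "j \<in> cambrian_generators n L R"
  shows "\<exists>d a. 0 < d \<and> d < int n \<and> a < d \<and> contracted_edge d a j"
proof -
  have one: "?thesis" if "contracted_edge 1 a j" "a < 0" for a
    using that n by (intro exI[of _ 1] exI[of _ a]) simp
  have i: "?thesis" if "contracted_edge d (d - 1) j" "d \<in> {2..int n - 1}" for d
    using that by (intro exI[of _ d] exI[of _ "d - 1"]) simp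
  consider "1 \<in> R" "j = simple_refl 0 \<circ> simple_refl 1"
    | "1 \<in> R" "j = simple_refl 0 \<circ> simple_refl 1 \<circ> simple_refl 0"
    | "1 \<in> L" "j = simple_refl 1 \<circ> simple_refl 0"
    | "1 \<in> L" "j = simple_refl 1 \<circ> simple_refl 0 \<circ> simple_refl 1"
    | d where "d \<in> {2..int n - 1}" "d \<in> R" "j = simple_refl (d - 1) \<circ> simple_refl d"
    | d where "d \<in> {2..int n - 1}" "d \<in> L" "j = simple_refl d \<circ> simple_refl (d - 1)"
    using assms unfolding cambrian_generators_def by (auto split: if_splits)
  then show ?thesis
  proof cases
    case 1 then show ?thesis using contracted_edge_generators(1) one[of "- 1"] by simp
  next
    case 2 then show ?thesis using contracted_edge_generators(2) one[of "- 2"] by simp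
  next
    case 3 then show ?thesis using contracted_edge_generators(3) one[of "- 2"] by simp
  next
    case 4 then show ?thesis using contracted_edge_generators(4) one[of "- 1"] by simp
  next
    case (5 d) then show ?thesis using contracted_edge_generators(5)[of d] i[of d] by simp
  next
    case (6 d) then show ?thesis using contracted_edge_generators(6)[of d] i[of d] by simp
  qed
qed

lemma edge_on_canonical: "edge n x y b a \<Longrightarrow> edge_on n {c. (b, c) \<notin> invs n y} x y b a"
  by (simp add: edge_on_def)

abbreviation generating_pairs :: "(int \<Rightarrow> int) rel" where
  "generating_pairs \<equiv> {(j, lower_cover n j) | j. j \<in> cambrian_generators n L R}"

lemma generating_pairs_in_shard_congruence:
  "generating_pairs \<subseteq> shard_congruence n left_side"
proof (rule subrelI)
  fix x y assume "(x, y) \<in> generating_pairs"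
  then have x: "x \<in> cambrian_generators n L R" "y = lower_cover n x" by auto
  obtain d a where d: "0 < d" "d < int n" "a < d" "edge n y x (d + 1) a" "(d + 1, d) \<in> invs n x \<longleftrightarrow> d \<in> L"
    using generators_sound[OF x(1)] x(2) unfolding contracted_edge_def by blast
  have "d \<in> pts n" using d by (simp add: signed_points_iff)
  then have "\<not> edge_on n left_side y x (d + 1) a"
    using d left_side_iff(1)[OF d(1)] unfolding edge_on_def by auto
  then have "(y, x) \<in> shard_congruence n left_side"
    using edge_in_shard_congruence(2)[OF d(4) left_side_sym] by blast
  then show "(x, y) \<in> shard_congruence n left_side"
    by (rule weak.congruence_sym[OF lattice_congruence_shard_congruence])
qed

lemma cambrian_congruence_lattice:
  "weak_congruence n (cambrian_congruence n L R)"
  unfolding cambrian_congruence_def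
proof (rule weak.congruence_hull)
  have "shard_congruence n left_side \<subseteq> carrier (weak_order n) \<times> carrier (weak_order n)"
    by (auto simp: shard_congruence_def)
  then show "generating_pairs \<subseteq> carrier (weak_order n) \<times> carrier (weak_order n)"
    using generating_pairs_in_shard_congruence by (rule subset_trans[rotated])
qed

lemma cambrian_congruence_eq: "cambrian_congruence n L R = shard_congruence n left_side"
proof
  show "cambrian_congruence n L R \<subseteq> shard_congruence n left_side"
    unfolding cambrian_congruence_def
    using generating_pairs_in_shard_congruence lattice_congruence_shard_congruence by (rule hull_minimal)
  note C = cambrian_congruence_lattice
  have gen: "\<exists>\<Lambda> x y. edge_on n \<Lambda> x y (d + 1) a \<and> (d \<in> \<Lambda> \<longleftrightarrow> d \<notin> left_side) \<and> (x, y) \<in> cambrian_congruence n L R"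
    if "0 < d" and ex: "\<exists>j \<in> cambrian_generators n L R. contracted_edge d a j" for d a
  proof -
    obtain j where j: "j \<in> cambrian_generators n L R" "edge n (lower_cover n j) j (d + 1) a"
      "(d + 1, d) \<in> invs n j \<longleftrightarrow> d \<in> L"
      using ex unfolding contracted_edge_def by blast
    have "(j, lower_cover n j) \<in> cambrian_congruence n L R"
      unfolding cambrian_congruence_def using j(1) by (intro hull_inc) auto
    then have "(lower_cover n j, j) \<in> cambrian_congruence n L R" by (rule weak.congruence_sym[OF C])
    moreover have "d \<in> {c. (d + 1, c) \<notin> invs n j} \<longleftrightarrow> d \<notin> left_side"
      using j(3) left_side_iff(1)[OF \<open>0 < d\<close>] by simp
    ultimately show ?thesis using edge_on_canonical[OF j(2)] by blast
  qed
  show "shard_congruence n left_side \<subseteq> cambrian_congruence n L R"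
  proof (rule congruence_subset_if_edges[OF n_pos lattice_congruence_shard_congruence C])
    fix x y b a assume e: "edge n x y b a" and xy: "(x, y) \<in> shard_congruence n left_side"
    have "\<not> edge_on n left_side x y b a" using edge_in_shard_congruence(1)[OF e] xy by blast
    then obtain d where d: "d \<in> pts n" "a < d" "d < b"
      "\<not> ((b, d) \<in> invs n y \<longleftrightarrow> d \<notin> left_side)"
      using e unfolding edge_on_def by blast
    show "(x, y) \<in> cambrian_congruence n L R"
    proof (rule misplaced_point_contracted[OF C left_side_sym _ _ _ edge_on_canonical[OF e] d(1-3)])
      show "d \<in> {c. (b, c) \<notin> invs n y} \<longleftrightarrow> d \<notin> left_side" using d(4) by simp
      show "\<exists>\<Lambda> x y. edge_on n \<Lambda> x y (k + 1) (k - 1) \<and> (k \<in> \<Lambda> \<longleftrightarrow> k \<notin> left_side) \<and>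
          (x, y) \<in> cambrian_congruence n L R" if "2 \<le> k" "k < int n" for k
        using gen[OF _ generators_complete(1)[OF that]] that by simp
      show "\<exists>\<Lambda> x y. edge_on n \<Lambda> x y 2 (- 1) \<and> (1 \<in> \<Lambda> \<longleftrightarrow> 1 \<notin> left_side) \<and> (x, y) \<in> cambrian_congruence n L R"
        using gen[OF _ generators_complete(2)] by simp
      show "\<exists>\<Lambda> x y. edge_on n \<Lambda> x y 2 (- 2) \<and> (1 \<in> \<Lambda> \<longleftrightarrow> 1 \<notin> left_side) \<and> (x, y) \<in> cambrian_congruence n L R"
        using gen[OF _ generators_complete(3)] by simp
    qed
  qed
qed

section \<open>The three maximal arcs and the meet of their congruences\<close>

definition side_arc :: "int \<Rightarrow> int \<Rightarrow> arc set" where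
  "side_arc p q = orbifold_image (Arc p q {c \<in> pts n. c \<in> left_side \<and> q < c \<and> c < p}
    {c \<in> pts n. c \<notin> left_side \<and> q < c \<and> c < p})"

lemma uminus_image_iff: "c \<in> uminus ` A \<longleftrightarrow> - c \<in> A" for c :: int
  by (auto intro!: image_eqI[of _ uminus "- c"])

lemma beta_eq_side_arc:
  shows "beta_o n L R = side_arc (int n) (- int n)"
    and "R \<noteq> {} \<Longrightarrow> beta_r n L R = side_arc (int n) (- Max R)"
    and "L \<noteq> {} \<Longrightarrow> beta_l n L R = side_arc (Max L) (- int n)"
proof -
  have arcs: "Arc p q A B = Arc p q {c \<in> pts n. c \<in> left_side \<and> q < c \<and> c < p}
      {c \<in> pts n. c \<notin> left_side \<and> q < c \<and> c < p}"
    if "- int n \<le> q" "p \<le> int n"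
      and "\<And>c. 0 < c \<Longrightarrow> (c \<in> A \<longleftrightarrow> c \<in> L \<and> q < c \<and> c < p) \<and> (c \<in> B \<longleftrightarrow> c \<notin> L \<and> q < c \<and> c < p)"
      and "\<And>c. c < 0 \<Longrightarrow> (c \<in> A \<longleftrightarrow> - c \<in> R \<and> q < c \<and> c < p) \<and> (c \<in> B \<longleftrightarrow> - c \<notin> R \<and> q < c \<and> c < p)"
      and "0 \<notin> A" "0 \<notin> B" for p q A B
  proof -
    have "(c \<in> A \<longleftrightarrow> c \<in> pts n \<and> c \<in> left_side \<and> q < c \<and> c < p) \<and>
        (c \<in> B \<longleftrightarrow> c \<in> pts n \<and> c \<notin> left_side \<and> q < c \<and> c < p)" for c
    proof -
      consider "c > 0" | "c < 0" | "c = 0" by linarith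
      then show ?thesis
      proof cases
        case 1
        then show ?thesis using that(1,2) that(3)[OF 1] left_side_iff(1)[OF 1] by (auto simp: signed_points_iff)
      next
        case 2
        then show ?thesis using that(1,2) that(4)[OF 2] left_side_iff(2)[OF 2] by (auto simp: signed_points_iff)
      next
        case 3
        then show ?thesis using that(5,6) by (simp add: signed_points_iff)
      qed
    qed
    then show ?thesis by blast
  qed
  have rng: "c \<in> L \<Longrightarrow> 0 < c \<and> c < int n" "c \<in> R \<Longrightarrow> 0 < c \<and> c < int n" for c
    using Max_LR(3,4) by auto
  have nL: "c \<in> R \<longleftrightarrow> c \<notin> L" if "0 < c" "c < int n" for c using L_or_R[OF that] .
  show "beta_o n L R = side_arc (int n) (- int n)"
    unfolding beta_o_def orbifold_arc_def side_arc_def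
    by (rule arg_cong[of _ _ orbifold_image], rule arcs)
      (use nL in \<open>auto simp: uminus_image_iff dest: rng\<close>)
  show "beta_r n L R = side_arc (int n) (- Max R)" if "R \<noteq> {}"
  proof -
    have "0 < Max R" "Max R < int n" using Max_LR(1)[OF that] rng by auto
    then show ?thesis
      unfolding beta_r_def long_arc_def side_arc_def
      by (intro arg_cong[of _ _ orbifold_image] arcs) (auto simp: uminus_image_iff dest: rng)
  qed
  show "beta_l n L R = side_arc (Max L) (- int n)" if "L \<noteq> {}"
  proof -
    have "0 < Max L" "Max L < int n" using Max_LR(2)[OF that] rng by auto
    then show ?thesis
      unfolding beta_l_def long_arc_def side_arc_def
      by (intro arg_cong[of _ _ orbifold_image] arcs) (auto simp: uminus_image_iff dest: rng)
  qed
qed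

text \<open>The middle edges of an octagon with b = n realise the central arc and the long arcs
  ending at - m. The arc for the highest left point is the half-turn of such a long arc.\<close>

lemma maximal_edges_exist:
  shows "\<exists>x y. edge_on n left_side x y (int n) (- int n)"
    and "R \<noteq> {} \<Longrightarrow> \<exists>x y. edge_on n left_side x y (int n) (- Max R)"
    and "L \<noteq> {} \<Longrightarrow> \<exists>x y. edge_on n left_side x y (Max L) (- int n)"
proof -
  show "\<exists>x y. edge_on n left_side x y (int n) (- int n)" using octagon_left_side[of 1] n by auto
  have long: "\<exists>x y. edge_on n left_side x y (int n) (- m)" if "0 < m" "m < int n" for m
    using octagon_left_side[OF that] by blast
  show "\<exists>x y. edge_on n left_side x y (int n) (- Max R)" if "R \<noteq> {}"
    by (rule long) (use Max_LR(1)[OF that] Max_LR(3) in auto)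
  show "\<exists>x y. edge_on n left_side x y (Max L) (- int n)" if "L \<noteq> {}"
  proof -
    have "\<exists>x y. edge_on n left_side x y (int n) (- Max L)"
      by (rule long) (use Max_LR(2)[OF that] Max_LR(4) in auto)
    then obtain x y where "edge_on n left_side x y (int n) (- Max L)" by blast
    then have "edge_on n left_side x y (- (- Max L)) (- int n)" by (rule edge_on_left_side_uminus)
    then show ?thesis by auto
  qed
qed

lemma cambrian_meet:
  assumes \<Psi>: "\<Psi> = {arc_congruence n (beta_o n L R)} \<union>
             (if R \<noteq> {} then {arc_congruence n (beta_r n L R)} else {}) \<union>
             (if L \<noteq> {} then {arc_congruence n (beta_l n L R)} else {})"
  shows "(\<forall>\<theta>\<in>\<Psi>. meet_irreducible (congruences (weak_order n)) \<theta>) \<and>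
         is_glb (congruences (weak_order n)) (cambrian_congruence n L R) \<Psi>"
proof -
  let ?C = "cambrian_congruence n L R"
  note C = cambrian_congruence_lattice
  have cases: "\<exists>p q x y. \<theta> = arc_congruence n (side_arc p q) \<and> edge_on n left_side x y p q" if \<theta>: "\<theta> \<in> \<Psi>" for \<theta>
  proof -
    consider "\<theta> = arc_congruence n (beta_o n L R)"
      | "R \<noteq> {}" "\<theta> = arc_congruence n (beta_r n L R)" | "L \<noteq> {}" "\<theta> = arc_congruence n (beta_l n L R)"
      using \<theta> unfolding \<Psi> by (auto split: if_splits)
    then show ?thesis
    proof cases
      case 1 then show ?thesis using maximal_edges_exist(1) beta_eq_side_arc(1) by metis
    next
      case 2 then show ?thesis using maximal_edges_exist(2) beta_eq_side_arc(2) by metis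
    next
      case 3 then show ?thesis using maximal_edges_exist(3) beta_eq_side_arc(3) by metis
    qed
  qed
  have mem: "arc_congruence n (side_arc (int n) (- int n)) \<in> \<Psi>"
    "R \<noteq> {} \<Longrightarrow> arc_congruence n (side_arc (int n) (- Max R)) \<in> \<Psi>"
    "L \<noteq> {} \<Longrightarrow> arc_congruence n (side_arc (Max L) (- int n)) \<in> \<Psi>"
    using beta_eq_side_arc unfolding \<Psi> by simp_all
  note sep = arc_congruence_separates[OF n_pos, where M = left_side, folded side_arc_def]
  have irr: "meet_irreducible (congruences (weak_order n)) \<theta>" and cong: "weak_congruence n \<theta>"
    and above: "?C \<subseteq> \<theta>" if \<theta>: "\<theta> \<in> \<Psi>" for \<theta>
  proof -
    obtain p q x y where pq: "\<theta> = arc_congruence n (side_arc p q)" and e: "edge_on n left_side x y p q"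
      using cases[OF \<theta>] by blast
    show "meet_irreducible (congruences (weak_order n)) \<theta>" "weak_congruence n \<theta>"
      unfolding pq using sep(4)[OF e] sep(1)[OF e] .
    have "(x, y) \<notin> ?C"
      unfolding cambrian_congruence_eq using edge_in_shard_congruence(1)[OF edge_onD[OF e] e] .
    then show "?C \<subseteq> \<theta>" unfolding pq by (rule sep(3)[OF e C e])
  qed
  have below: "\<phi> \<subseteq> ?C" if \<phi>: "weak_congruence n \<phi>" and le: "\<And>\<theta>. \<theta> \<in> \<Psi> \<Longrightarrow> \<phi> \<subseteq> \<theta>" for \<phi>
    unfolding cambrian_congruence_eq
  proof (rule congruence_subset_if_edges[OF n_pos \<phi> lattice_congruence_shard_congruence], rule ccontr)
    fix x y b a assume e: "edge n x y b a" and xy: "(x, y) \<in> \<phi>" and no: "(x, y) \<notin> shard_congruence n left_side"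
    have no_arc: False
      if "arc_congruence n (side_arc p q) \<in> \<Psi>" "edge_on n left_side u v p q" "(u, v) \<in> \<phi>" for p q u v
      using sep(2)[OF that(2,2)] le[OF that(1)] that(3) by blast
    have "edge_on n left_side x y b a" using edge_in_shard_congruence(2)[OF e left_side_sym no] .
    from edge_reaches_maximal[OF \<phi> this xy]
    consider "reaches \<phi> (int n) (- int n)" | "R \<noteq> {}" "reaches \<phi> (int n) (- Max R)"
      | "L \<noteq> {}" "reaches \<phi> (int n) (- Max L)" by blast
    then show False
    proof cases
      case 1 then show ?thesis using no_arc mem(1) unfolding reaches_def by blast
    next
      case 2 then show ?thesis using no_arc mem(2) unfolding reaches_def by blast
    next
      case 3
      then obtain u v where uv: "edge_on n left_side u v (int n) (- Max L)" "(u, v) \<in> \<phi>"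
        unfolding reaches_def by blast
      \<comment> \<open>Lengthening ends at the lift from n down to - Max L, whereas
        \<open>beta_l\<close> is represented by the other lift, starting at Max L.\<close>
      have "edge_on n left_side u v (Max L) (- int n)" using edge_on_left_side_uminus[OF uv(1)] by simp
      then show ?thesis using no_arc[OF mem(3)[OF 3(1)]] uv(2) by blast
    qed
  qed
  have "is_glb (congruences (weak_order n)) ?C \<Psi>"
    unfolding greatest_def Lower_def using C cong above below by (auto simp: congruences_def)
  then show ?thesis using irr by blast
qed

end

theorem theorem6p6:
  fixes n :: nat and L R :: "int set" and \<Psi> :: "(int \<Rightarrow> int) rel set"
  assumes "n \<ge> 2"
    and "L \<union> R = {1 .. int n - 1}" and "L \<inter> R = {}"
    and "\<Psi> = {arc_congruence n (beta_o n L R)} \<union>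
             (if R \<noteq> {} then {arc_congruence n (beta_r n L R)} else {}) \<union>
             (if L \<noteq> {} then {arc_congruence n (beta_l n L R)} else {})"
  shows "(\<forall>\<theta>\<in>\<Psi>. meet_irreducible (congruences (weak_order n)) \<theta>) \<and>
         is_glb (congruences (weak_order n)) (cambrian_congruence n L R) \<Psi>"
  using assms by (rule cambrian_meet)

end
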